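(* If $X$ is a compact geodesic surface that is homeomorphic to a subset of the $2$-dimensional sphere, then $c(X)\le 3$.
   Context: A compact geodesic surface is a compact, path-connected metric space $(X,d)$ that is homeomorphic to a surface (possibly with boundary) and is a geodesic space: every two points $x,y\in X$ are joined by a path of length $d(x,y)$ (i.e. $d$ is an intrinsic metric). No further assumption on the metric is made. **Game on a geodesic space.** Let $(X,d)$ be a compact path-connected geodesic space and let $k\ge 1$. The player controlling the robber selects the initial positions $(r^0,c_1^0,\dots,c_k^0)\in X^{k+1}$ of the robber and of the $k$ cops, and an agility function $\tau:\mathbb N\to\mathbb R_+$ with $\sum_{n\ge1}\tau(n)=\infty$. In step $n\ge1$ the robber moves to a point $r^n$ with $d(r^{n-1},r^n)\le\tau(n)$; this is revealed to the cops; then each cop $i$ moves to a point $c_i^n$ with $d(c_i^{n-1},c_i^n)\le\tau(n)$. If $c_i^n=r^n$ for some $i$, the game stops, the cops have caught the robber, and the value of the game is $0$. If the game never stops, its value is $v=\inf_{n\ge0}\min_{i} d(r^n,c_i^n)$. A strategy of the robber is a function $s:X\times X^k\times\mathbb R_+\to X$, $(r,c,t)\mapsto r'$ with $d(r,r')\le t$ (the choice of the initial position is regarded as part of $s$); a strategy of the cops is a function $q:(r',c,t)\mapsto c'\in X^k$ with $d(c_i,c_i')\le t$ for all $i$. Strategies may depend on the agility $\tau$, which is known to both players. Let $v_\tau(s,q)$ be the value of the game played with agility $\tau$ and strategies $s,q$. Put $\underline{\mathrm{Val}}_C=\sup_\tau\sup_s\inf_q v_\tau(s,q)$ and $\overline{\mathrm{Val}}_R=\sup_\tau\inf_q\sup_s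 v_\tau(s,q)$; it is known that these are equal. The cops win if $\underline{\mathrm{Val}}_C=0$ (they need not catch the robber); the robber wins if $\overline{\mathrm{Val}}_R>0$. The cop number $c(X)$ is the minimum $k$ such that $k$ cops win the game on $X$ ($\infty$ if there is no such $k$). *)

theory Defs
  imports "HOL-Analysis.Analysis"
begin

section \<open>Compact geodesic surfaces\<close>

definition path_partitions :: "(nat \<times> (nat \<Rightarrow> real)) set" where
  "path_partitions = {(n, t). t 0 = 0 \<and> t n = 1 \<and> mono_on {..n} t}"

definition path_length :: "(real \<Rightarrow> 'a::metric_space) \<Rightarrow> ennreal" where
  "path_length g =
     (SUP (n, t) \<in> path_partitions. \<Sum>i<n. ennreal (dist (g (t i)) (g (t (Suc i)))))"

text \<open>A metric space is represented by a subset \<open>X\<close> of a type of class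
  \<^class>\<open>metric_space\<close>, with the restriction of \<^const>\<open>dist\<close> as its metric.\<close>

definition geodesic_space :: "'a::metric_space set \<Rightarrow> bool" where
  "geodesic_space X \<longleftrightarrow>
     (\<forall>x\<in>X. \<forall>y\<in>X. \<exists>g. path g \<and> path_image g \<subseteq> X \<and> pathstart g = x \<and> pathfinish g = y \<and>
        path_length g = ennreal (dist x y))"

definition half_plane :: "(real^2) set" where
  "half_plane = {z. 0 \<le> z $ 2}"

definition surface_with_boundary :: "'a::t2_space set \<Rightarrow> bool" where
  "surface_with_boundary X \<longleftrightarrow>
     second_countable (top_of_set X) \<and>
     (\<forall>x\<in>X. \<exists>U V. x \<in> U \<and> openin (top_of_set X) U \<and>
        openin (top_of_set half_plane) V \<and> U homeomorphic V)"

definition compact_geodesic_surface :: "'a::metric_space set \<Rightarrow> bool" where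
  "compact_geodesic_surface X \<longleftrightarrow>
     compact X \<and> path_connected X \<and> surface_with_boundary X \<and> geodesic_space X"


section \<open>The game\<close>

text \<open>The entry \<open>\<tau> 0\<close> is never used: step \<open>n\<close> has agility \<open>\<tau> n\<close> for \<open>n \<ge> 1\<close>.\<close>

definition agility_functions :: "(nat \<Rightarrow> real) set" where
  "agility_functions =
     {\<tau>. (\<forall>n\<ge>1. 0 \<le> \<tau> n) \<and> filterlim (\<lambda>N. \<Sum>n=1..N. \<tau> n) at_top sequentially}"

text \<open>A position of the \<open>k\<close> cops is an extensional function on \<open>{..<k}\<close>. Extensionality
  matters: otherwise the values outside \<open>{..<k}\<close> could be used as a hidden memory by
  strategies that are meant to depend only on the current positions and the current agility.\<close>

definition cop_positions :: "'a set \<Rightarrow> nat \<Rightarrow> (nat \<Rightarrow> 'a) set" where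
  "cop_positions X k = {..<k} \<rightarrow>\<^sub>E X"

type_synonym 'a position = "'a \<times> (nat \<Rightarrow> 'a)"
type_synonym 'a robber_strategy = "'a position \<times> ('a \<Rightarrow> (nat \<Rightarrow> 'a) \<Rightarrow> real \<Rightarrow> 'a)"
type_synonym 'a cop_strategy = "'a \<Rightarrow> (nat \<Rightarrow> 'a) \<Rightarrow> real \<Rightarrow> (nat \<Rightarrow> 'a)"

text \<open>The robber also chooses the initial positions of all players; they form the first
  component of his strategy.\<close>

definition robber_strategies :: "'a::metric_space set \<Rightarrow> nat \<Rightarrow> 'a robber_strategy set" where
  "robber_strategies X k =
     {((r0, c0), s). r0 \<in> X \<and> c0 \<in> cop_positions X k \<and>
        (\<forall>r\<in>X. \<forall>c\<in>cop_positions X k. \<forall>t\<ge>0. s r c t \<in> X \<and> dist r (s r c t) \<le> t)}"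

definition cop_strategies :: "'a::metric_space set \<Rightarrow> nat \<Rightarrow> 'a cop_strategy set" where
  "cop_strategies X k =
     {q. \<forall>r\<in>X. \<forall>c\<in>cop_positions X k. \<forall>t\<ge>0.
        q r c t \<in> cop_positions X k \<and> (\<forall>i<k. dist (c i) (q r c t i) \<le> t)}"

text \<open>The positions after step \<open>n\<close>. The recursion ignores the stopping rule, which is taken
  into account in the value of the game.\<close>

primrec play :: "(nat \<Rightarrow> real) \<Rightarrow> 'a robber_strategy \<Rightarrow> 'a cop_strategy \<Rightarrow> nat \<Rightarrow> 'a position" where
  "play \<tau> \<sigma> q 0 = fst \<sigma>"
| "play \<tau> \<sigma> q (Suc n) =
     (let (r, c) = play \<tau> \<sigma> q n;
          r' = snd \<sigma> r c (\<tau> (Suc n))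
      in (r', q r' c (\<tau> (Suc n))))"

definition robber_at :: "(nat \<Rightarrow> real) \<Rightarrow> 'a robber_strategy \<Rightarrow> 'a cop_strategy \<Rightarrow> nat \<Rightarrow> 'a" where
  "robber_at \<tau> \<sigma> q n = fst (play \<tau> \<sigma> q n)"

definition cop_at :: "(nat \<Rightarrow> real) \<Rightarrow> 'a robber_strategy \<Rightarrow> 'a cop_strategy \<Rightarrow> nat \<Rightarrow> nat \<Rightarrow> 'a" where
  "cop_at \<tau> \<sigma> q n i = snd (play \<tau> \<sigma> q n) i"

definition game_value ::
  "nat \<Rightarrow> (nat \<Rightarrow> real) \<Rightarrow> 'a::metric_space robber_strategy \<Rightarrow> 'a cop_strategy \<Rightarrow> ennreal" where
  "game_value k \<tau> \<sigma> q =
     (if \<exists>n\<ge>1. \<exists>i<k. cop_at \<tau> \<sigma> q n i = robber_at \<tau> \<sigma> q n then 0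
      else INF n. ennreal (MIN i\<in>{..<k}. dist (robber_at \<tau> \<sigma> q n) (cop_at \<tau> \<sigma> q n i)))"

definition lower_value :: "'a::metric_space set \<Rightarrow> nat \<Rightarrow> ennreal" where
  "lower_value X k =
     (SUP \<tau>\<in>agility_functions. SUP \<sigma>\<in>robber_strategies X k. INF q\<in>cop_strategies X k.
        game_value k \<tau> \<sigma> q)"

definition cops_win :: "'a::metric_space set \<Rightarrow> nat \<Rightarrow> bool" where
  "cops_win X k \<longleftrightarrow> lower_value X k = 0"

definition cop_number :: "'a::metric_space set \<Rightarrow> enat" where
  "cop_number X = (INF k\<in>{k. 1 \<le> k \<and> cops_win X k}. enat k)"

end

theory Submission
  imports Defs
begin

text \<open>One cop guards a shortest path: if \<open>\<gamma>\<close> is parametrized by arc length and starts at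
  \<open>z0\<close>, the cop stays at \<open>\<gamma> (min (dist z0 r) L)\<close>, the shadow of the
  robber's position \<open>r\<close>. The shadow moves at most as fast as the robber, and it coincides with
  \<open>r\<close> when \<open>r\<close> is on \<open>\<gamma>\<close>, so a robber who crosses
  \<open>\<gamma>\<close> within a step is caught in that step. If \<open>\<gamma>\<close> is a shortest
  path only up to an error, the robber is caught up to a comparable error, and the error is all that
  matters for the value of the game. Moreover the cop guards a whole neighbourhood of
  \<open>\<gamma>\<close>.

  All guarded paths start at one point \<open>z0\<close>. The space without \<open>z0\<close> is embedded
  in the plane (stereographic projection from the image of \<open>z0\<close>), and the plane is tiled by
  small bricks. Bricks that meet have labels that are adjacent in the triangular lattice, so the brick
  labels are the vertices of a triangulated square, whose boundary stands for a small neighbourhood of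
  \<open>z0\<close>. The key construction (\<open>exists_guarded_cells\<close>) is a spanning tree of this
  triangulation, rooted at the boundary, such that the bricks on each branch all lie near one almost
  shortest path from \<open>z0\<close>. Hence one cop guards a branch.

  Now the search is that of a spanning tree in a planar triangulation (\<open>lattice_search\<close>). Two
  cops guard the branches of the two ends of an edge; together with the edge and the boundary these
  branches separate the square, and the robber is on one side. The third cop goes on to guard the branch of
  the third vertex of the triangle on that side. Then the robber is behind exactly one of the other two
  edges of the triangle, one of the three cops is released, and the two others guard the ends of this edge.
  Each crossed edge is outside of the tree, and such a walk through the triangles never returns: crossing
  an edge \<open>f\<close> outside of the tree changes the side with respect to the cycle of
  \<open>f\<close>, and no other crossing changes it back. As there are finitely many triangles, the robber
  is caught up to the error. The side of a cycle on which a triangle lies is expressed by the parity of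
  crossings with a ray.

  The strategy just described uses memory, whereas the cops of the game are positional. But the robber's
  strategy is known, and the cops can move a little less precisely so that the first cop never returns to a
  former position; then the position of the first cop encodes the history
  (\<open>positional_reach\<close>).\<close>


section \<open>Geodesic arcs\<close>

text \<open>The two intermediate points are arbitrary: along a path whose length is the distance of its ends
  this makes all triangle inequalities sharp.\<close>

lemma path_length_three:
  assumes "0 \<le> s" "s \<le> t" "t \<le> 1"
  shows "ennreal (dist (g 0) (g s) + dist (g s) (g t) + dist (g t) (g 1)) \<le> path_length g"
proof -
  let ?t = "\<lambda>i::nat. if i = 0 then 0 else if i = 1 then s else if i = 2 then t else 1"
  have "(3, ?t) \<in> path_partitions"
    using assms by (auto simp: path_partitions_def mono_on_def)
  then have "(\<Sum>i<3. ennreal (dist (g (?t i)) (g (?t (Suc i))))) \<le> path_length g"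
    unfolding path_length_def by (rule SUP_upper2) simp
  moreover have "(\<Sum>i<3. ennreal (dist (g (?t i)) (g (?t (Suc i))))) = 
      ennreal (dist (g 0) (g s) + dist (g s) (g t) + dist (g t) (g 1))"
    by (simp add: eval_nat_numeral ennreal_plus)
  ultimately show ?thesis by simp
qed

definition geodesic_arc :: "'a::metric_space set \<Rightarrow> (real \<Rightarrow> 'a) \<Rightarrow> 'a \<Rightarrow> 'a \<Rightarrow> bool" where
  "geodesic_arc X \<gamma> x y \<longleftrightarrow> \<gamma> 0 = x \<and> \<gamma> (dist x y) = y \<and> \<gamma> ` {0..dist x y} \<subseteq> X \<and>
     (\<forall>s\<in>{0..dist x y}. \<forall>t\<in>{0..dist x y}. dist (\<gamma> s) (\<gamma> t) = \<bar>s - t\<bar>)"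

text \<open>Along a path \<open>g\<close> of minimal length the function \<open>dist x (g s)\<close> is monotone
  and measures the length of \<open>g\<close> up to \<open>s\<close>. Choosing a parameter for each of its
  values gives the parametrization by arc length.\<close>

lemma geodesic_arc_exists:
  assumes "geodesic_space X" "x \<in> X" "y \<in> X"
  obtains \<gamma> where "geodesic_arc X \<gamma> x y"
proof -
  obtain g where g: "path g" "path_image g \<subseteq> X" "g 0 = x" "g 1 = y" "path_length g = ennreal (dist x y)"
    using assms unfolding geodesic_space_def pathstart_def pathfinish_def by blast
  let ?d = "dist x y" and ?\<phi> = "\<lambda>s. dist x (g s)"
  have three: "?\<phi> s + dist (g s) (g t) + dist (g t) y \<le> ?d" if "0 \<le> s" "s \<le> t" "t \<le> 1" for s t
    using path_length_three[OF that, of g] unfolding g(3-5) by (subst (asm) ennreal_le_iff) auto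
  have eq: "dist (g s) (g t) = ?\<phi> t - ?\<phi> s" if "0 \<le> s" "s \<le> t" "t \<le> 1" for s t
    using three[OF that] dist_triangle[of x y "g t"] dist_triangle[of x "g t" "g s"] by (simp add: dist_commute)
  have "continuous_on {0..1} ?\<phi>"
    using g(1) unfolding path_def by (intro continuous_intros)
  then have "\<exists>s. 0 \<le> s \<and> s \<le> 1 \<and> ?\<phi> s = u" if "0 \<le> u" "u \<le> ?d" for u
    using IVT'[of ?\<phi> 0 u 1] that g by auto
  then obtain h where h: "\<And>u. 0 \<le> u \<Longrightarrow> u \<le> ?d \<Longrightarrow> 0 \<le> h u \<and> h u \<le> 1 \<and> ?\<phi> (h u) = u"
    by metis
  have "geodesic_arc X (\<lambda>u. g (h u)) x y"
    unfolding geodesic_arc_def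
  proof (intro conjI ballI)
    show "g (h 0) = x" using h[of 0] by simp
    show "g (h ?d) = y" using h[of ?d] three[of "h ?d" "h ?d"] by simp
    show "(\<lambda>u. g (h u)) ` {0..?d} \<subseteq> X" using h g(2) unfolding path_image_def by auto
    fix s t assume st: "s \<in> {0..?d}" "t \<in> {0..?d}"
    show "dist (g (h s)) (g (h t)) = \<bar>s - t\<bar>"
      using eq[of "h s" "h t"] eq[of "h t" "h s"] h[of s] h[of t] st zero_le_dist[of "g (h s)" "g (h t)"]
      by (cases "h s \<le> h t") (auto simp: dist_commute)
  qed
  then show thesis by (rule that)
qed

lemma geodesic_arc_dist:
  assumes "geodesic_arc X \<gamma> x y" "0 \<le> t" "t \<le> dist x y"
  shows "\<gamma> t \<in> X" "dist x (\<gamma> t) = t" "dist (\<gamma> t) y = dist x y - t"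
proof -
  have "t \<in> {0..dist x y}" "0 \<in> {0..dist x y}" "dist x y \<in> {0..dist x y}" using assms by auto
  with assms have "\<gamma> t \<in> X" "dist (\<gamma> 0) (\<gamma> t) = \<bar>0 - t\<bar>" "dist (\<gamma> t) (\<gamma> (dist x y)) = \<bar>t - dist x y\<bar>" 
    unfolding geodesic_arc_def by blast+
  then show "\<gamma> t \<in> X" "dist x (\<gamma> t) = t" "dist (\<gamma> t) y = dist x y - t"
    using assms unfolding geodesic_arc_def by auto
qed

lemma geodesic_arc_connected:
  assumes "geodesic_arc X \<gamma> x y"
  shows "continuous_on {0..dist x y} \<gamma>"
proof -
  have "1-lipschitz_on {0..dist x y} \<gamma>"
    using assms unfolding geodesic_arc_def by (auto intro!: lipschitz_onI simp: dist_real_def)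
  then show ?thesis by (rule lipschitz_on_continuous_on)
qed

text \<open>How far a cop can come towards \<open>b\<close> with a step of size \<open>u\<close>.\<close>

lemma geodesic_step:
  assumes "geodesic_space X" "a \<in> X" "b \<in> X" "dist a b \<le> u + v" "0 \<le> u" "0 \<le> v"
  obtains c where "c \<in> X" "dist a c \<le> u" "dist c b \<le> v"
proof -
  obtain \<gamma> where \<gamma>: "geodesic_arc X \<gamma> a b" using geodesic_arc_exists assms by blast
  show thesis
    using that[of "\<gamma> (min u (dist a b))"] geodesic_arc_dist[OF \<gamma>, of "min u (dist a b)"] assms by auto
qed

text \<open>There is room to avoid finitely many points by an arbitrarily small change of a move.\<close>

lemma geodesic_ball_infinite:
  assumes "geodesic_space X" "p \<in> X" "y \<in> X" "y \<noteq> p" "0 < (s::real)"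
  shows "infinite {x \<in> X. dist p x \<le> s}"
proof -
  obtain \<gamma> where \<gamma>: "geodesic_arc X \<gamma> p y" using geodesic_arc_exists assms by blast
  let ?m = "min s (dist p y)"
  have "inj_on \<gamma> {0..?m}"
  proof (rule inj_onI)
    fix u v assume uv: "u \<in> {0..?m}" "v \<in> {0..?m}" "\<gamma> u = \<gamma> v"
    have "dist p (\<gamma> u) = u" by (rule geodesic_arc_dist(2)[OF \<gamma>]) (use uv in auto)
    moreover have "dist p (\<gamma> v) = v" by (rule geodesic_arc_dist(2)[OF \<gamma>]) (use uv in auto)
    ultimately show "u = v" using uv(3) by metis
  qed
  moreover have "infinite {0..?m}" using assms by (simp add: infinite_Icc)
  ultimately have "infinite (\<gamma> ` {0..?m})" by (metis finite_imageD)
  moreover have "\<gamma> ` {0..?m} \<subseteq> {x \<in> X. dist p x \<le> s}"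
    using geodesic_arc_dist[OF \<gamma>] by auto
  ultimately show ?thesis using finite_subset by blast
qed


section \<open>From strategies with memory to positional strategies\<close>

text \<open>After step \<open>n\<close>, with the robber at \<open>r\<close> and cops at \<open>c\<close>, the
  cops can force a distance of at most \<open>e\<close> within finitely many steps, against every robber.
  The predicate is inductive in the position together with the time, so a proof of it is a strategy with
  unbounded memory.\<close>

inductive cops_reach :: "'a::metric_space set \<Rightarrow> nat \<Rightarrow> (nat \<Rightarrow> real) \<Rightarrow> real \<Rightarrow> nat \<Rightarrow> 'a \<Rightarrow> (nat \<Rightarrow> 'a) \<Rightarrow> bool"
  for X k \<tau> e where
  near: "i < k \<Longrightarrow> dist r (c i) \<le> e \<Longrightarrow> cops_reach X k \<tau> e n r c"
| move: "(\<And>r'. r' \<in> X \<Longrightarrow> dist r r' \<le> \<tau> (Suc n) \<Longrightarrow>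
      \<exists>c'. (\<forall>i<k. c' i \<in> X \<and> dist (c i) (c' i) \<le> \<tau> (Suc n)) \<and> cops_reach X k \<tau> e (Suc n) r' c') \<Longrightarrow>
    cops_reach X k \<tau> e n r c"

text \<open>The play of the fixed strategies \<open>s\<close> and \<open>q\<close> brings a cop within
  \<open>e\<close> of the robber, and until then the first cop avoids \<open>H\<close>. Avoiding
  \<open>H\<close> allows one to change \<open>q\<close> at the positions with first cop in
  \<open>H\<close>.\<close>

inductive fresh_reach :: "nat \<Rightarrow> (nat \<Rightarrow> real) \<Rightarrow> real \<Rightarrow> ('a::metric_space \<Rightarrow> (nat \<Rightarrow> 'a) \<Rightarrow> real \<Rightarrow> 'a) \<Rightarrow>
    'a cop_strategy \<Rightarrow> 'a set \<Rightarrow> nat \<Rightarrow> 'a \<Rightarrow> (nat \<Rightarrow> 'a) \<Rightarrow> bool" for k \<tau> e s q H where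
  near: "i < k \<Longrightarrow> dist r (a i) \<le> e \<Longrightarrow> fresh_reach k \<tau> e s q H n r a"
| move: "a 0 \<notin> H \<Longrightarrow> r' = s r a (\<tau> (Suc n)) \<Longrightarrow> fresh_reach k \<tau> e s q H (Suc n) r' (q r' a (\<tau> (Suc n))) \<Longrightarrow>
    fresh_reach k \<tau> e s q H n r a"

lemma fresh_reach_cong:
  assumes "fresh_reach k \<tau> e s q H n r a" "\<And>r c t. c 0 \<notin> H \<Longrightarrow> q' r c t = q r c t" "H' \<subseteq> H"
  shows "fresh_reach k \<tau> e s q' H' n r a"
  using assms(1)
proof induction
  case (near i r a n)
  then show ?case by (rule fresh_reach.near)
next
  case (move a r' r n)
  show ?case
    by (rule fresh_reach.move[where r' = r']) (use move assms(2,3) in auto)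
qed

lemma fresh_reach_play:
  assumes "fresh_reach k \<tau> e (snd \<sigma>) q H n r a" "play \<tau> \<sigma> q n = (r, a)"
  shows "\<exists>m. \<exists>i<k. dist (robber_at \<tau> \<sigma> q m) (cop_at \<tau> \<sigma> q m i) \<le> e"
  using assms
proof induction
  case (near i r a n)
  then show ?case unfolding robber_at_def cop_at_def by (metis fst_conv snd_conv)
next
  case (move a r' r n)
  show ?case by (rule move.IH) (use move in \<open>simp add: Let_def\<close>)
qed

text \<open>The strategy with memory is followed by cops who stay only within \<open>\<eta> n\<close> of where
  they should be after step \<open>n\<close>. Since \<open>\<eta>\<close> increases strictly, each move of
  positive size can be chosen in a ball, and there the first cop avoids the finite set \<open>H\<close> of
  its former positions. The first move is then added to a positional strategy for the rest of the play,
  which never asks for it again. Moves of size \<open>0\<close> repeat the position, but they are forced.\<close>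

lemma positional_reach:
  fixes X :: "'a::metric_space set"
  assumes geo: "geodesic_space X" and k: "k \<ge> 1" and e: "e > 0"
    and \<tau>: "\<And>n. n \<ge> 1 \<Longrightarrow> \<tau> n \<ge> 0"
    and s: "\<And>r c t. r \<in> X \<Longrightarrow> c \<in> cop_positions X k \<Longrightarrow> t \<ge> 0 \<Longrightarrow> s r c t \<in> X \<and> dist r (s r c t) \<le> t"
    and \<eta>: "\<And>n. 0 \<le> \<eta> n" "\<And>n. \<eta> n < \<eta> (Suc n)" "\<And>n. \<eta> n \<le> e"
    and reach: "cops_reach X k \<tau> e n r c"
    and "r \<in> X" "\<forall>i<k. c i \<in> X" "a \<in> cop_positions X k" "\<forall>i<k. dist (a i) (c i) \<le> \<eta> n"
      "finite H" "a 0 \<notin> H"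
  shows "\<exists>q\<in>cop_strategies X k. fresh_reach k \<tau> (2*e) s q H n r a"
  using reach assms(10-)
proof (induction arbitrary: a H)
  case (near i r c n)
  have "dist r (a i) \<le> dist r (c i) + dist (a i) (c i)" by (metis dist_commute dist_triangle2)
  moreover have "dist (a i) (c i) \<le> \<eta> n" using near by blast
  ultimately have "dist r (a i) \<le> 2*e" using near(2) \<eta>(3)[of n] by linarith
  then have "fresh_reach k \<tau> (2*e) s (\<lambda>r c t. c) H n r a" using near(1) by (intro fresh_reach.near)
  moreover have "(\<lambda>r c t. c) \<in> cop_strategies X k" by (auto simp: cop_strategies_def)
  ultimately show ?case by blast
next
  case (move r n c)
  let ?T = "\<tau> (Suc n)"
  define r' where "r' = s r a ?T"
  have T: "?T \<ge> 0" using \<tau> by simp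
  have r': "r' \<in> X" "dist r r' \<le> ?T" using s move.prems T unfolding r'_def by auto
  from move.IH[OF r'] obtain c' where c': "\<forall>i<k. c' i \<in> X \<and> dist (c i) (c' i) \<le> ?T"
    and IH0: "r' \<in> X \<longrightarrow> (\<forall>i<k. c' i \<in> X) \<longrightarrow> (\<forall>a. a \<in> cop_positions X k \<longrightarrow>
      (\<forall>i<k. dist (a i) (c' i) \<le> \<eta> (Suc n)) \<longrightarrow> (\<forall>H. finite H \<longrightarrow> a 0 \<notin> H \<longrightarrow>
      (\<exists>q\<in>cop_strategies X k. fresh_reach k \<tau> (2*e) s q H (Suc n) r' a)))"
    by (elim exE conjE)
  then have IH: "a \<in> cop_positions X k \<Longrightarrow> \<forall>i<k. dist (a i) (c' i) \<le> \<eta> (Suc n) \<Longrightarrow> finite H \<Longrightarrow> a 0 \<notin> H \<Longrightarrow>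
      \<exists>q\<in>cop_strategies X k. fresh_reach k \<tau> (2*e) s q H (Suc n) r' a" for a H using r'(1) by simp
  have aX: "a i \<in> X" if "i < k" for i using move.prems(3) that unfolding cop_positions_def by auto
  consider "?T = 0" | "?T > 0" "\<exists>x\<in>X. x \<noteq> a 0" | "\<forall>x\<in>X. x = a 0" using T by fastforce
  then show ?case
  proof cases
    case 1
    have "dist (a i) (c' i) \<le> \<eta> (Suc n)" if "i < k" for i
      using c' 1 move.prems(4) \<eta>(2)[of n] that by fastforce
    then obtain q where q: "q \<in> cop_strategies X k" "fresh_reach k \<tau> (2*e) s q H (Suc n) r' a"
      using IH[of a H] move.prems r' c' by blast
    have qa: "q r' a ?T \<in> cop_positions X k" "\<forall>i<k. dist (a i) (q r' a ?T i) \<le> ?T"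
      using q(1) r'(1) move.prems(3) T unfolding cop_strategies_def by blast+
    have "q r' a ?T = a"
      using qa 1 move.prems(3) unfolding cop_positions_def by (intro PiE_ext[of _ "{..<k}" "\<lambda>_. X"]) auto
    then have "fresh_reach k \<tau> (2*e) s q H n r a"
      using q(2) by (intro fresh_reach.move[where \<tau> = \<tau> and s = s and a = a and r = r and q = q and n = n and H = H, OF move.prems(6) r'_def]) simp
    then show ?thesis using q(1) by blast
  next
    case 2
    define \<delta> where "\<delta> = min ?T (\<eta> (Suc n) - \<eta> n) / 2"
    have \<delta>: "\<delta> > 0" "2 * \<delta> \<le> ?T" "\<eta> n + 2 * \<delta> \<le> \<eta> (Suc n)" using 2 \<eta>(2)[of n] unfolding \<delta>_def by (auto simp: min_def field_simps)
    have ball: "infinite {x \<in> X. dist p x \<le> \<delta>}" if "p \<in> X" for p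
    proof -
      have "\<exists>y\<in>X. y \<noteq> p" using 2(2) k aX[of 0] by (metis not_less_eq_eq One_nat_def le_zero_eq neq0_conv)
      then show ?thesis using geodesic_ball_infinite[OF geo that _ _ \<delta>(1)] by blast
    qed
    have "\<exists>x. x \<in> X \<and> dist (a i) x \<le> ?T \<and> dist x (c' i) \<le> \<eta> (Suc n) \<and> x \<notin> insert (a 0) H" if "i < k" for i
    proof -
      have ai: "a i \<in> X" using aX that by blast
      have "dist (a i) (c' i) \<le> \<eta> n + ?T" using dist_triangle[of "a i" "c' i" "c i"] move.prems(4) c' that by fastforce
      then have "dist (a i) (c' i) \<le> (?T - \<delta>) + (\<eta> n + \<delta>)" by simp
      moreover have "0 \<le> ?T - \<delta>" "0 \<le> \<eta> n + \<delta>" using \<delta> \<eta>(1)[of n] by linarith+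
      moreover have "c' i \<in> X" using c' that by blast
      ultimately obtain p where p: "p \<in> X" "dist (a i) p \<le> ?T - \<delta>" "dist p (c' i) \<le> \<eta> n + \<delta>"
        using geodesic_step[OF geo ai] by blast
      have "\<not> {x \<in> X. dist p x \<le> \<delta>} \<subseteq> insert (a 0) H"
        using ball[OF p(1)] move.prems(5) finite_subset by blast
      then obtain x where x: "x \<in> X" "dist p x \<le> \<delta>" "x \<notin> insert (a 0) H" by blast
      have "dist (a i) x \<le> ?T" using dist_triangle[of "a i" x p] p x by linarith
      moreover have "dist x (c' i) \<le> \<eta> (Suc n)" using dist_triangle[of x "c' i" p] p x \<delta> by (simp add: dist_commute)
      ultimately show ?thesis using x by blast
    qed
    then obtain b where b: "\<And>i. i < k \<Longrightarrow> b i \<in> X \<and> dist (a i) (b i) \<le> ?T \<and> dist (b i) (c' i) \<le> \<eta> (Suc n) \<and> b i \<notin> insert (a 0) H"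
      by metis
    define a' where "a' = restrict b {..<k}"
    have a': "a' \<in> cop_positions X k" using b unfolding a'_def cop_positions_def by auto
    have a'i: "i < k \<Longrightarrow> a' i = b i" for i unfolding a'_def by simp
    obtain q where q: "q \<in> cop_strategies X k" "fresh_reach k \<tau> (2*e) s q (insert (a 0) H) (Suc n) r' a'"
      using IH[of a' "insert (a 0) H"] r' c' a' a'i b move.prems(5) k by fastforce
    \<comment> \<open>the rest of the play avoids the position \<open>a 0\<close> of the first cop, so the value of the strategy there is free\<close>
    define q' where "q' = (\<lambda>r c t. if c 0 = a 0 then (if r = r' \<and> c = a \<and> t = ?T then a' else c) else q r c t)"
    have "q' \<in> cop_strategies X k"
      using q(1) a' a'i b unfolding cop_strategies_def q'_def by auto
    moreover have "fresh_reach k \<tau> (2*e) s q' H (Suc n) r' a'"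
      by (rule fresh_reach_cong[OF q(2)]) (auto simp: q'_def)
    then have "fresh_reach k \<tau> (2*e) s q' H n r a"
      by (intro fresh_reach.move[where \<tau> = \<tau> and s = s and a = a and r = r and q = q' and n = n and H = H, OF move.prems(6) r'_def])
        (simp add: q'_def)
    ultimately show ?thesis by blast
  next
    case 3
    then have "dist r (a 0) \<le> 2*e" using move.prems(1) e by fastforce
    then have "fresh_reach k \<tau> (2*e) s (\<lambda>r c t. c) H n r a" using k by (intro fresh_reach.near[of 0]) auto
    moreover have "(\<lambda>r c t. c) \<in> cop_strategies X k" by (auto simp: cop_strategies_def)
    ultimately show ?thesis by blast
  qed
qed

lemma cops_winI:
  fixes X :: "'a::metric_space set"
  assumes geo: "geodesic_space X" and k: "k \<ge> 1"
    and reach: "\<And>\<tau> e r c. \<tau> \<in> agility_functions \<Longrightarrow> e > 0 \<Longrightarrow> r \<in> X \<Longrightarrow> \<forall>i<k. c i \<in> X \<Longrightarrow> cops_reach X k \<tau> e 0 r c"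
  shows "cops_win X k"
proof -
  have "(INF q\<in>cop_strategies X k. game_value k \<tau> \<sigma> q) = 0"
    if \<tau>: "\<tau> \<in> agility_functions" and \<sigma>: "\<sigma> \<in> robber_strategies X k" for \<tau> \<sigma>
  proof -
    obtain r c s where [simp]: "\<sigma> = ((r, c), s)" by (metis surj_pair)
    have rc: "r \<in> X" "c \<in> cop_positions X k" 
      "\<And>r c t. r \<in> X \<Longrightarrow> c \<in> cop_positions X k \<Longrightarrow> t \<ge> 0 \<Longrightarrow> s r c t \<in> X \<and> dist r (s r c t) \<le> t"
      using \<sigma> unfolding robber_strategies_def by auto
    have cX: "\<forall>i<k. c i \<in> X" using rc(2) unfolding cop_positions_def by auto
    have "(INF q\<in>cop_strategies X k. game_value k \<tau> \<sigma> q) \<le> 0 + ennreal \<epsilon>" if \<epsilon>: "\<epsilon> > 0" for \<epsilon>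
    proof -
      have \<tau>0: "\<And>n. n \<ge> 1 \<Longrightarrow> \<tau> n \<ge> 0" using \<tau> unfolding agility_functions_def by auto
      have "cops_reach X k \<tau> (\<epsilon>/2) 0 r c" using reach[OF \<tau> _ rc(1) cX] \<epsilon> by simp
      \<comment> \<open>an error that starts at \<open>0\<close> and increases strictly without exceeding \<open>\<epsilon>/2\<close>\<close>
      moreover have "0 \<le> \<epsilon>/2 * (1 - (1/2)^n)" "\<epsilon>/2 * (1 - (1/2)^n) < \<epsilon>/2 * (1 - (1/2)^(Suc n))" "\<epsilon>/2 * (1 - (1/2)^n) \<le> \<epsilon>/2" for n :: nat
        using \<epsilon> by (auto simp: power_le_one)
      ultimately have "\<exists>q\<in>cop_strategies X k. fresh_reach k \<tau> (2*(\<epsilon>/2)) s q {} 0 r c"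
        using positional_reach[of X k "\<epsilon>/2" \<tau> s "\<lambda>n. \<epsilon>/2 * (1 - (1/2)^n)" 0 r c c "{}"] geo k \<epsilon> \<tau>0 rc cX by auto
      then obtain q where q: "q \<in> cop_strategies X k" "fresh_reach k \<tau> \<epsilon> s q {} 0 r c" by auto
      obtain m i where m: "i < k" "dist (robber_at \<tau> \<sigma> q m) (cop_at \<tau> \<sigma> q m i) \<le> \<epsilon>"
        using fresh_reach_play[of k \<tau> \<epsilon> \<sigma> q "{}" 0 r c] q(2) by auto
      have "(MIN i\<in>{..<k}. dist (robber_at \<tau> \<sigma> q m) (cop_at \<tau> \<sigma> q m i)) \<le> \<epsilon>"
        using m by (meson Min_le finite_imageI finite_lessThan imageI lessThan_iff order_trans)
      then have "(INF n. ennreal (MIN i\<in>{..<k}. dist (robber_at \<tau> \<sigma> q n) (cop_at \<tau> \<sigma> q n i))) \<le> ennreal \<epsilon>"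
        by (intro INF_lower2[of m]) (auto intro: ennreal_leI)
      then have "game_value k \<tau> \<sigma> q \<le> ennreal \<epsilon>" unfolding game_value_def by simp
      then show ?thesis using q(1) by (simp add: INF_lower2)
    qed
    then have "(INF q\<in>cop_strategies X k. game_value k \<tau> \<sigma> q) \<le> 0" by (rule ennreal_le_epsilon)
    then show ?thesis by simp
  qed
  then have "lower_value X k \<le> 0"
    unfolding lower_value_def by (intro SUP_least) simp
  then show ?thesis unfolding cops_win_def by simp
qed


section \<open>Crossing parities in the triangular lattice\<close>

text \<open>The neighbours in the triangular lattice: the square lattice with one family of diagonals.\<close>

definition lat_adj :: "int \<times> int \<Rightarrow> int \<times> int \<Rightarrow> bool" where
  "lat_adj a b \<longleftrightarrow> 
     fst b = fst a \<and> (snd b = snd a + 1 \<or> snd a = snd b + 1) \<or>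
     fst b = fst a + 1 \<and> (snd b = snd a \<or> snd b = snd a + 1) \<or>
     fst a = fst b + 1 \<and> (snd a = snd b \<or> snd a = snd b + 1)"

definition lat_square :: "int \<Rightarrow> (int \<times> int) set" where
  "lat_square n = {-n..n} \<times> {-n..n}"

definition lat_inner :: "int \<Rightarrow> (int \<times> int) set" where
  "lat_inner n = {-n<..<n} \<times> {-n<..<n}"

definition lat_ring :: "int \<Rightarrow> (int \<times> int) set" where
  "lat_ring n = lat_square n - lat_inner n"

text \<open>The edges between the rows \<open>i\<close> and \<open>i + 1\<close> are ordered from left to right,
  the vertical edges and diagonals in turn; edge number \<open>k\<close> is the one whose ends have second
  coordinates with sum \<open>k\<close>. The triangle \<open>(i, k)\<close> lies between the edges
  \<open>k\<close> and \<open>k + 1\<close>.\<close>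

definition tri_verts :: "int \<times> int \<Rightarrow> (int \<times> int) set" where
  "tri_verts t = (case t of (i, k) \<Rightarrow>
     {(i, k div 2), (i, (k+1) div 2), (i+1, (k+1) div 2), (i+1, (k+2) div 2)})"

definition tri_inside :: "int \<Rightarrow> int \<times> int \<Rightarrow> bool" where
  "tri_inside n t \<longleftrightarrow> -n \<le> fst t \<and> fst t < n \<and> -2*n \<le> snd t \<and> snd t < 2*n"

text \<open>The edge \<open>{a, b}\<close> meets the horizontal ray from the triangle \<open>t\<close> to the
  right.\<close>

definition ray_cross :: "int \<times> int \<Rightarrow> int \<times> int \<Rightarrow> int \<times> int \<Rightarrow> bool" where
  "ray_cross t a b \<longleftrightarrow> (fst a = fst t \<and> fst b = fst t + 1 \<or> fst a = fst t + 1 \<and> fst b = fst t)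
     \<and> snd a + snd b > snd t"

text \<open>Paths that end on the boundary are prolonged: from a vertex of the right side one goes down along
  that side, and from the other sides one avoids all the rays. The prolongation of a path from
  \<open>p\<close> crosses the ray of \<open>t\<close>, for triangles of the square, if and only if this
  predicate holds.\<close>

definition ring_cross :: "int \<Rightarrow> int \<times> int \<Rightarrow> int \<times> int \<Rightarrow> bool" where
  "ring_cross n t p \<longleftrightarrow> snd p = n \<and> fst p > fst t"

lemma lat_adj_sym: "lat_adj a b \<Longrightarrow> lat_adj b a"
  by (auto simp: lat_adj_def)

lemma lat_adj_neq: "lat_adj a b \<Longrightarrow> a \<noteq> b"
  by (auto simp: lat_adj_def)

lemma lat_square_split: "lat_square n = lat_inner n \<union> lat_ring n" "lat_inner n \<inter> lat_ring n = {}"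
  by (auto simp: lat_square_def lat_inner_def lat_ring_def)

text \<open>The triangles \<open>t\<close> and \<open>t'\<close> share the edge \<open>{a, b}\<close>. Crossing
  numbers of a path with the two rays differ by the number of passages through that edge, up to the number
  of times that the path enters or leaves the vertex set \<open>H\<close> between the rays; the latter
  cancels along closed paths.\<close>

definition parity_link :: "int \<Rightarrow> int \<times> int \<Rightarrow> int \<times> int \<Rightarrow> int \<times> int \<Rightarrow> int \<times> int \<Rightarrow> (int \<times> int) set \<Rightarrow> bool" where
  "parity_link n a b t t' H \<longleftrightarrow>
     (\<forall>x y. lat_adj x y \<longrightarrow> (ray_cross t x y \<noteq> ray_cross t' x y) = (({x,y} = {a,b}) \<noteq> ((x \<in> H) \<noteq> (y \<in> H)))) \<and>
     (\<forall>p\<in>lat_ring n. (ring_cross n t p \<noteq> ring_cross n t' p) = (p \<in> H))"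

lemma parity_link_adj:
  assumes "parity_link n a b t t' H" "lat_adj x y"
  shows "(ray_cross t x y \<noteq> ray_cross t' x y) = (({x,y} = {a,b}) \<noteq> ((x \<in> H) \<noteq> (y \<in> H)))"
  using conjunct1[OF assms(1)[unfolded parity_link_def]] assms(2) by (elim allE impE)

lemma parity_link_ring:
  assumes "parity_link n a b t t' H" "p \<in> lat_ring n"
  shows "(ring_cross n t p \<noteq> ring_cross n t' p) = (p \<in> H)"
  using conjunct2[OF assms(1)[unfolded parity_link_def]] assms(2) by (rule bspec)

lemma parity_linkI:
  "(\<And>x y. lat_adj x y \<Longrightarrow> (ray_cross t x y \<noteq> ray_cross t' x y) = (({x,y} = {a,b}) \<noteq> ((x \<in> H) \<noteq> (y \<in> H)))) \<Longrightarrow>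
   (\<And>p. p \<in> lat_ring n \<Longrightarrow> (ring_cross n t p \<noteq> ring_cross n t' p) = (p \<in> H)) \<Longrightarrow>
   parity_link n a b t t' H"
  unfolding parity_link_def by (intro conjI allI impI ballI)

definition edge_link :: "int \<Rightarrow> int \<times> int \<Rightarrow> int \<times> int \<Rightarrow> int \<times> int \<Rightarrow> int \<times> int \<Rightarrow> bool" where
  "edge_link n a b t t' \<longleftrightarrow> (\<exists>H. parity_link n a b t t' H)"

lemma edge_link_sym: 
  assumes "edge_link n a b t t'"
  shows "edge_link n a b t' t"
proof -
  obtain H where H: "parity_link n a b t t' H"
    using assms unfolding edge_link_def by blast
  have "parity_link n a b t' t H"
  proof (rule parity_linkI)
    fix x y assume "lat_adj x y"
    from parity_link_adj[OF H this]
    show "(ray_cross t' x y \<noteq> ray_cross t x y) = (({x,y} = {a,b}) \<noteq> ((x \<in> H) \<noteq> (y \<in> H)))"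
      by argo
  next
    fix p assume "p \<in> lat_ring n"
    from parity_link_ring[OF H this] show "(ring_cross n t' p \<noteq> ring_cross n t p) = (p \<in> H)"
      by argo
  qed
  then show ?thesis unfolding edge_link_def by blast
qed

lemma edge_link_swap: "edge_link n a b t t' \<Longrightarrow> edge_link n b a t t'"
  unfolding edge_link_def parity_link_def insert_commute[of b a] .

lemma edge_linkI:
  assumes link: "\<And>x1 x2 d1 d2. (d1, d2) \<in> {(0,1),(1,0),(1,1)} \<Longrightarrow>
      (ray_cross t (x1,x2) (x1 + d1,x2 + d2) \<noteq> ray_cross t' (x1,x2) (x1 + d1,x2 + d2)) =
        (((x1,x2) = a \<and> (x1 + d1,x2 + d2) = b) \<noteq> (((x1,x2) \<in> H) \<noteq> ((x1 + d1,x2 + d2) \<in> H)))"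
    and ring: "\<And>p. p \<in> lat_ring n \<Longrightarrow> (ring_cross n t p \<noteq> ring_cross n t' p) = (p \<in> H)"
    and ab: "b = (fst a + e1, snd a + e2)" "(e1, e2) \<in> {(0,1),(1,0),(1,1)}"
  shows "edge_link n a b t t'"
proof -
  have pos: "(ray_cross t x y \<noteq> ray_cross t' x y) = (({x,y} = {a,b}) \<noteq> ((x \<in> H) \<noteq> (y \<in> H)))"
    if d: "y = (fst x + d1, snd x + d2)" "(d1, d2) \<in> {(0,1),(1,0),(1,1)}" for x y d1 d2
  proof -
    have "\<not> (x = b \<and> y = a)"
      using d ab by (cases a; cases x) auto
    then have "{x,y} = {a,b} \<longleftrightarrow> x = a \<and> y = b"
      by (auto simp: doubleton_eq_iff)
    with link[OF d(2), of "fst x" "snd x"] show ?thesis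
      unfolding d(1)[symmetric] prod.collapse by (simp only:)
  qed
  have sym: "ray_cross t x y = ray_cross t y x" for t x y
    by (auto simp: ray_cross_def)
  have "parity_link n a b t t' H"
  proof (rule parity_linkI)
    fix x y assume "lat_adj x y"
    then consider d1 d2 where "y = (fst x + d1, snd x + d2)" "(d1, d2) \<in> {(0,1),(1,0),(1,1)}"
      | d1 d2 where "x = (fst y + d1, snd y + d2)" "(d1, d2) \<in> {(0,1),(1,0),(1,1)}"
      by (cases x; cases y) (auto simp: lat_adj_def)
    then show "(ray_cross t x y \<noteq> ray_cross t' x y) = (({x,y} = {a,b}) \<noteq> ((x \<in> H) \<noteq> (y \<in> H)))"
    proof cases
      case 2
      from pos[OF 2] show ?thesis 
        unfolding sym[of _ x y] insert_commute[of x y] by argo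
    qed (rule pos)
  qed (rule ring)
  then show ?thesis unfolding edge_link_def by blast
qed

lemma edge_link_vertical: "edge_link n (i,j) (i+1,j) (i,2*j-1) (i,2*j)"
proof (rule edge_linkI[where H = "{}" and ?e1.0 = 1 and ?e2.0 = 0], goal_cases)
  case (1 x1 x2 d1 d2)
  then consider "d1 = 0 \<and> d2 = 1" | "d1 = 1 \<and> d2 = 0" | "d1 = 1 \<and> d2 = 1" by blast
  then show ?case
    by cases (simp_all add: ray_cross_def, (presburger+)?)
qed (auto simp: ring_cross_def)

lemma edge_link_diagonal: "edge_link n (i,j) (i+1,j+1) (i,2*j) (i,2*j+1)"
proof (rule edge_linkI[where H = "{}" and ?e1.0 = 1 and ?e2.0 = 1], goal_cases)
  case (1 x1 x2 d1 d2)
  then consider "d1 = 0 \<and> d2 = 1" | "d1 = 1 \<and> d2 = 0" | "d1 = 1 \<and> d2 = 1" by blast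
  then show ?case
    by cases (simp_all add: ray_cross_def, (presburger+)?)
qed (auto simp: ring_cross_def)

text \<open>The two rays run on the two sides of a row, and \<open>H\<close> consists of the vertices of this
  row between them.\<close>

lemma edge_link_horizontal:
  assumes "-n < i" "i < n" "-n \<le> j" "j < n"
  shows "edge_link n (i,j) (i,j+1) (i,2*j+1) (i-1,2*j)"
proof (rule edge_linkI[where ?e1.0 = 0 and ?e2.0 = 1 and H = "{p. fst p = i \<and> snd p > j}"], goal_cases)
  case (1 x1 x2 d1 d2)
  then consider "d1 = 0 \<and> d2 = 1" | "d1 = 1 \<and> d2 = 0" | "d1 = 1 \<and> d2 = 1" by blast
  then show ?case
    by cases (simp_all add: ray_cross_def, (presburger+)?)
next
  case (2 p)
  then show ?case
    using assms by (cases p) (auto simp: ring_cross_def lat_ring_def lat_square_def lat_inner_def)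
qed (auto simp: ring_cross_def)

lemma lat_adj_cases:
  assumes "lat_adj a b"
  obtains i j where "{a,b} = {(i,j),(i+1,j)}" | i j where "{a,b} = {(i,j),(i+1,j+1)}"
    | i j where "{a,b} = {(i,j),(i,j+1)}"
proof -
  obtain a1 a2 b1 b2 where [simp]: "a = (a1,a2)" "b = (b1,b2)" by (metis surj_pair)
  consider "b1 = a1 + 1" "b2 = a2" | "a1 = b1 + 1" "b2 = a2" | "b1 = a1 + 1" "b2 = a2+1" 
    | "a1 = b1 + 1" "a2 = b2+1" | "b1 = a1" "b2 = a2+1" | "b1 = a1" "a2 = b2+1"
    using assms by (auto simp: lat_adj_def)
  then have "(\<exists>i j. {a,b} = {(i,j),(i+1,j)}) \<or> (\<exists>i j. {a,b} = {(i,j),(i+1,j+1)}) \<or> (\<exists>i j. {a,b} = {(i,j),(i,j+1)})"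
    by cases (auto simp: insert_commute)
  then show thesis using that by blast
qed

lemma tri_verts_even: "tri_verts (i, 2*m) = {(i,m),(i+1,m),(i+1,m+1)}"
  and tri_verts_odd: "tri_verts (i, 2*m+1) = {(i,m),(i,m+1),(i+1,m+1)}"
proof -
  have "(2*m) div 2 = m" "(2*m+1) div 2 = m" "(2*m+2) div 2 = m+1" "(2*m+1+1) div 2 = m+1" "(2*m+1+2) div 2 = m+1" for m :: int
    by presburger+
  then show "tri_verts (i, 2*m) = {(i,m),(i+1,m),(i+1,m+1)}"
    and "tri_verts (i, 2*m+1) = {(i,m),(i,m+1),(i+1,m+1)}"
    unfolding tri_verts_def by auto
qed

lemma tri_cases:
  fixes t :: "int \<times> int"
  obtains i m where "t = (i, 2*m)" | i m where "t = (i, 2*m+1)"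
  by (cases t) (metis evenE oddE)



lemma verts_vertical: "{(i,j),(i+1,j)} \<subseteq> tri_verts t \<longleftrightarrow> t = (i,2*j-1) \<or> t = (i,2*j)"
  by (rule tri_cases[of t]; auto simp: tri_verts_even tri_verts_odd; presburger)

lemma verts_diagonal: "{(i,j),(i+1,j+1)} \<subseteq> tri_verts t \<longleftrightarrow> t = (i,2*j) \<or> t = (i,2*j+1)"
  by (rule tri_cases[of t]; auto simp: tri_verts_even tri_verts_odd; presburger)

lemma verts_horizontal: "{(i,j),(i,j+1)} \<subseteq> tri_verts t \<longleftrightarrow> t = (i,2*j+1) \<or> t = (i-1,2*j)"
  by (rule tri_cases[of t]; auto simp: tri_verts_even tri_verts_odd; presburger)


lemma ray_cross_sym: "ray_cross t x y = ray_cross t y x"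
  by (auto simp: ray_cross_def)

text \<open>The property of the boundary edges that matters is that their closed paths do not separate the
  triangles of the square. An edge that cuts off a corner of the square also joins two vertices of the
  boundary, but it does not have this property.\<close>

definition boundary_edge :: "int \<Rightarrow> int \<times> int \<Rightarrow> int \<times> int \<Rightarrow> bool" where
  "boundary_edge n a b \<longleftrightarrow> a \<in> lat_ring n \<and> b \<in> lat_ring n \<and>
     (\<exists>c. \<forall>s. tri_inside n s \<longrightarrow> (ray_cross s a b \<noteq> (ring_cross n s a \<noteq> ring_cross n s b)) = c)"

lemma boundary_edge_swap: "boundary_edge n a b \<Longrightarrow> boundary_edge n b a"
  unfolding boundary_edge_def ray_cross_sym[of _ b a]
  by (metis (full_types))

definition across :: "int \<Rightarrow> int \<times> int \<Rightarrow> int \<times> int \<Rightarrow> int \<times> int \<Rightarrow> int \<times> int \<Rightarrow> bool" where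
  "across n a b t t' \<longleftrightarrow> t' \<noteq> t \<and> tri_inside n t' \<and> {a,b} \<subseteq> tri_verts t' \<and> edge_link n a b t t' \<and>
     (\<forall>s. {a,b} \<subseteq> tri_verts s \<longrightarrow> s = t \<or> s = t')"

lemma across_swap: "across n a b t t' \<Longrightarrow> across n b a t t'"
  unfolding across_def using edge_link_swap by (metis insert_commute)

lemma across_cases_vertical:
  assumes "(i,j) \<in> lat_square n" "(i+1,j) \<in> lat_square n" "tri_inside n t" "{(i,j),(i+1,j)} \<subseteq> tri_verts t" "n \<ge> 1"
  shows "boundary_edge n (i,j) (i+1,j) \<or> (\<exists>t'. across n (i,j) (i+1,j) t t')"
proof (cases "j = n \<or> j = -n")
  case True
  then have "boundary_edge n (i,j) (i+1,j)"
  proof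
    assume "j = -n"
    then show ?thesis
      using assms unfolding boundary_edge_def
      by (auto simp: ray_cross_def ring_cross_def tri_inside_def lat_ring_def lat_square_def lat_inner_def
          intro!: exI[of _ False])
  next
    assume "j = n"
    then show ?thesis
      using assms unfolding boundary_edge_def
      by (auto simp: ray_cross_def ring_cross_def tri_inside_def lat_ring_def lat_square_def lat_inner_def
          intro!: exI[of _ False])
  qed
  then show ?thesis ..
next
  case False
  have t: "t = (i,2*j-1) \<or> t = (i,2*j)"
    using assms(4) unfolding verts_vertical .
  let ?o = "if t = (i,2*j) then (i,2*j-1) else (i,2*j)"
  have "edge_link n (i,j) (i+1,j) t ?o"
    using t edge_link_vertical[of n i j] edge_link_sym by auto
  moreover have "tri_inside n ?o"
    using assms t False by (auto simp: tri_inside_def lat_square_def)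
  ultimately have "across n (i,j) (i+1,j) t ?o"
    unfolding across_def verts_vertical using t by auto
  then show ?thesis by blast
qed

lemma across_cases_diagonal:
  assumes "(i,j) \<in> lat_square n" "(i+1,j+1) \<in> lat_square n" "tri_inside n t" "{(i,j),(i+1,j+1)} \<subseteq> tri_verts t" "n \<ge> 1"
  shows "\<exists>t'. across n (i,j) (i+1,j+1) t t'"
proof -
  have t: "t = (i,2*j) \<or> t = (i,2*j+1)"
    using assms(4) unfolding verts_diagonal .
  let ?o = "if t = (i,2*j) then (i,2*j+1) else (i,2*j)"
  have "edge_link n (i,j) (i+1,j+1) t ?o"
    using t edge_link_diagonal[of n i j] edge_link_sym by auto
  moreover have "tri_inside n ?o"
    using assms t by (auto simp: tri_inside_def lat_square_def)
  ultimately have "across n (i,j) (i+1,j+1) t ?o"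
    unfolding across_def verts_diagonal using t by auto
  then show ?thesis by blast
qed

lemma across_cases_horizontal:
  assumes "(i,j) \<in> lat_square n" "(i,j+1) \<in> lat_square n" "tri_inside n t" "{(i,j),(i,j+1)} \<subseteq> tri_verts t" "n \<ge> 1"
  shows "boundary_edge n (i,j) (i,j+1) \<or> (\<exists>t'. across n (i,j) (i,j+1) t t')"
proof (cases "i = n \<or> i = -n")
  case True
  then have "boundary_edge n (i,j) (i,j+1)"
  proof
    assume "i = -n"
    then show ?thesis
      using assms unfolding boundary_edge_def
      by (auto simp: ray_cross_def ring_cross_def tri_inside_def lat_ring_def lat_square_def lat_inner_def
          intro!: exI[of _ False])
  next
    assume "i = n"
    then show ?thesis
      using assms unfolding boundary_edge_def
      by (auto simp: ray_cross_def ring_cross_def tri_inside_def lat_ring_def lat_square_def lat_inner_def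
          intro!: exI[of _ "j+1=n"])
  qed
  then show ?thesis ..
next
  case False
  have t: "t = (i,2*j+1) \<or> t = (i-1,2*j)"
    using assms(4) unfolding verts_horizontal .
  let ?o = "if t = (i,2*j+1) then (i-1,2*j) else (i,2*j+1)"
  have "edge_link n (i,j) (i,j+1) (i,2*j+1) (i-1,2*j)"
    by (rule edge_link_horizontal) (use assms False in \<open>auto simp: lat_square_def\<close>)
  then have "edge_link n (i,j) (i,j+1) t ?o"
    using t edge_link_sym by auto
  moreover have "tri_inside n ?o"
    using assms t False by (auto simp: tri_inside_def lat_square_def)
  ultimately have "across n (i,j) (i,j+1) t ?o"
    unfolding across_def verts_horizontal using t by auto
  then show ?thesis by blast
qed

lemma across_cases:
  assumes "lat_adj a b" "a \<in> lat_square n" "b \<in> lat_square n" "tri_inside n t" "{a,b} \<subseteq> tri_verts t" "n \<ge> 1"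
  shows "boundary_edge n a b \<or> (\<exists>t'. across n a b t t')"
proof -
  have "boundary_edge n p q \<or> (\<exists>t'. across n p q t t') \<Longrightarrow> ?thesis" if "{a,b} = {p,q}" for p q
    using that unfolding doubleton_eq_iff by (metis boundary_edge_swap across_swap)
  moreover have "\<exists>p q. {a,b} = {p,q} \<and> (boundary_edge n p q \<or> (\<exists>t'. across n p q t t'))"
    using assms(1)
  proof (cases rule: lat_adj_cases)
    case (1 i j)
    then have "boundary_edge n (i,j) (i+1,j) \<or> (\<exists>t'. across n (i,j) (i+1,j) t t')"
      using assms by (intro across_cases_vertical) auto
    with 1 show ?thesis by blast
  next
    case (2 i j)
    then have "\<exists>t'. across n (i,j) (i+1,j+1) t t'"
      using assms by (intro across_cases_diagonal) auto
    with 2 show ?thesis by blast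
  next
    case (3 i j)
    then have "boundary_edge n (i,j) (i,j+1) \<or> (\<exists>t'. across n (i,j) (i,j+1) t t')"
      using assms by (intro across_cases_horizontal) auto
    with 3 show ?thesis by blast
  qed
  ultimately show ?thesis by blast
qed


fun path_parity :: "('v \<Rightarrow> 'v \<Rightarrow> bool) \<Rightarrow> 'v list \<Rightarrow> bool" where
  "path_parity c (x # y # l) = (c x y \<noteq> path_parity c (y # l))"
| "path_parity c _ = False"

text \<open>A forest on \<open>D\<close> whose roots are vertices of the boundary; the list \<open>pth v\<close>
  is the path from \<open>v\<close> to its root.\<close>

definition lat_tree :: "int \<Rightarrow> (int \<times> int) set \<Rightarrow> (int \<times> int \<Rightarrow> (int \<times> int) list) \<Rightarrow> bool" where
  "lat_tree n D pth \<longleftrightarrow> (\<forall>v\<in>D. v \<in> lat_ring n \<and> pth v = [v] \<or>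
      v \<in> lat_inner n \<and> (\<exists>p\<in>D. lat_adj v p \<and> pth v = v # pth p))"

text \<open>The parity of the crossings of the ray of \<open>t\<close> with a path and its prolongation from the
  boundary.\<close>

definition ray_parity :: "int \<Rightarrow> int \<times> int \<Rightarrow> (int \<times> int) list \<Rightarrow> bool" where
  "ray_parity n t l \<longleftrightarrow> path_parity (ray_cross t) l \<noteq> ring_cross n t (last l)"

lemma lat_tree_induct [consumes 2, case_names ring step]:
  assumes "lat_tree n D pth" "v \<in> D"
    and "\<And>v. v \<in> D \<Longrightarrow> v \<in> lat_ring n \<Longrightarrow> pth v = [v] \<Longrightarrow> P v"
    and "\<And>v p. v \<in> D \<Longrightarrow> v \<in> lat_inner n \<Longrightarrow> p \<in> D \<Longrightarrow> lat_adj v p \<Longrightarrow> pth v = v # pth p \<Longrightarrow> P p \<Longrightarrow> P v"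
  shows "P v"
  using assms(2)
proof (induction "length (pth v)" arbitrary: v rule: less_induct)
  case less
  from assms(1) less.prems consider "v \<in> lat_ring n" "pth v = [v]" 
    | p where "v \<in> lat_inner n" "p \<in> D" "lat_adj v p" "pth v = v # pth p"
    unfolding lat_tree_def by blast
  then show ?case
  proof cases
    case 1 then show ?thesis using assms(3) less.prems by blast
  next
    case (2 p)
    then have "P p" using less.hyps[of p] by simp
    then show ?thesis using 2 assms(4) less.prems by blast
  qed
qed

lemma lat_tree_hd:
  assumes "lat_tree n D pth" "v \<in> D"
  shows "\<exists>l. pth v = v # l"
  using assms by (induction rule: lat_tree_induct) auto

lemma lat_tree_step:
  assumes "lat_tree n D pth" "p \<in> D" "pth v = v # pth p"
  shows "path_parity c (pth v) = (c v p \<noteq> path_parity c (pth p))" "ray_parity n t (pth v) = (ray_cross t v p \<noteq> ray_parity n t (pth p))"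
proof -
  obtain l where "pth p = p # l" using lat_tree_hd[OF assms(1,2)] by blast
  with assms(3) show "path_parity c (pth v) = (c v p \<noteq> path_parity c (pth p))" 
    "ray_parity n t (pth v) = (ray_cross t v p \<noteq> ray_parity n t (pth p))"
    by (auto simp: ray_parity_def)
qed

lemma ray_parity_link:
  assumes "parity_link n a b t t' H" "lat_tree n D pth" "v \<in> D"
  shows "(ray_parity n t (pth v) \<noteq> ray_parity n t' (pth v)) = (path_parity (\<lambda>x y. {x,y} = {a,b}) (pth v) \<noteq> (v \<in> H))"
  using assms(2,3)
proof (induction rule: lat_tree_induct)
  case (ring v)
  then show ?case using parity_link_ring[OF assms(1), of v] by (simp add: ray_parity_def)
next
  case (step v p)
  from parity_link_adj[OF assms(1) step(4)] step(6) show ?case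
    unfolding lat_tree_step[OF assms(2) step(3,5)] by argo
qed

definition tree_edge :: "(int \<times> int) set \<Rightarrow> (int \<times> int \<Rightarrow> (int \<times> int) list) \<Rightarrow> int \<times> int \<Rightarrow> int \<times> int \<Rightarrow> bool" where
  "tree_edge D pth a b \<longleftrightarrow> (\<exists>v\<in>D. \<exists>p\<in>D. pth v = v # pth p \<and> {v,p} = {a,b})"

lemma edge_on_path:
  assumes "lat_tree n D pth" "v \<in> D" "path_parity (\<lambda>x y. {x,y} = {a,b}) (pth v)"
  shows "a \<in> set (pth v) \<and> tree_edge D pth a b"
  using assms
proof (induction rule: lat_tree_induct)
  case (step v p)
  obtain l where l: "pth p = p # l" using lat_tree_hd[OF assms(1) step(3)] by blast
  show ?case
  proof (cases "{v,p} = {a,b}")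
    case True
    then have "tree_edge D pth a b" using step unfolding tree_edge_def by blast
    moreover have "a \<in> {v,p}" using True by blast
    moreover have "{v,p} \<subseteq> set (pth v)" unfolding step(5) l by simp
    ultimately show ?thesis by blast
  next
    case False
    then have "path_parity (\<lambda>x y. {x,y} = {a,b}) (pth p)"
      using step.prems lat_tree_step(1)[OF assms(1) step(3,5), of "\<lambda>x y. {x,y} = {a,b}"] by metis
    from step(6)[OF this] show ?thesis unfolding step(5) by simp
  qed
qed simp

text \<open>The closed path that consists of the edge \<open>{u, v}\<close> and of the branches of
  \<open>u\<close> and \<open>v\<close> winds around \<open>t\<close> an odd number of times.\<close>

definition enclosed :: "int \<Rightarrow> (int \<times> int \<Rightarrow> (int \<times> int) list) \<Rightarrow> int \<times> int \<Rightarrow> int \<times> int \<Rightarrow> int \<times> int \<Rightarrow> bool" where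
  "enclosed n pth u v t \<longleftrightarrow> (ray_parity n t (pth u) \<noteq> ray_parity n t (pth v)) \<noteq> ray_cross t u v"

lemma enclosed_sym: "enclosed n pth u v t = enclosed n pth v u t"
  unfolding enclosed_def ray_cross_sym[of t u v] by argo

lemma enclosed_flip:
  assumes "edge_link n a b t t'" "lat_tree n D pth" "u \<in> D" "v \<in> D" "lat_adj u v"
  shows "(enclosed n pth u v t \<noteq> enclosed n pth u v t') =
     ((path_parity (\<lambda>x y. {x,y} = {a,b}) (pth u) \<noteq> path_parity (\<lambda>x y. {x,y} = {a,b}) (pth v)) \<noteq> ({u,v} = {a,b}))"
proof -
  obtain H where H: "parity_link n a b t t' H" using assms(1) unfolding edge_link_def by blast
  show ?thesis
    using ray_parity_link[OF H assms(2,3)] ray_parity_link[OF H assms(2,4)] parity_link_adj[OF H assms(5)]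
    unfolding enclosed_def by argo
qed

text \<open>For a tree edge the two branches and the edge cancel.\<close>

lemma enclosed_tree_edge:
  assumes "lat_tree n D pth" "tree_edge D pth u v"
  shows "\<not> enclosed n pth u v t"
proof -
  obtain x p where xp: "x \<in> D" "p \<in> D" "pth x = x # pth p" "{x,p} = {u,v}"
    using assms(2) unfolding tree_edge_def by blast
  have "\<not> enclosed n pth x p t"
    using lat_tree_step(2)[OF assms(1) xp(2,3)] unfolding enclosed_def by blast
  moreover have "x = u \<and> p = v \<or> x = v \<and> p = u"
    using xp(4) by (simp add: doubleton_eq_iff)
  ultimately show ?thesis using enclosed_sym[of n pth u v t] by blast
qed

lemma enclosed_boundary_edge:
  assumes "lat_tree n D pth" "boundary_edge n u v" "u \<in> D" "v \<in> D" "tri_inside n s" "tri_inside n t"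
    "lat_inner n \<inter> lat_ring n = {}"
  shows "enclosed n pth u v s = enclosed n pth u v t"
proof -
  have "u \<in> lat_ring n" "v \<in> lat_ring n" using assms(2) unfolding boundary_edge_def by auto
  then have "pth u = [u]" "pth v = [v]" using assms unfolding lat_tree_def by blast+
  then have *: "enclosed n pth u v s = (ray_cross s u v \<noteq> (ring_cross n s u \<noteq> ring_cross n s v))" for s
    unfolding enclosed_def ray_parity_def by simp argo
  show ?thesis unfolding * using assms(2,5,6) unfolding boundary_edge_def by metis
qed

text \<open>The three closed paths add up to the boundary of the triangle \<open>s\<close>, which encloses only
  \<open>s\<close>.\<close>

lemma triangle_parity:
  assumes "tri_verts s = {u,v,x}" "lat_adj u v" "lat_adj v x" "lat_adj x u"
  shows "((enclosed n pth u v t \<noteq> enclosed n pth v x t) \<noteq> enclosed n pth x u t) = (t = s)"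
proof -
  have "((ray_cross t u v \<noteq> ray_cross t v x) \<noteq> ray_cross t x u) = (t = s)"
  proof -
    have *: "((ray_cross t a b \<noteq> ray_cross t b c) \<noteq> ray_cross t c a) = (t = s)" 
      if "s = (i, 2*m) \<and> a = (i,m) \<and> b = (i+1,m) \<and> c = (i+1,m+1) \<or> 
          s = (i, 2*m+1) \<and> a = (i,m) \<and> b = (i,m+1) \<and> c = (i+1,m+1)" for a b c i m
    proof -
      obtain t1 t2 where t: "t = (t1,t2)" by (cases t)
      have 1: "ray_cross t (i',m1) (i'+1,m2) \<longleftrightarrow> t1 = i' \<and> m1 + m2 > t2" "ray_cross t (i'+1,m1) (i',m2) \<longleftrightarrow> t1 = i' \<and> m1 + m2 > t2" 
        "\<not> ray_cross t (i',m1) (i',m2)" for i' m1 m2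
        unfolding t ray_cross_def by auto
      from that show ?thesis
      proof
        assume "s = (i, 2*m) \<and> a = (i,m) \<and> b = (i+1,m) \<and> c = (i+1,m+1)"
        then have [simp]: "s = (i, 2*m)" "a = (i,m)" "b = (i+1,m)" "c = (i+1,m+1)" by auto
        show ?thesis by (simp add: 1[unfolded t] t; linarith)
      next
        assume "s = (i, 2*m+1) \<and> a = (i,m) \<and> b = (i,m+1) \<and> c = (i+1,m+1)"
        then have [simp]: "s = (i, 2*m+1)" "a = (i,m)" "b = (i,m+1)" "c = (i+1,m+1)" by auto
        show ?thesis by (simp add: 1[unfolded t] t; linarith)
      qed
    qed
    obtain a b c i m where abc: "{a,b,c} = {u,v,x}" "s = (i, 2*m) \<and> a = (i,m) \<and> b = (i+1,m) \<and> c = (i+1,m+1) \<or> 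
          s = (i, 2*m+1) \<and> a = (i,m) \<and> b = (i,m+1) \<and> c = (i+1,m+1)"
    proof (rule tri_cases[of s])
      fix i m assume s: "s = (i, 2*m)"
      show thesis by (rule that[OF assms(1)[unfolded s tri_verts_even], of i m]) (simp add: s)
    next
      fix i m assume s: "s = (i, 2*m+1)"
      show thesis by (rule that[OF assms(1)[unfolded s tri_verts_odd], of i m]) (simp add: s)
    qed
    have d: "u \<noteq> v" "v \<noteq> x" "x \<noteq> u" using assms lat_adj_neq by auto
    have "u \<in> {a,b,c}" "v \<in> {a,b,c}" "x \<in> {a,b,c}" using abc(1) by auto
    with d have D: "u = a \<and> v = b \<and> x = c \<or> u = a \<and> v = c \<and> x = b \<or> u = b \<and> v = a \<and> x = c \<or>
      u = b \<and> v = c \<and> x = a \<or> u = c \<and> v = a \<and> x = b \<or> u = c \<and> v = b \<and> x = a"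
      by auto
    show ?thesis
      using D *[OF abc(2)] ray_cross_sym[of t a b] ray_cross_sym[of t b c] ray_cross_sym[of t c a]
      by (elim disjE conjE; hypsubst; argo)
  qed
  then show ?thesis unfolding enclosed_def by argo
qed


section \<open>Searching the lattice along a spanning tree\<close>

lemma vertex_triangles:
  "(i,j) \<in> tri_verts t \<longleftrightarrow> t \<in> {(i,2*j-1),(i,2*j),(i,2*j+1),(i-1,2*j),(i-1,2*j-1),(i-1,2*(j-1))}"
proof -
  have odd: "2*m \<noteq> 2*j-1" "2*m \<noteq> 2*j+1" "2*j \<noteq> 2*m+1" "2*m+1 \<noteq> 2*j" "2*m+1 = 2*j-1 \<longleftrightarrow> m = j-1" "2*m+1 = 2*(j-1) \<longleftrightarrow> False" for m :: int
    by presburger+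
  show ?thesis
    by (rule tri_cases[of t]; auto simp: tri_verts_even tri_verts_odd odd)
qed

lemma enclosed_across_free_edge:
  assumes "edge_link n w b t t'" "lat_tree n D pth" "u \<in> D" "v \<in> D" "lat_adj u v"
    and w: "w \<notin> set (pth u)" "w \<notin> set (pth v)"
  shows "enclosed n pth u v t = enclosed n pth u v t'"
proof -
  have "\<not> path_parity (\<lambda>x y. {x,y} = {w,b}) (pth u)" "\<not> path_parity (\<lambda>x y. {x,y} = {w,b}) (pth v)"
    using edge_on_path[OF assms(2)] assms by blast+
  moreover have "u \<in> set (pth u)" "v \<in> set (pth v)"
    using lat_tree_hd[OF assms(2)] assms(3,4) by fastforce+
  then have "{u,v} \<noteq> {w,b}" using w by (metis doubleton_eq_iff)
  ultimately show ?thesis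
    using enclosed_flip[OF assms(1-5)] by metis
qed

text \<open>The six triangles around a vertex \<open>w\<close> are separated by edges at \<open>w\<close>, and
  none of them is on a path that avoids \<open>w\<close>. So the closed path of \<open>u\<close> and
  \<open>v\<close> has a well-defined side at each vertex that it avoids.\<close>

lemma enclosed_around_vertex:
  assumes "lat_tree n D pth" "u \<in> D" "v \<in> D" "lat_adj u v"
    and w: "w \<notin> set (pth u)" "w \<notin> set (pth v)" "w \<in> lat_inner n"
    and t: "w \<in> tri_verts t" "w \<in> tri_verts t'"
  shows "enclosed n pth u v t = enclosed n pth u v t'"
proof -
  obtain i j where ij: "w = (i,j)" by (cases w)
  have inn: "-n < i" "i < n" "-n \<le> j" "j < n" "-n < j" using w(3) by (auto simp: ij lat_inner_def)
  have flip: "enclosed n pth u v s = enclosed n pth u v s'" if "edge_link n (i,j) b s s'" for s s' b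
    using enclosed_across_free_edge[OF that assms(1-4)] w by (simp add: ij)
  let ?e = "enclosed n pth u v"
  have "?e (i,2*j-1) = ?e (i,2*j)" by (rule flip[OF edge_link_vertical])
  moreover have "?e (i,2*j) = ?e (i,2*j+1)" by (rule flip[OF edge_link_diagonal])
  moreover have "?e (i,2*j+1) = ?e (i-1,2*j)" by (rule flip[OF edge_link_horizontal[OF inn(1-4)]])
  moreover have "?e (i-1,2*j-1) = ?e (i-1,2*j)"
    using flip[OF edge_link_swap[OF edge_link_vertical[of n "i-1" j, simplified]]] .
  moreover have "?e (i-1,2*(j-1)) = ?e (i-1,2*j-1)"
    using flip[OF edge_link_swap[OF edge_link_diagonal[of n "i-1" "j-1", simplified]]] by (simp add: algebra_simps)
  ultimately have "s \<in> {(i,2*j-1),(i,2*j),(i,2*j+1),(i-1,2*j),(i-1,2*j-1),(i-1,2*(j-1))} \<Longrightarrow> ?e s = ?e (i,2*j)" for s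
    by blast
  then have "(i,j) \<in> tri_verts s \<Longrightarrow> ?e s = ?e (i,2*j)" for s
    unfolding vertex_triangles .
  with t show ?thesis unfolding ij by blast
qed

lemma adjacent_common_triangle:
  assumes "lat_adj a b"
  shows "\<exists>t. a \<in> tri_verts t \<and> b \<in> tri_verts t"
  using assms
proof (cases rule: lat_adj_cases)
  case (1 i j) then have "{a,b} \<subseteq> tri_verts (i,2*j)" using verts_vertical[of i j] by simp
  then show ?thesis by blast
next
  case (2 i j) then have "{a,b} \<subseteq> tri_verts (i,2*j)" using verts_diagonal[of i j] by simp
  then show ?thesis by blast
next
  case (3 i j) then have "{a,b} \<subseteq> tri_verts (i,2*j+1)" using verts_horizontal[of i j] by simp
  then show ?thesis by blast
qed

lemma third_vertex:
  assumes "lat_adj u v" "{u,v} \<subseteq> tri_verts t"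
  obtains x where "tri_verts t = {u,v,x}" "lat_adj v x" "lat_adj x u"
proof -
  obtain a b c where abc: "tri_verts t = {a,b,c}" "lat_adj a b" "lat_adj b c" "lat_adj c a"
    by (rule tri_cases[of t]) (auto simp: tri_verts_even tri_verts_odd lat_adj_def intro!: that)
  have "u \<noteq> v" using assms lat_adj_neq by blast
  moreover have "u \<in> {a,b,c}" "v \<in> {a,b,c}" using assms abc by auto
  ultimately have "u = a \<and> v = b \<or> u = a \<and> v = c \<or> u = b \<and> v = a \<or> u = b \<and> v = c \<or> u = c \<and> v = a \<or> u = c \<and> v = b"
    by auto
  moreover have "{a,b,c} = {a,c,b}" "{a,b,c} = {b,a,c}" "{a,b,c} = {b,c,a}" "{a,b,c} = {c,a,b}" "{a,b,c} = {c,b,a}"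
    by blast+
  ultimately show thesis
    using that abc lat_adj_sym by metis
qed

lemma tri_inside_verts: "tri_inside n t \<Longrightarrow> tri_verts t \<subseteq> lat_square n"
  by (rule tri_cases[of t]) (auto simp: tri_inside_def lat_square_def tri_verts_even tri_verts_odd)

text \<open>Where the robber can go as long as the vertices in \<open>B\<close> and the boundary are guarded.\<close>

definition free_reach :: "int \<Rightarrow> (int \<times> int) set \<Rightarrow> int \<times> int \<Rightarrow> int \<times> int \<Rightarrow> bool" where
  "free_reach n B = (\<lambda>a b. lat_adj a b \<and> b \<in> lat_inner n - B)\<^sup>*\<^sup>*"

lemma enclosed_free_reach:
  assumes "free_reach n (set (pth u) \<union> set (pth v)) w w'"
    and tree: "lat_tree n D pth" "u \<in> D" "v \<in> D" "lat_adj u v"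
    and w: "w \<in> lat_inner n" "w \<notin> set (pth u) \<union> set (pth v)"
    and t: "w \<in> tri_verts t"
  shows "w' \<in> lat_inner n - (set (pth u) \<union> set (pth v)) \<and>
     (\<forall>t'. w' \<in> tri_verts t' \<longrightarrow> enclosed n pth u v t' = enclosed n pth u v t)"
  using assms(1) unfolding free_reach_def
proof (induction rule: rtranclp_induct)
  case base
  then show ?case using enclosed_around_vertex[OF tree] w t by blast
next
  case (step y z)
  obtain s where s: "y \<in> tri_verts s" "z \<in> tri_verts s"
    using adjacent_common_triangle step(2) by blast
  from step s have "enclosed n pth u v s = enclosed n pth u v t" by blast
  then show ?case using enclosed_around_vertex[OF tree _ _ _ s(2)] step(2) by blast
qed

text \<open>\<open>W u v w\<close> stands for: the cops win if they guard the branches of \<open>u\<close> and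
  \<open>v\<close> and the robber is at \<open>w\<close>. The hypothesis on \<open>W\<close> is the effect
  of sending the third cop to the branch of \<open>x\<close>.

  The walk has crossed the edges \<open>Es\<close> and visited the triangles \<open>Vis\<close>; it is now
  in the triangle \<open>s\<close> with the edge \<open>{u, v}\<close>, and the robber is on the same side
  of the closed path of \<open>{u, v}\<close> as \<open>s\<close>. The three invariants say that both
  triangles at a crossed edge have been visited, that no other edge separates visited triangles, and that
  only the edge \<open>{u, v}\<close> of \<open>s\<close> has been crossed. By
  \<open>triangle_parity\<close> exactly one of the other two edges has the robber on its other side. It
  has not been crossed and it is no tree edge, so the triangle behind it is not among the visited ones.
  Each crossing makes \<open>Es\<close> larger.\<close>

lemma lattice_search_aux:
  assumes n: "n \<ge> 1" and tree: "lat_tree n (lat_square n) pth"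
    and step: "\<And>u v x w. u \<in> lat_square n \<Longrightarrow> v \<in> lat_square n \<Longrightarrow> x \<in> lat_square n \<Longrightarrow> w \<in> lat_inner n \<Longrightarrow>
      w \<notin> set (pth u) \<union> set (pth v) \<Longrightarrow>
      (\<And>w'. free_reach n (set (pth u) \<union> set (pth v)) w w' \<Longrightarrow> w' \<in> lat_inner n \<Longrightarrow>
          w' \<notin> set (pth u) \<union> set (pth v) \<union> set (pth x) \<Longrightarrow> W u x w' \<or> W v x w') \<Longrightarrow> W u v w"
    and Es: "Es \<subseteq> Pow (lat_square n)" and Vis: "\<forall>t\<in>Vis. tri_inside n t"
    and edge: "lat_adj u v" "{u,v} \<subseteq> tri_verts s" "s \<in> Vis"
    and i1: "\<forall>a b t. {a,b} \<in> Es \<longrightarrow> {a,b} \<subseteq> tri_verts t \<longrightarrow> tri_inside n t \<longrightarrow> t \<in> Vis"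
    and i2: "\<forall>a\<in>lat_square n. \<forall>b\<in>lat_square n. \<forall>t\<in>Vis. \<forall>t'\<in>Vis. lat_adj a b \<longrightarrow> {a,b} \<notin> Es \<longrightarrow>
        enclosed n pth a b t = enclosed n pth a b t'"
    and i3: "\<forall>a b. a \<noteq> b \<longrightarrow> {a,b} \<subseteq> tri_verts s \<longrightarrow> {a,b} \<in> Es \<longrightarrow> {a,b} = {u,v}"
    and w: "w \<in> lat_inner n" "w \<notin> set (pth u) \<union> set (pth v)"
    and t: "w \<in> tri_verts t" "enclosed n pth u v t = enclosed n pth u v s"
  shows "W u v w"
  using Es Vis edge i1 i2 i3 w t
proof (induction "card (Pow (lat_square n) - Es)" arbitrary: Es Vis u v s w t rule: less_induct)
  case less
  note Es = less.prems(1) and Vis = less.prems(2) and edge = less.prems(3-5) and i1 = less.prems(6) and i2 = less.prems(7)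
    and i3 = less.prems(8) and w = less.prems(9-10) and t = less.prems(11-12)
  let ?D = "lat_square n"
  have ins: "tri_inside n s" using Vis edge by blast
  obtain x where x: "tri_verts s = {u,v,x}" "lat_adj v x" "lat_adj x u"
    using third_vertex edge by blast
  have uvx: "u \<in> ?D" "v \<in> ?D" "x \<in> ?D" using tri_inside_verts[OF ins] x by auto
  have dist: "u \<noteq> v" "v \<noteq> x" "x \<noteq> u" using edge x lat_adj_neq by auto
  have fin: "finite (Pow ?D - Es)" by (simp add: lat_square_def)
  have key: "W a x w'" if a: "a \<in> {u,v}" "lat_adj a x" and w': "w' \<in> lat_inner n" "w' \<notin> set (pth a) \<union> set (pth x)"
    and t': "w' \<in> tri_verts t'" "enclosed n pth a x t' \<noteq> enclosed n pth a x s" and int: "tri_inside n t'" for a w' t'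
  proof -
    have aD: "a \<in> ?D" using a uvx by auto
    have ax: "{a,x} \<subseteq> tri_verts s" using a x by auto
    have "{a,x} \<noteq> {u,v}" using dist a by (auto simp: doubleton_eq_iff)
    then have nEs: "{a,x} \<notin> Es" using i3 ax a(2) lat_adj_neq by blast
    have ntree: "\<not> tree_edge ?D pth a x" using enclosed_tree_edge[OF tree] t'(2) by blast
    have "\<not> boundary_edge n a x" 
      using enclosed_boundary_edge[OF tree _ aD uvx(3) int ins] lat_square_split t'(2) by blast
    then obtain s' where s': "across n a x s s'"
      using across_cases[OF a(2) aD uvx(3) ins ax n] by blast
    then have s'D: "s' \<noteq> s" "tri_inside n s'" "{a,x} \<subseteq> tri_verts s'" "edge_link n a x s s'"
      "\<And>r. {a,x} \<subseteq> tri_verts r \<Longrightarrow> r = s \<or> r = s'" unfolding across_def by auto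
    have np: "\<not> path_parity (\<lambda>p q. {p,q} = {a,x}) (pth z)" if "z \<in> ?D" for z
      using edge_on_path[OF tree that] ntree by blast
    have flip: "(enclosed n pth b c s \<noteq> enclosed n pth b c s') = ({b,c} = {a,x})" if "b \<in> ?D" "c \<in> ?D" "lat_adj b c" for b c
      using enclosed_flip[OF s'D(4) tree that] np[OF that(1)] np[OF that(2)] by metis
    \<comment> \<open>crossing \<open>{a, x}\<close> changes the side of the closed path of \<open>{a, x}\<close>, on which all visited triangles agree\<close>
    have nVis: "s' \<notin> Vis" 
      using i2 aD uvx(3) edge(3) a(2) nEs flip[OF aD uvx(3) a(2)] by blast
    have EsD: "insert {a,x} Es \<subseteq> Pow ?D" using Es aD uvx by auto
    have smaller: "card (Pow ?D - insert {a,x} Es) < card (Pow ?D - Es)"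
      using fin nEs EsD by (intro psubset_card_mono) auto
    show "W a x w'"
    proof (rule less.hyps[OF smaller, of "insert s' Vis" a x s' w' t'])
      show "insert {a,x} Es \<subseteq> Pow ?D" by (rule EsD)
      show "\<forall>t\<in>insert s' Vis. tri_inside n t" using Vis s'D by auto
      show "lat_adj a x" by fact
      show "{a,x} \<subseteq> tri_verts s'" by fact
      show "s' \<in> insert s' Vis" by simp
      show "\<forall>b c t. {b,c} \<in> insert {a,x} Es \<longrightarrow> {b,c} \<subseteq> tri_verts t \<longrightarrow> tri_inside n t \<longrightarrow> t \<in> insert s' Vis"
      proof (intro allI impI)
        fix b c r assume r: "{b,c} \<in> insert {a,x} Es" "{b,c} \<subseteq> tri_verts r" "tri_inside n r"
        show "r \<in> insert s' Vis"
        proof (cases "{b,c} = {a,x}")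
          case True
          then have "r = s \<or> r = s'" using r(2) s'D(5) by simp
          then show ?thesis using edge(3) by blast
        next
          case False
          then show ?thesis using r i1 by blast
        qed
      qed
      show "\<forall>b\<in>?D. \<forall>c\<in>?D. \<forall>t\<in>insert s' Vis. \<forall>t'\<in>insert s' Vis. lat_adj b c \<longrightarrow> {b,c} \<notin> insert {a,x} Es \<longrightarrow>
        enclosed n pth b c t = enclosed n pth b c t'"
      proof (intro ballI impI)
        fix b c r r' assume bc: "b \<in> ?D" "c \<in> ?D" "r \<in> insert s' Vis" "r' \<in> insert s' Vis" "lat_adj b c" "{b,c} \<notin> insert {a,x} Es"
        then have e: "enclosed n pth b c s = enclosed n pth b c s'" using flip by blast
        have "enclosed n pth b c q = enclosed n pth b c s" if "q \<in> insert s' Vis" for q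
        proof (cases "q = s'")
          case False
          then have "q \<in> Vis" using that by blast
          then show ?thesis using i2 bc edge(3) by blast
        qed (use e in simp)
        then show "enclosed n pth b c r = enclosed n pth b c r'" using bc(3,4) by simp
      qed
      show "\<forall>b c. b \<noteq> c \<longrightarrow> {b,c} \<subseteq> tri_verts s' \<longrightarrow> {b,c} \<in> insert {a,x} Es \<longrightarrow> {b,c} = {a,x}"
        using i1 nVis s'D(2) by blast
      show "w' \<in> lat_inner n" "w' \<notin> set (pth a) \<union> set (pth x)" "w' \<in> tri_verts t'" using w' t' by auto
      show "enclosed n pth a x t' = enclosed n pth a x s'" using flip[OF aD uvx(3) a(2)] t'(2) by blast
    qed
  qed
  show "W u v w"
  proof (rule step[OF uvx w(1,2)])
    fix w' assume w': "free_reach n (set (pth u) \<union> set (pth v)) w w'" "w' \<in> lat_inner n"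
      "w' \<notin> set (pth u) \<union> set (pth v) \<union> set (pth x)"
    obtain i j where ij: "w' = (i,j)" by (cases w')
    have t': "w' \<in> tri_verts (i,2*j)" unfolding ij vertex_triangles by simp
    have int: "tri_inside n (i,2*j)" using w'(2) by (auto simp: ij lat_inner_def tri_inside_def)
    have "enclosed n pth u v (i,2*j) = enclosed n pth u v s"
      using enclosed_free_reach[OF w'(1) tree uvx(1,2) edge(1) w(1,2) t(1)] t' t(2) by blast
    moreover have "(i,2*j) \<noteq> s"
    proof
      assume "(i,2*j) = s"
      then have "w' \<in> {u,v,x}" using t' x by simp
      moreover have "u \<in> set (pth u)" "v \<in> set (pth v)" "x \<in> set (pth x)"
        using lat_tree_hd[OF tree] uvx by fastforce+
      ultimately show False using w'(3) by blast
    qed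
    then have "((enclosed n pth u v (i,2*j) \<noteq> enclosed n pth v x (i,2*j)) \<noteq> enclosed n pth x u (i,2*j)) = False"
      using triangle_parity[OF x(1) edge(1) x(2,3), of n pth "(i,2*j)"] by metis
    moreover have "((enclosed n pth u v s \<noteq> enclosed n pth v x s) \<noteq> enclosed n pth x u s) = True"
      using triangle_parity[OF x(1) edge(1) x(2,3), of n pth s] by argo
    ultimately have "enclosed n pth v x (i,2*j) \<noteq> enclosed n pth v x s \<or> enclosed n pth x u (i,2*j) \<noteq> enclosed n pth x u s"
      by argo
    then show "W u x w' \<or> W v x w'"
    proof
      assume "enclosed n pth v x (i,2*j) \<noteq> enclosed n pth v x s"
      from key[OF _ x(2) w'(2) _ t' this int] w'(3) show ?thesis by simp
    next
      assume "enclosed n pth x u (i,2*j) \<noteq> enclosed n pth x u s"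
      then have "enclosed n pth u x (i,2*j) \<noteq> enclosed n pth u x s" unfolding enclosed_sym[of n pth u x] .
      from key[OF _ lat_adj_sym[OF x(3)] w'(2) _ t' this int] w'(3) show ?thesis by simp
    qed
  qed
qed

text \<open>The walk starts at an edge of the boundary, whose closed path has all triangles of the square on the
  same side.\<close>

lemma lattice_search:
  assumes n: "n \<ge> 1" and tree: "lat_tree n (lat_square n) pth"
    and step: "\<And>u v x w. u \<in> lat_square n \<Longrightarrow> v \<in> lat_square n \<Longrightarrow> x \<in> lat_square n \<Longrightarrow> w \<in> lat_inner n \<Longrightarrow>
      w \<notin> set (pth u) \<union> set (pth v) \<Longrightarrow>
      (\<And>w'. free_reach n (set (pth u) \<union> set (pth v)) w w' \<Longrightarrow> w' \<in> lat_inner n \<Longrightarrow>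
          w' \<notin> set (pth u) \<union> set (pth v) \<union> set (pth x) \<Longrightarrow> W u x w' \<or> W v x w') \<Longrightarrow> W u v w"
    and w: "w \<in> lat_inner n"
  shows "W (-n,-n) (-n,-n+1) w"
proof -
  let ?u = "(-n,-n)" and ?v = "(-n,-n+1)"
  obtain i j where ij: "w = (i,j)" by (cases w)
  have t': "w \<in> tri_verts (i,2*j)" unfolding ij vertex_triangles by simp
  have int: "tri_inside n (i,2*j)" using w by (auto simp: ij lat_inner_def tri_inside_def)
  have ins: "tri_inside n (-n,2*(-n)+1)" using n by (auto simp: tri_inside_def)
  have b: "boundary_edge n ?u ?v"
    using n unfolding boundary_edge_def
    by (auto simp: ray_cross_def ring_cross_def tri_inside_def lat_ring_def lat_square_def lat_inner_def
        intro!: exI[of _ False])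
  have D: "?u \<in> lat_square n" "?v \<in> lat_square n" using n by (auto simp: lat_square_def)
  have r: "?u \<in> lat_ring n" "?v \<in> lat_ring n" using b unfolding boundary_edge_def by auto
  then have "pth ?u = [?u]" "pth ?v = [?v]"
    using tree D lat_square_split(2)[of n] unfolding lat_tree_def by blast+
  then have w': "w \<notin> set (pth ?u) \<union> set (pth ?v)" using r w lat_square_split(2)[of n] by auto
  show ?thesis
  proof (rule lattice_search_aux[OF n tree, where W = W and Es = "{}" and Vis = "{(-n,2*(-n)+1)}" and s = "(-n,2*(-n)+1)" and t = "(i,2*j)"])
    fix u v x w
    assume "u \<in> lat_square n" "v \<in> lat_square n" "x \<in> lat_square n" "w \<in> lat_inner n"
      "w \<notin> set (pth u) \<union> set (pth v)"
      and *: "\<And>w'. free_reach n (set (pth u) \<union> set (pth v)) w w' \<Longrightarrow> w' \<in> lat_inner n \<Longrightarrow>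
          w' \<notin> set (pth u) \<union> set (pth v) \<union> set (pth x) \<Longrightarrow> W u x w' \<or> W v x w'"
    from step[OF this(1-5)] * show "W u v w" by blast
  next
    show "enclosed n pth ?u ?v (i, 2*j) = enclosed n pth ?u ?v (-n, 2*(-n)+1)"
      by (rule enclosed_boundary_edge[OF tree b D int ins lat_square_split(2)])
    show "{?u,?v} \<subseteq> tri_verts (-n, 2*(-n)+1)" unfolding tri_verts_odd by simp
  qed (use w w' t' ins in \<open>auto simp: lat_adj_def\<close>)
qed


section \<open>Guarding branches\<close>

text \<open>The space is covered by closed sets \<open>cell v\<close> that are indexed by the vertices of the
  square. All cells on the branch of \<open>u\<close>, and the cells of the boundary, are near the path
  \<open>gam u\<close> in the sense of \<open>near\<close>: a robber in such a cell is within
  \<open>e\<close> of the cop who guards this path.\<close>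

locale guarded_cells =
  fixes X :: "'a::metric_space set" and z0 :: 'a and n :: int and cell :: "int \<times> int \<Rightarrow> 'a set"
    and pth :: "int \<times> int \<Rightarrow> (int \<times> int) list" and gam :: "int \<times> int \<Rightarrow> real \<Rightarrow> 'a"
    and len :: "int \<times> int \<Rightarrow> real" and e :: real
  assumes geo: "geodesic_space X" and z0: "z0 \<in> X" and n: "n \<ge> 1"
    and cell_closed: "v \<in> lat_square n \<Longrightarrow> closed (cell v)"
    and cell_cover: "X \<subseteq> (\<Union>v\<in>lat_square n. cell v)"
    and cell_adj: "v \<in> lat_inner n \<Longrightarrow> w \<in> lat_inner n \<Longrightarrow> v \<noteq> w \<Longrightarrow> cell v \<inter> cell w \<noteq> {} \<Longrightarrow> lat_adj v w"
    and tree: "lat_tree n (lat_square n) pth"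
    and len_nonneg: "u \<in> lat_square n \<Longrightarrow> 0 \<le> len u"
    and gam_0: "u \<in> lat_square n \<Longrightarrow> gam u 0 = z0"
    and gam_in: "u \<in> lat_square n \<Longrightarrow> 0 \<le> t \<Longrightarrow> t \<le> len u \<Longrightarrow> gam u t \<in> X"
    and gam_lip: "u \<in> lat_square n \<Longrightarrow> 0 \<le> s \<Longrightarrow> s \<le> t \<Longrightarrow> t \<le> len u \<Longrightarrow> dist (gam u s) (gam u t) \<le> t - s"
    and near: "u \<in> lat_square n \<Longrightarrow> w \<in> set (pth u) \<union> lat_ring n \<Longrightarrow> x \<in> cell w \<Longrightarrow>
      dist (gam u (min (dist z0 x) (len u))) x \<le> e"
begin

definition shadow_time :: "int \<times> int \<Rightarrow> 'a \<Rightarrow> real" where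
  "shadow_time u x = min (dist z0 x) (len u)"

text \<open>The position of a cop who guards the branch of \<open>u\<close>.\<close>

definition shadow :: "int \<times> int \<Rightarrow> 'a \<Rightarrow> 'a" where
  "shadow u x = gam u (shadow_time u x)"

lemma shadow_time_bounds: "u \<in> lat_square n \<Longrightarrow> 0 \<le> shadow_time u x \<and> shadow_time u x \<le> len u"
  using len_nonneg by (auto simp: shadow_time_def)

lemma shadow_time_lip: "\<bar>shadow_time u x - shadow_time u y\<bar> \<le> dist x y"
  unfolding shadow_time_def using dist_triangle[of z0 x y] dist_triangle[of z0 y x]
  by (auto simp: min_def dist_commute)

lemma shadow_in: "u \<in> lat_square n \<Longrightarrow> shadow u x \<in> X"
  unfolding shadow_def using gam_in shadow_time_bounds by blast

lemma gam_lip': "u \<in> lat_square n \<Longrightarrow> 0 \<le> s \<Longrightarrow> s \<le> len u \<Longrightarrow> 0 \<le> t \<Longrightarrow> t \<le> len u \<Longrightarrow> dist (gam u s) (gam u t) \<le> \<bar>t - s\<bar>"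
  using gam_lip[of u s t] gam_lip[of u t s] by (cases "s \<le> t") (auto simp: dist_commute)

lemma shadow_lip:
  assumes "u \<in> lat_square n" shows "dist (shadow u x) (shadow u y) \<le> dist x y"
  using gam_lip'[OF assms, of "shadow_time u x" "shadow_time u y"] shadow_time_bounds[OF assms]
    shadow_time_lip[of u x y] unfolding shadow_def by fastforce

lemma shadow_near:
  assumes "u \<in> lat_square n" "w \<in> set (pth u) \<union> lat_ring n" "x \<in> cell w"
  shows "dist (shadow u x) x \<le> e"
  using near[OF assms] unfolding shadow_def shadow_time_def .

text \<open>When the robber's move from \<open>r\<close> to \<open>r'\<close> meets a cell of the guarded branch
  in a point \<open>y\<close>, the distance from the cop at the shadow of \<open>r\<close> via the shadow
  of \<open>y\<close> and \<open>y\<close> to \<open>r'\<close> is at most \<open>e\<close> plus the length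
  of the move.\<close>

lemma crossing_response:
  assumes u: "u \<in> lat_square n" and w: "w \<in> set (pth u) \<union> lat_ring n"
    and \<gamma>: "geodesic_arc X \<gamma> r r'" and r: "r \<in> X" "r' \<in> X"
    and t: "t \<in> {0..dist r r'}" "\<gamma> t \<in> cell w"
    and T: "dist r r' \<le> T"
  obtains c' where "c' \<in> X" "dist (shadow u r) c' \<le> T" "dist r' c' \<le> e"
proof -
  have e: "0 \<le> e" using shadow_near[OF u w t(2)] zero_le_dist order_trans by blast
  have T0: "0 \<le> T" using T zero_le_dist order_trans by blast
  have "dist (shadow u r) r' \<le> dist (shadow u r) (shadow u (\<gamma> t)) + dist (shadow u (\<gamma> t)) (\<gamma> t) + dist (\<gamma> t) r'"
    using dist_triangle[of "shadow u r" r' "\<gamma> t"] dist_triangle[of "shadow u r" "\<gamma> t" "shadow u (\<gamma> t)"] by linarith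
  also have "\<dots> \<le> dist r (\<gamma> t) + e + dist (\<gamma> t) r'"
    using shadow_lip[OF u] shadow_near[OF u w t(2)] by (intro add_mono) auto
  also have "\<dots> \<le> T + e"
    using geodesic_arc_dist[OF \<gamma>, of t] t T by simp
  finally obtain c' where "c' \<in> X" "dist (shadow u r) c' \<le> T" "dist c' r' \<le> e"
    using geodesic_step[OF geo shadow_in[OF u] r(2) _ T0 e] by blast
  then show thesis using that by (simp add: dist_commute)
qed

text \<open>A geodesic is connected and the cells are closed, so a robber who moves along it without touching a
  guarded cell passes only from cells to adjacent cells.\<close>

lemma uncrossed_reach:
  assumes \<gamma>: "geodesic_arc X \<gamma> r r'" and r: "r \<in> X" "r' \<in> X"
    and avoid: "\<And>t w. t \<in> {0..dist r r'} \<Longrightarrow> w \<in> B \<union> lat_ring n \<Longrightarrow> \<gamma> t \<notin> cell w"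
    and w: "free_reach n B w w'" "w' \<in> lat_inner n" "r \<in> cell w'"
  obtains w'' where "free_reach n B w w''" "w'' \<in> lat_inner n" "r' \<in> cell w''"
proof -
  define A where "A = {a \<in> lat_inner n - B. free_reach n B w a}"
  define A' where "A' = lat_inner n - B - A"
  let ?I = "\<gamma> ` {0..dist r r'}"
  have fin: "finite (lat_inner n)" by (simp add: lat_inner_def)
  have AI: "A \<subseteq> lat_inner n" "A' \<subseteq> lat_inner n" unfolding A_def A'_def by auto
  have cl: "closed (\<Union>a\<in>C. cell a)" if "C \<subseteq> lat_inner n" for C
    using that finite_subset[OF that fin] cell_closed lat_square_split by (intro closed_UN) auto
  have rI: "r \<in> ?I" "r' \<in> ?I"
    using \<gamma> unfolding geodesic_arc_def by (auto simp: image_iff intro: bexI[of _ 0] bexI[of _ "dist r r'"])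
  have cov: "?I \<subseteq> (\<Union>a\<in>A. cell a) \<union> (\<Union>a\<in>A'. cell a)"
  proof
    fix y assume "y \<in> ?I"
    then obtain t where t: "t \<in> {0..dist r r'}" "y = \<gamma> t" by blast
    then have "y \<in> X" using geodesic_arc_dist(1)[OF \<gamma>, of t] by simp
    then obtain v where v: "v \<in> lat_square n" "y \<in> cell v" using cell_cover by blast
    then have "v \<notin> B \<union> lat_ring n" using avoid[of t v] t by blast
    then have "v \<in> lat_inner n - B" using v(1) lat_square_split by blast
    then have "v \<in> A \<union> A'" unfolding A'_def by blast
    then show "y \<in> (\<Union>a\<in>A. cell a) \<union> (\<Union>a\<in>A'. cell a)" using v(2) by blast
  qed
  have "w' \<in> A"
  proof -
    have "r = \<gamma> 0" using \<gamma> unfolding geodesic_arc_def by simp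
    then have "w' \<notin> B" using avoid[of 0 w'] w(3) by auto
    then show ?thesis using w unfolding A_def by blast
  qed
  have disj: "(\<Union>a\<in>A. cell a) \<inter> (\<Union>a\<in>A'. cell a) \<inter> ?I = {}"
  proof (rule ccontr)
    assume "\<not> ?thesis"
    then obtain a b y where ab: "a \<in> A" "b \<in> A'" "y \<in> cell a" "y \<in> cell b" by blast
    then have "lat_adj a b" using cell_adj[of a b] AI unfolding A'_def by blast
    moreover have "b \<in> lat_inner n - B" "free_reach n B w a" using ab unfolding A'_def A_def by auto
    ultimately have "free_reach n B w b"
      unfolding free_reach_def by (metis (mono_tags, lifting) rtranclp.rtrancl_into_rtrancl)
    then show False using ab unfolding A'_def A_def by blast
  qed
  have "connected ?I"
    using geodesic_arc_connected[OF \<gamma>] by (rule connected_continuous_image) simp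
  then have "(\<Union>a\<in>A. cell a) \<inter> ?I = {} \<or> (\<Union>a\<in>A'. cell a) \<inter> ?I = {}"
    using connected_closedD[OF _ disj cov cl[OF AI(1)] cl[OF AI(2)]] by blast
  moreover have "r \<in> (\<Union>a\<in>A. cell a) \<inter> ?I" using \<open>w' \<in> A\<close> w(3) rI by blast
  ultimately have "r' \<in> (\<Union>a\<in>A. cell a)" using cov rI by blast
  then show thesis using that unfolding A_def by blast
qed

definition guards :: "(nat \<Rightarrow> 'a) \<Rightarrow> nat set \<Rightarrow> (nat \<Rightarrow> int \<times> int) \<Rightarrow> 'a \<Rightarrow> bool" where
  "guards c J g r \<longleftrightarrow> (\<forall>i\<in>J. c i = shadow (g i) r)"

text \<open>The robber has stayed in cells that can be reached from \<open>w\<close> without entering a guarded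
  cell. Nothing is known as long as no cop guards.\<close>

definition confined :: "nat set \<Rightarrow> (nat \<Rightarrow> int \<times> int) \<Rightarrow> int \<times> int \<Rightarrow> 'a \<Rightarrow> bool" where
  "confined J g w r \<longleftrightarrow> J = {} \<or>
     (\<exists>w'. free_reach n (\<Union>i\<in>J. set (pth (g i))) w w' \<and> w' \<in> lat_inner n \<and> r \<in> cell w')"

lemma confined_step:
  assumes J: "J \<subseteq> {..<k}" "\<And>i. i \<in> J \<Longrightarrow> g i \<in> lat_square n"
    and "guards c J g r" "confined J g w r" and r: "r \<in> X" "r' \<in> X" and T: "dist r r' \<le> T"
  shows "confined J g w r' \<or> (\<exists>i\<in>J. \<exists>p\<in>X. dist (c i) p \<le> T \<and> dist r' p \<le> e)"
proof (cases "J = {}")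
  case False
  obtain \<gamma> where \<gamma>: "geodesic_arc X \<gamma> r r'" using geodesic_arc_exists geo r by blast
  let ?B = "\<Union>i\<in>J. set (pth (g i))"
  show ?thesis
  proof (cases "\<exists>t\<in>{0..dist r r'}. \<exists>w\<in>?B \<union> lat_ring n. \<gamma> t \<in> cell w")
    case True
    then obtain t i w where t: "t \<in> {0..dist r r'}" "i \<in> J" "w \<in> set (pth (g i)) \<union> lat_ring n" "\<gamma> t \<in> cell w"
      using False by blast
    obtain p where "p \<in> X" "dist (shadow (g i) r) p \<le> T" "dist r' p \<le> e"
      using crossing_response[OF J(2)[OF t(2)] t(3) \<gamma> r t(1,4) T] by blast
    then show ?thesis using assms(3) t(2) unfolding guards_def by force
  next
    case avoid: False
    from assms(4) False obtain w' where w': "free_reach n ?B w w'" "w' \<in> lat_inner n" "r \<in> cell w'"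
      unfolding confined_def by blast
    obtain w'' where "free_reach n ?B w w''" "w'' \<in> lat_inner n" "r' \<in> cell w''"
      using uncrossed_reach[OF \<gamma> r _ w'] avoid by blast
    then show ?thesis unfolding confined_def by blast
  qed
qed (simp add: confined_def)

text \<open>A further cop \<open>l\<close> walks along \<open>\<Gamma>\<close>, which leads to \<open>z0\<close>
  and then along the path of \<open>x\<close>, as long as the shadow of the robber is ahead. The total
  agility is infinite, so the cop meets the shadow after finitely many steps; from then on it can stay
  there. Meanwhile the cops in \<open>J\<close> keep their guards.\<close>

lemma advance:
  assumes J: "J \<subseteq> {..<k}" "\<And>i. i \<in> J \<Longrightarrow> g i \<in> lat_square n" and l: "l < k" "l \<notin> J" and x: "x \<in> lat_square n"
    and \<Gamma>: "\<And>s t. - a \<le> s \<Longrightarrow> s \<le> t \<Longrightarrow> t \<le> len x \<Longrightarrow> dist (\<Gamma> s) (\<Gamma> t) \<le> t - s"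
      "\<And>t. - a \<le> t \<Longrightarrow> t \<le> len x \<Longrightarrow> \<Gamma> t \<in> X" "\<And>t. 0 \<le> t \<Longrightarrow> t \<le> len x \<Longrightarrow> \<Gamma> t = gam x t"
    and \<tau>: "\<And>m. m \<ge> 1 \<Longrightarrow> 0 \<le> \<tau> m"
    and goal: "\<And>N r c. r \<in> X \<Longrightarrow> \<forall>i<k. c i \<in> X \<Longrightarrow> confined J g w r \<Longrightarrow> guards c J g r \<Longrightarrow> c l = shadow x r \<Longrightarrow>
      cops_reach X k \<tau> e N r c"
    and "r \<in> X" "\<forall>i<k. c i \<in> X" "confined J g w r" "guards c J g r" "c l = \<Gamma> s" "- a \<le> s" "s \<le> shadow_time x r"
      "len x - s < (\<Sum>m\<in>{N<..N+K}. \<tau> m)"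
  shows "cops_reach X k \<tau> e N r c"
  using assms(11-)
proof (induction K arbitrary: N r c s)
  case 0
  then show ?case using shadow_time_bounds[OF x, of r] by simp
next
  case (Suc K)
  let ?T = "\<tau> (Suc N)"
  have T: "0 \<le> ?T" using \<tau> by simp
  show ?case
  proof (rule cops_reach.move)
    fix r' assume r': "r' \<in> X" "dist r r' \<le> ?T"
    consider "confined J g w r'" | i p where "i \<in> J" "p \<in> X" "dist (c i) p \<le> ?T" "dist r' p \<le> e"
      using confined_step[OF J Suc.prems(4,3,1) r'] by blast
    then show "\<exists>c'. (\<forall>i<k. c' i \<in> X \<and> dist (c i) (c' i) \<le> ?T) \<and> cops_reach X k \<tau> e (Suc N) r' c'"
    proof cases
      case 2
      have "cops_reach X k \<tau> e (Suc N) r' (c(i := p))"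
        by (rule cops_reach.near[of i]) (use 2 J in auto)
      moreover have "\<forall>j<k. (c(i := p)) j \<in> X \<and> dist (c j) ((c(i := p)) j) \<le> ?T"
        using 2 Suc.prems(2) T by auto
      ultimately show ?thesis by blast
    next
      case 1
      define s' where "s' = min (s + ?T) (shadow_time x r')"
      have st: "0 \<le> shadow_time x r'" "shadow_time x r' \<le> len x" using shadow_time_bounds[OF x] by auto
      have "shadow_time x r - ?T \<le> shadow_time x r'" using shadow_time_lip[of x r r'] r'(2) by linarith
      then have ss: "s - ?T \<le> s'" "s' \<le> s + ?T" using Suc.prems(7) T unfolding s'_def by auto
      show ?thesis
      proof (cases "s \<le> s'")
        case True
        define c' where "c' = (\<lambda>i. if i = l then \<Gamma> s' else if i \<in> J then shadow (g i) r' else c i)"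
        have s'le: "s' \<le> len x" "- a \<le> s'" using st True Suc.prems(6) unfolding s'_def by auto
        have c'X: "\<forall>i<k. c' i \<in> X" unfolding c'_def using \<Gamma>(2) s'le shadow_in J(2) Suc.prems(2) by auto
        have move: "\<forall>i<k. dist (c i) (c' i) \<le> ?T"
        proof (intro allI impI)
          fix i assume "i < k"
          consider "i = l" | "i \<noteq> l" "i \<in> J" | "i \<noteq> l" "i \<notin> J" by blast
          then show "dist (c i) (c' i) \<le> ?T"
          proof cases
            case 1
            then show ?thesis using \<Gamma>(1)[OF Suc.prems(6) True s'le(1)] ss Suc.prems(5) unfolding c'_def by simp
          next
            case 2
            then show ?thesis using Suc.prems(4) shadow_lip[OF J(2), of i r r'] r'(2) unfolding c'_def guards_def by force
          qed (use T in \<open>auto simp: c'_def\<close>)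
        qed
        have gd: "guards c' J g r'" using l(2) unfolding guards_def c'_def by auto
        have "cops_reach X k \<tau> e (Suc N) r' c'"
        proof (cases "s' = shadow_time x r'")
          case True
          then have "c' l = shadow x r'" using \<Gamma>(3)[of s'] st unfolding c'_def shadow_def by simp
          then show ?thesis by (rule goal[OF r'(1) c'X 1 gd])
        next
          case False
          then have "s' = s + ?T" unfolding s'_def by auto
          moreover have "{N<..N + Suc K} = insert (Suc N) {Suc N<..Suc N + K}" by auto
          then have "(\<Sum>m\<in>{N<..N + Suc K}. \<tau> m) = ?T + (\<Sum>m\<in>{Suc N<..Suc N + K}. \<tau> m)" by simp
          ultimately have "len x - s' < (\<Sum>m\<in>{Suc N<..Suc N + K}. \<tau> m)" using Suc.prems(8) by linarith
          moreover have "s' \<le> shadow_time x r'" unfolding s'_def by simp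
          ultimately show ?thesis
            using Suc.IH[OF r'(1) c'X 1 gd _ s'le(2)] unfolding c'_def by simp
        qed
        then show ?thesis using c'X move by blast
      next
        case False
        define c' where "c' = (\<lambda>i. if i = l then gam x (shadow_time x r') else if i \<in> J then shadow (g i) r' else c i)"
        have eq: "s' = shadow_time x r'" "s' < s" using False T unfolding s'_def by auto
        have sl: "s \<le> len x" using Suc.prems(7) shadow_time_bounds[OF x, of r] by simp
        have s'le: "s' \<le> len x" "0 \<le> s'" using st eq by auto
        have cl: "c' l = shadow x r'" unfolding c'_def shadow_def by simp
        have c'X: "\<forall>i<k. c' i \<in> X" unfolding c'_def using shadow_in[OF x] shadow_in J(2) Suc.prems(2) 
          unfolding shadow_def by auto
        have move: "\<forall>i<k. dist (c i) (c' i) \<le> ?T"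
        proof (intro allI impI)
          fix i assume "i < k"
          consider "i = l" | "i \<noteq> l" "i \<in> J" | "i \<noteq> l" "i \<notin> J" by blast
          then show "dist (c i) (c' i) \<le> ?T"
          proof cases
            case 1
            have "dist (gam x s') (gam x s) \<le> s - s'" by (rule gam_lip[OF x]) (use eq s'le sl in auto)
            then show ?thesis using 1 ss eq Suc.prems(5) \<Gamma>(3)[of s] sl s'le unfolding c'_def by (simp add: dist_commute)
          next
            case 2
            then show ?thesis using Suc.prems(4) shadow_lip[OF J(2), of i r r'] r'(2) unfolding c'_def guards_def by force
          qed (use T in \<open>auto simp: c'_def\<close>)
        qed
        have gd: "guards c' J g r'" using l(2) unfolding guards_def c'_def by auto
        show ?thesis using goal[OF r'(1) c'X 1 gd cl] c'X move by blast
      qed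
    qed
  qed
qed

end


lemma agility_sum_exceeds:
  assumes "\<tau> \<in> agility_functions"
  obtains K where "D < (\<Sum>m\<in>{N<..N+K}. \<tau> m)"
proof -
  have nn: "0 \<le> \<tau> m" if "m \<ge> 1" for m using assms that unfolding agility_functions_def by auto
  have "filterlim (\<lambda>M. \<Sum>m=1..M. \<tau> m) at_top sequentially"
    using assms unfolding agility_functions_def by auto
  then have "eventually (\<lambda>M. D + (\<Sum>m=1..N. \<tau> m) < (\<Sum>m=1..M. \<tau> m)) sequentially"
    by (simp add: filterlim_at_top_dense)
  then obtain M where M: "D + (\<Sum>m=1..N. \<tau> m) < (\<Sum>m=1..M. \<tau> m)" 
    unfolding eventually_sequentially by blast
  have "(\<Sum>m=1..M. \<tau> m) \<le> (\<Sum>m=1..N+M. \<tau> m)"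
    using nn by (intro sum_mono2) auto
  also have "{1..N+M} = {1..N} \<union> {N<..N+M}" by auto
  also have "(\<Sum>m\<in>{1..N} \<union> {N<..N+M}. \<tau> m) = (\<Sum>m=1..N. \<tau> m) + (\<Sum>m\<in>{N<..N+M}. \<tau> m)"
    by (intro sum.union_disjoint) auto
  finally have "D < (\<Sum>m\<in>{N<..N+M}. \<tau> m)" using M by linarith
  then show thesis by (rule that)
qed

context guarded_cells
begin

text \<open>The path \<open>\<Gamma>\<close> starts at the present position of the cop.\<close>

lemma guard_one_more:
  assumes J: "J \<subseteq> {..<k}" "\<And>i. i \<in> J \<Longrightarrow> g i \<in> lat_square n" and l: "l < k" "l \<notin> J" and x: "x \<in> lat_square n"
    and \<tau>: "\<tau> \<in> agility_functions"
    and goal: "\<And>N r c. r \<in> X \<Longrightarrow> \<forall>i<k. c i \<in> X \<Longrightarrow> confined J g w r \<Longrightarrow> guards c J g r \<Longrightarrow> c l = shadow x r \<Longrightarrow>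
      cops_reach X k \<tau> e N r c"
    and r: "r \<in> X" "\<forall>i<k. c i \<in> X" "confined J g w r" "guards c J g r"
  shows "cops_reach X k \<tau> e N r c"
proof -
  have cl: "c l \<in> X" using r(2) l(1) by blast
  obtain \<alpha> where \<alpha>: "geodesic_arc X \<alpha> (c l) z0" using geodesic_arc_exists[OF geo cl z0] by blast
  define a where "a = dist (c l) z0"
  have a: "0 \<le> a" unfolding a_def by simp
  define \<Gamma> where "\<Gamma> = (\<lambda>t. if t \<le> 0 then \<alpha> (t + a) else gam x t)"
  have \<alpha>': "\<alpha> (t + a) \<in> X" "dist (\<alpha> (t + a)) z0 = - t" if "- a \<le> t" "t \<le> 0" for t
    using geodesic_arc_dist[OF \<alpha>, of "t + a"] that unfolding a_def by auto
  obtain K where K: "len x - (- a) < (\<Sum>m\<in>{N<..N+K}. \<tau> m)" using agility_sum_exceeds[OF \<tau>] by blast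
  have \<tau>0: "0 \<le> \<tau> m" if "m \<ge> 1" for m using \<tau> that unfolding agility_functions_def by auto
  show ?thesis
  proof (rule advance[OF J l x, where \<Gamma> = \<Gamma> and a = a and s = "- a" and K = K])
    show "\<Gamma> t \<in> X" if "- a \<le> t" "t \<le> len x" for t
      using that \<alpha>' gam_in[OF x] unfolding \<Gamma>_def by auto
    show "\<Gamma> t = gam x t" if "0 \<le> t" "t \<le> len x" for t
      using that \<alpha>'(2)[of 0] a gam_0[OF x] unfolding \<Gamma>_def by auto
    show "dist (\<Gamma> s) (\<Gamma> t) \<le> t - s" if st: "- a \<le> s" "s \<le> t" "t \<le> len x" for s t
    proof -
      consider "t \<le> 0" | "s \<le> 0" "0 < t" | "0 < s" "0 < t" using st by linarith
      then show ?thesis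
      proof cases
        case 1
        have "s + a \<in> {0..a}" "t + a \<in> {0..a}" using 1 st by auto
        then have "dist (\<alpha> (s + a)) (\<alpha> (t + a)) = \<bar>(s + a) - (t + a)\<bar>" 
          using \<alpha> unfolding geodesic_arc_def a_def[symmetric] by blast
        then show ?thesis using 1 st unfolding \<Gamma>_def by simp
      next
        case 2
        have "dist (\<alpha> (s + a)) (gam x t) \<le> dist (\<alpha> (s + a)) z0 + dist z0 (gam x t)" by (rule dist_triangle)
        also have "\<dots> \<le> - s + t" 
          using \<alpha>'(2)[of s] gam_lip[OF x, of 0 t] gam_0[OF x] 2 st by simp
        finally show ?thesis using 2 unfolding \<Gamma>_def by simp
      next
        case 3
        then show ?thesis using gam_lip[OF x, of s t] st unfolding \<Gamma>_def by simp
      qed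
    qed
    show "c l = \<Gamma> (- a)" using \<alpha> a unfolding \<Gamma>_def geodesic_arc_def by simp
    show "- a \<le> shadow_time x r" using shadow_time_bounds[OF x, of r] a by linarith
  qed (use goal \<tau>0 r K in auto)
qed

definition catchable :: "(nat \<Rightarrow> real) \<Rightarrow> int \<times> int \<Rightarrow> int \<times> int \<Rightarrow> int \<times> int \<Rightarrow> bool" where
  "catchable \<tau> u v w \<longleftrightarrow> (\<forall>N r c i j. i < 3 \<longrightarrow> j < 3 \<longrightarrow> i \<noteq> j \<longrightarrow> r \<in> X \<longrightarrow> r \<in> cell w \<longrightarrow>
     (\<forall>m<3. c m \<in> X) \<longrightarrow> c i = shadow u r \<longrightarrow> c j = shadow v r \<longrightarrow> cops_reach X 3 \<tau> e N r c)"

lemma near_reach: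
  assumes "u \<in> lat_square n" "w \<in> set (pth u) \<union> lat_ring n" "r \<in> cell w" "i < k" "c i = shadow u r"
  shows "cops_reach X k \<tau> e N r c"
  using cops_reach.near[of i k r c e] shadow_near[OF assms(1-3)] assms(4,5) by (simp add: dist_commute)

text \<open>The cop that guards neither \<open>u\<close> nor \<open>v\<close> goes to guard \<open>x\<close>.
  Then one of the other two is released.\<close>

lemma catchable_step:
  assumes \<tau>: "\<tau> \<in> agility_functions" and uvx: "u \<in> lat_square n" "v \<in> lat_square n" "x \<in> lat_square n"
    and w: "w \<in> lat_inner n"
    and step: "\<And>w'. free_reach n (set (pth u) \<union> set (pth v)) w w' \<Longrightarrow> w' \<in> lat_inner n \<Longrightarrow>
          w' \<notin> set (pth u) \<union> set (pth v) \<union> set (pth x) \<Longrightarrow> catchable \<tau> u x w' \<or> catchable \<tau> v x w'"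
  shows "catchable \<tau> u v w"
  unfolding catchable_def
proof (intro allI impI)
  fix N r c and i j :: nat
  assume ij: "i < 3" "j < 3" "i \<noteq> j" and r: "r \<in> X" "r \<in> cell w" "\<forall>m<3. c m \<in> X" "c i = shadow u r" "c j = shadow v r"
  obtain l where l: "l < 3" "l \<noteq> i" "l \<noteq> j"
    using ij that[of 0] that[of 1] that[of 2] by fastforce
  define g where "g = (\<lambda>m::nat. if m = i then u else v)"
  have gB: "(\<Union>m\<in>{i,j}. set (pth (g m))) = set (pth u) \<union> set (pth v)" using ij(3) unfolding g_def by auto
  show "cops_reach X 3 \<tau> e N r c"
  proof (rule guard_one_more[where J = "{i,j}" and g = g and l = l and x = x and w = w])
    show "confined {i,j} g w r" unfolding confined_def gB using w r by (intro disjI2 exI[of _ w]) (simp add: free_reach_def)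
    show "guards c {i,j} g r" using r ij(3) unfolding guards_def g_def by auto
    fix N r c assume h: "r \<in> X" "\<forall>i<3. c i \<in> X" "confined {i,j} g w r" "guards c {i,j} g r" "c l = shadow x r"
    obtain w' where w': "free_reach n (set (pth u) \<union> set (pth v)) w w'" "w' \<in> lat_inner n" "r \<in> cell w'"
      using h(3) unfolding confined_def gB by blast
    have g: "c i = shadow u r" "c j = shadow v r" using h(4) ij(3) unfolding guards_def g_def by auto
    show "cops_reach X 3 \<tau> e N r c"
    proof (cases "w' \<in> set (pth u) \<union> set (pth v) \<union> set (pth x)")
      case True
      then show ?thesis using near_reach[OF _ _ w'(3)] uvx g h(5) ij l by blast
    next
      case False
      from step[OF w'(1,2) this] show ?thesis
      proof
        assume "catchable \<tau> u x w'"
        then show ?thesis unfolding catchable_def using ij l h w'(3) g by blast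
      next
        assume "catchable \<tau> v x w'"
        then show ?thesis unfolding catchable_def using ij l h w'(3) g by blast
      qed
    qed
  qed (use ij l uvx \<tau> r in \<open>auto simp: g_def\<close>)
qed

lemma three_cops_reach:
  assumes \<tau>: "\<tau> \<in> agility_functions" and r: "r \<in> X" "\<forall>i<3. c i \<in> X"
  shows "cops_reach X 3 \<tau> e N r c"
proof -
  let ?u = "(-n,-n)" and ?v = "(-n,-n+1)"
  have catch: "catchable \<tau> ?u ?v w" if "w \<in> lat_inner n" for w
    by (rule lattice_search[OF n tree _ that]) (rule catchable_step[OF \<tau>])
  have D: "?u \<in> lat_square n" "?v \<in> lat_square n" using n by (auto simp: lat_square_def)
  have uring: "?u \<in> lat_ring n" using n by (auto simp: lat_ring_def lat_square_def lat_inner_def)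
  show ?thesis
  proof (rule guard_one_more[where J = "{}" and g = "\<lambda>_. ?u" and l = 0 and x = ?u and w = ?u])
    fix N r and c :: "nat \<Rightarrow> 'a" assume h: "r \<in> X" "\<forall>i<3. c i \<in> X" "c 0 = shadow ?u r"
    obtain w where w: "w \<in> lat_square n" "r \<in> cell w" using cell_cover h(1) by blast
    show "cops_reach X 3 \<tau> e N r c"
    proof (cases "w \<in> lat_ring n")
      case True
      then show ?thesis using near_reach[OF D(1) _ w(2), of 0] h(3) by simp
    next
      case False
      then have wi: "w \<in> lat_inner n" using w lat_square_split by blast
      show ?thesis
      proof (rule guard_one_more[where J = "{0}" and g = "\<lambda>_. ?u" and l = 1 and x = ?v and w = w])
        show "confined {0} (\<lambda>_. ?u) w r" unfolding confined_def using wi w(2) by (intro disjI2 exI[of _ w]) (simp add: free_reach_def)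
        show "guards c {0} (\<lambda>_. ?u) r" using h unfolding guards_def by simp
        fix N r and c :: "nat \<Rightarrow> 'a" assume h: "r \<in> X" "\<forall>i<3. c i \<in> X" "confined {0} (\<lambda>_. ?u) w r" "guards c {0} (\<lambda>_. ?u) r" "c 1 = shadow ?v r"
        obtain w' where w': "w' \<in> lat_inner n" "r \<in> cell w'" using h(3) unfolding confined_def by blast
        show "cops_reach X 3 \<tau> e N r c"
          using catch[OF w'(1), unfolded catchable_def, rule_format, of 0 1 r c N] h w'(2) unfolding guards_def by simp
      qed (use D \<tau> h in auto)
    qed
  qed (use D \<tau> r in \<open>auto simp: confined_def guards_def\<close>)
qed

end


section \<open>A spanning tree of almost geodesic branches\<close>

lemma lat_tree_insert:
  assumes "lat_tree n D pth" "v \<in> lat_inner n" "v \<notin> D" "p \<in> D" "lat_adj v p"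
  shows "lat_tree n (insert v D) (pth(v := v # pth p))"
  unfolding lat_tree_def
proof
  fix w assume w: "w \<in> insert v D"
  show "w \<in> lat_ring n \<and> (pth(v := v # pth p)) w = [w] \<or>
    w \<in> lat_inner n \<and> (\<exists>q\<in>insert v D. lat_adj w q \<and> (pth(v := v # pth p)) w = w # (pth(v := v # pth p)) q)"
  proof (cases "w = v")
    case True
    then show ?thesis using assms by auto
  next
    case False
    then have "w \<in> D" using w by simp
    then consider "w \<in> lat_ring n" "pth w = [w]" | q where "w \<in> lat_inner n" "q \<in> D" "lat_adj w q" "pth w = w # pth q"
      using assms(1) unfolding lat_tree_def by blast
    then show ?thesis
    proof cases
      case (2 q)
      then have "q \<noteq> v" using assms(3) by auto
      then show ?thesis using 2 False by auto
    qed (use False in simp)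
  qed
qed

text \<open>The time at which a path leaves \<open>U\<close> for the first time. The path may touch
  \<open>U'\<close> earlier without leaving \<open>U\<close>, so this need not be the first time in both
  sets; it is an upper bound of all times up to which the path stays in \<open>U\<close>.\<close>

lemma last_covered_time:
  fixes P :: "real \<Rightarrow> 'a::topological_space"
  assumes P: "continuous_on {0..l} P" and cl: "closed U" "closed U'" and cov: "P ` {0..l} \<subseteq> U \<union> U'"
    and 0: "P 0 \<in> U" and t: "t \<in> {0..l}" "P t \<notin> U"
  obtains t1 where "t1 \<in> {0..l}" "P t1 \<in> U" "P t1 \<in> U'" "\<And>s. 0 \<le> s \<Longrightarrow> s \<le> t1 \<Longrightarrow> P s \<in> U"
    "\<And>u. u \<le> l \<Longrightarrow> (\<forall>s\<in>{0..u}. P s \<in> U) \<Longrightarrow> u \<le> t1"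
proof -
  define A where "A = {t \<in> {0..l}. P t \<notin> U}"
  have A: "A \<noteq> {}" "bdd_below A" using t unfolding A_def by (auto intro: bdd_belowI[of _ 0])
  define t1 where "t1 = Inf A"
  have le: "t1 \<le> t" if "t \<in> A" for t unfolding t1_def using A that by (simp add: cInf_lower)
  have ge: "u \<le> t1" if "\<And>t. t \<in> A \<Longrightarrow> u \<le> t" for u unfolding t1_def using A that by (intro cInf_greatest)
  have t1: "0 \<le> t1" "t1 \<le> l" using ge[of 0] le A unfolding A_def by fastforce+
  have clo: "closed ({0..l} \<inter> P -` C)" if "closed C" for C
    using continuous_closed_preimage[OF P _ that] by simp
  have "A \<subseteq> {0..l} \<inter> P -` U'" using cov unfolding A_def by (auto simp: image_subset_iff)
  then have "closure A \<subseteq> {0..l} \<inter> P -` U'" using clo[OF cl(2)] by (rule closure_minimal)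
  moreover have "t1 \<in> closure A" unfolding t1_def using A by (rule closure_contains_Inf)
  ultimately have U': "P t1 \<in> U'" by blast
  have before: "P s \<in> U" if "0 \<le> s" "s < t1" for s
    using le[of s] that t1 unfolding A_def by force
  have U: "P t1 \<in> U"
  proof (cases "t1 = 0")
    case False
    then have "t1 \<in> closure {0..<t1}" using t1 by (simp add: closure_atLeastLessThan)
    moreover have "{0..<t1} \<subseteq> {0..l} \<inter> P -` U" using before t1 by auto
    then have "closure {0..<t1} \<subseteq> {0..l} \<inter> P -` U" using clo[OF cl(1)] by (rule closure_minimal)
    ultimately show ?thesis by blast
  qed (use 0 in simp)
  show thesis
  proof (rule that[of t1])
    show "P s \<in> U" if "0 \<le> s" "s \<le> t1" for s using before[OF that(1)] U that by (cases "s = t1") auto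
    fix u assume u: "u \<le> l" "\<forall>s\<in>{0..u}. P s \<in> U"
    show "u \<le> t1"
    proof (rule ge)
      fix t assume "t \<in> A"
      then show "u \<le> t" using u unfolding A_def by force
    qed
  qed (use t1 U U' in auto)
qed

text \<open>The cells of the boundary are one and the same set \<open>outer\<close>, a neighbourhood of
  \<open>z0\<close>. The scale of the other cells is \<open>\<delta>\<close>, and \<open>\<rho>\<close> is
  the scale of the errors.\<close>

locale lattice_cells =
  fixes X :: "'a::metric_space set" and z0 :: 'a and n :: int and cell :: "int \<times> int \<Rightarrow> 'a set"
    and outer :: "'a set" and \<rho> \<delta> :: real
  assumes geo: "geodesic_space X" and z0: "z0 \<in> X" and n: "n \<ge> 1"
    and cell_sub: "v \<in> lat_square n \<Longrightarrow> cell v \<subseteq> X"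
    and cell_closed: "v \<in> lat_square n \<Longrightarrow> closed (cell v)"
    and cell_cover: "X \<subseteq> (\<Union>v\<in>lat_square n. cell v)"
    and cell_adj: "v \<in> lat_inner n \<Longrightarrow> w \<in> lat_inner n \<Longrightarrow> v \<noteq> w \<Longrightarrow> cell v \<inter> cell w \<noteq> {} \<Longrightarrow> lat_adj v w"
    and ring_cell: "v \<in> lat_ring n \<Longrightarrow> cell v = outer"
    and outer: "z0 \<in> outer" "x \<in> outer \<Longrightarrow> dist z0 x \<le> \<rho>"
    and inner_outer: "v \<in> lat_inner n \<Longrightarrow> cell v \<inter> outer \<noteq> {} \<Longrightarrow> \<exists>p\<in>lat_ring n. lat_adj v p"
    and small: "v \<in> lat_inner n \<Longrightarrow> x \<in> cell v \<Longrightarrow> y \<in> cell v \<Longrightarrow> dist x y \<le> \<delta>"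
    and \<delta>: "0 \<le> \<delta>" "\<delta> \<le> \<rho>"
begin

text \<open>The path \<open>\<gamma>\<close> from \<open>z0\<close> to \<open>y\<close> exceeds the distance of
  its ends by at most \<open>\<eta>\<close>, and it passes within \<open>\<kappa>\<close> of each point of
  the cells in \<open>R\<close>.\<close>

definition almost_geodesic :: "(int \<times> int) set \<Rightarrow> 'a \<Rightarrow> real \<Rightarrow> real \<Rightarrow> (real \<Rightarrow> 'a) \<Rightarrow> real \<Rightarrow> bool" where
  "almost_geodesic R y \<eta> \<kappa> \<gamma> L \<longleftrightarrow> 0 \<le> L \<and> \<gamma> 0 = z0 \<and> \<gamma> L = y \<and> (\<forall>t\<in>{0..L}. \<gamma> t \<in> X) \<and>
     (\<forall>s t. 0 \<le> s \<longrightarrow> s \<le> t \<longrightarrow> t \<le> L \<longrightarrow> dist (\<gamma> s) (\<gamma> t) \<le> t - s) \<and> L \<le> dist z0 y + \<eta> \<and>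
     (\<forall>w\<in>R. \<forall>x\<in>cell w. \<exists>t\<in>{0..L}. dist x (\<gamma> t) \<le> \<kappa>)"

definition guardable :: "(int \<times> int) set \<Rightarrow> 'a \<Rightarrow> real \<Rightarrow> real \<Rightarrow> bool" where
  "guardable R y \<eta> \<kappa> \<longleftrightarrow> (\<exists>\<gamma> L. almost_geodesic R y \<eta> \<kappa> \<gamma> L)"

text \<open>Every initial part of \<open>\<gamma>\<close> is shortest up to the same error
  \<open>\<eta>\<close>. Hence the time at which \<open>\<gamma>\<close> passes near \<open>x\<close>
  differs from \<open>dist z0 x\<close> by at most \<open>\<eta> + \<kappa>\<close>.\<close>

lemma almost_geodesic_near:
  assumes "almost_geodesic R y \<eta> \<kappa> \<gamma> L" "w \<in> R" "x \<in> cell w"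
  shows "dist (\<gamma> (min (dist z0 x) L)) x \<le> \<eta> + 2 * \<kappa>"
proof -
  have g: "0 \<le> L" "\<gamma> 0 = z0" "\<gamma> L = y" "L \<le> dist z0 y + \<eta>"
    "\<And>s t. 0 \<le> s \<Longrightarrow> s \<le> t \<Longrightarrow> t \<le> L \<Longrightarrow> dist (\<gamma> s) (\<gamma> t) \<le> t - s"
    using assms(1) unfolding almost_geodesic_def by auto
  obtain t where t: "0 \<le> t" "t \<le> L" "dist x (\<gamma> t) \<le> \<kappa>" using assms unfolding almost_geodesic_def by fastforce
  have \<kappa>: "0 \<le> \<kappa>" using t(3) zero_le_dist order_trans by blast
  have \<eta>: "0 \<le> \<eta>" using g(4) g(5)[of 0 L] g(1-3) by simp
  have lo: "t - \<eta> \<le> dist z0 (\<gamma> t)"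
    using g(5)[OF t(1,2)] g(5)[of t L] t g(3,4) dist_triangle[of z0 y "\<gamma> t"] by simp
  have hi: "dist z0 (\<gamma> t) \<le> t" using g(5)[of 0 t] t g(2) by simp
  define m where "m = min (dist z0 x) L"
  have m: "t - \<eta> - \<kappa> \<le> m" "m \<le> t + \<kappa>" "0 \<le> m" "m \<le> L"
    unfolding m_def using lo hi t \<kappa> \<eta> dist_triangle[of z0 "\<gamma> t" x] dist_triangle[of z0 x "\<gamma> t"] by (auto simp: min_def dist_commute)
  have "dist (\<gamma> m) (\<gamma> t) \<le> \<eta> + \<kappa>"
  proof (cases "m \<le> t")
    case True
    then show ?thesis using g(5)[of m t] m t by simp
  next
    case False
    then have "dist (\<gamma> t) (\<gamma> m) \<le> m - t" using m t by (intro g(5)) auto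
    then show ?thesis using m \<eta> by (simp add: dist_commute)
  qed
  then show ?thesis unfolding m_def[symmetric] using dist_triangle[of "\<gamma> m" x "\<gamma> t"] t(3) by (simp add: dist_commute)
qed

lemma guardable_mono:
  assumes "guardable R y \<eta> \<kappa>" "\<eta> \<le> \<eta>'" "\<kappa> \<le> \<kappa>'"
  shows "guardable R y \<eta>' \<kappa>'"
proof -
  obtain \<gamma> L where g: "almost_geodesic R y \<eta> \<kappa> \<gamma> L" using assms(1) unfolding guardable_def by blast
  have "L \<le> dist z0 y + \<eta>'" using g assms(2) unfolding almost_geodesic_def by linarith
  moreover have "\<forall>w\<in>R. \<forall>x\<in>cell w. \<exists>t\<in>{0..L}. dist x (\<gamma> t) \<le> \<kappa>'"
    using g assms(3) order_trans unfolding almost_geodesic_def by meson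
  ultimately have "almost_geodesic R y \<eta>' \<kappa>' \<gamma> L" using g unfolding almost_geodesic_def by blast
  then show ?thesis unfolding guardable_def by blast
qed

lemma guardable_in: "guardable R y \<eta> \<kappa> \<Longrightarrow> y \<in> X"
  unfolding guardable_def almost_geodesic_def by auto

lemma guardable_ring: "guardable (lat_ring n) z0 0 \<rho>"
  unfolding guardable_def almost_geodesic_def
  using z0 ring_cell outer by (intro exI[of _ "\<lambda>_. z0"] exI[of _ 0]) (auto simp: dist_commute)

lemma guardable_same:
  assumes "guardable R y \<eta> \<kappa>" "\<And>x. x \<in> cell v \<Longrightarrow> dist x y \<le> \<kappa>'" "\<kappa> \<le> \<kappa>'"
  shows "guardable (insert v R) y \<eta> \<kappa>'"
proof -
  have "guardable R y \<eta> \<kappa>'" using guardable_mono[OF assms(1) order_refl assms(3)] .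
  then obtain \<gamma> L where g: "almost_geodesic R y \<eta> \<kappa>' \<gamma> L" unfolding guardable_def by blast
  have "\<gamma> L = y" "L \<in> {0..L}" using g unfolding almost_geodesic_def by auto
  then have "\<forall>x\<in>cell v. \<exists>t\<in>{0..L}. dist x (\<gamma> t) \<le> \<kappa>'" using assms(2) by blast
  then have "almost_geodesic (insert v R) y \<eta> \<kappa>' \<gamma> L" using g unfolding almost_geodesic_def by blast
  then show ?thesis unfolding guardable_def by blast
qed

text \<open>The excess over the distance grows only by as much as the detour via \<open>y\<close> costs.\<close>

lemma guardable_extend:
  assumes "guardable R y \<eta> \<kappa>" and z: "z \<in> X" "dist z0 y + dist y z + \<eta> \<le> dist z0 z + \<eta>'"
  shows "guardable R z \<eta>' \<kappa>"
proof -
  obtain \<gamma> L where g: "almost_geodesic R y \<eta> \<kappa> \<gamma> L" using assms(1) unfolding guardable_def by blast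
  have g: "0 \<le> L" "\<gamma> 0 = z0" "\<gamma> L = y" "L \<le> dist z0 y + \<eta>" "\<And>t. 0 \<le> t \<Longrightarrow> t \<le> L \<Longrightarrow> \<gamma> t \<in> X"
    "\<And>s t. 0 \<le> s \<Longrightarrow> s \<le> t \<Longrightarrow> t \<le> L \<Longrightarrow> dist (\<gamma> s) (\<gamma> t) \<le> t - s"
    "\<And>w x. w \<in> R \<Longrightarrow> x \<in> cell w \<Longrightarrow> \<exists>t\<in>{0..L}. dist x (\<gamma> t) \<le> \<kappa>"
    using g unfolding almost_geodesic_def by auto
  have y: "y \<in> X" using guardable_in assms(1) by blast
  obtain \<alpha> where \<alpha>: "geodesic_arc X \<alpha> y z" using geodesic_arc_exists[OF geo y z(1)] by blast
  let ?L = "L + dist y z"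
  define \<beta> where "\<beta> = (\<lambda>t. if t \<le> L then \<gamma> t else \<alpha> (t - L))"
  have \<alpha>0: "\<alpha> 0 = y" "\<alpha> (dist y z) = z" using \<alpha> unfolding geodesic_arc_def by auto
  have "almost_geodesic R z \<eta>' \<kappa> \<beta> ?L"
    unfolding almost_geodesic_def
  proof (intro conjI ballI allI impI)
    show "0 \<le> ?L" using g(1) by simp
    show "\<beta> 0 = z0" using g unfolding \<beta>_def by simp
    show "\<beta> ?L = z" using \<alpha>0 g(3) unfolding \<beta>_def by (cases "dist y z = 0") auto
    show "?L \<le> dist z0 z + \<eta>'" using g(4) z(2) by simp
    show "\<beta> t \<in> X" if "t \<in> {0..?L}" for t
      using that g(5) geodesic_arc_dist(1)[OF \<alpha>, of "t - L"] unfolding \<beta>_def by auto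
    show "\<exists>t\<in>{0..?L}. dist x (\<beta> t) \<le> \<kappa>" if wx: "w \<in> R" "x \<in> cell w" for w x
    proof -
      obtain t where "t \<in> {0..L}" "dist x (\<gamma> t) \<le> \<kappa>" using g(7)[OF wx] by blast
      then show ?thesis by (intro bexI[of _ t]) (auto simp: \<beta>_def add_increasing2)
    qed
    fix s t assume st: "0 \<le> s" "s \<le> t" "t \<le> ?L"
    consider "t \<le> L" | "s \<le> L" "L < t" | "L < s" "L < t" using st by linarith
    then show "dist (\<beta> s) (\<beta> t) \<le> t - s"
    proof cases
      case 1
      then show ?thesis using g(6) st unfolding \<beta>_def by simp
    next
      case 2
      have "dist (\<gamma> s) (\<alpha> (t - L)) \<le> dist (\<gamma> s) y + dist y (\<alpha> (t - L))" by (rule dist_triangle)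
      also have "\<dots> \<le> (L - s) + (t - L)"
        using g(6)[of s L] g(3) st 2 geodesic_arc_dist(2)[OF \<alpha>, of "t - L"] by simp
      finally show ?thesis using 2 unfolding \<beta>_def by simp
    next
      case 3
      then have "s - L \<in> {0..dist y z}" "t - L \<in> {0..dist y z}" using st by auto
      then have "dist (\<alpha> (s - L)) (\<alpha> (t - L)) = \<bar>(s - L) - (t - L)\<bar>" using \<alpha> unfolding geodesic_arc_def by blast
      then show ?thesis using 3 st unfolding \<beta>_def by simp
    qed
  qed
  then show ?thesis unfolding guardable_def by blast
qed

definition rooted_tree :: "(int \<times> int) set \<Rightarrow> (int \<times> int \<Rightarrow> (int \<times> int) list) \<Rightarrow> bool" where
  "rooted_tree D pth \<longleftrightarrow> lat_tree n D pth \<and> lat_ring n \<subseteq> D \<and> D \<subseteq> lat_square n"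

lemma rooted_tree_insert:
  assumes "rooted_tree D pth" "v \<in> lat_inner n" "v \<notin> D" "p \<in> D" "lat_adj v p"
  shows "rooted_tree (insert v D) (pth(v := v # pth p))"
  using assms lat_tree_insert[of n D pth v p] lat_square_split(1)[of n] unfolding rooted_tree_def by blast

text \<open>All paths start at \<open>z0\<close>, so the boundary is guarded together with any branch.\<close>

definition branch :: "(int \<times> int \<Rightarrow> (int \<times> int) list) \<Rightarrow> int \<times> int \<Rightarrow> (int \<times> int) set" where
  "branch pth v = set (pth v) \<union> lat_ring n"


text \<open>All cells of the boundary are equal, so \<open>p\<close> can be replaced by a vertex of the boundary
  that is adjacent to \<open>v\<close>.\<close>

lemma attachable:
  assumes D: "lat_ring n \<subseteq> D" "D \<subseteq> lat_square n" and v: "v \<in> lat_square n - D" and p: "p \<in> D" and z: "z \<in> cell v" "z \<in> cell p"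
  obtains p' where "v \<in> lat_inner n" "p' \<in> D" "lat_adj v p'" "z \<in> cell p'"
proof -
  have vi: "v \<in> lat_inner n" using v D lat_square_split by blast
  consider "p \<in> lat_inner n" | "p \<in> lat_ring n" using p D lat_square_split by blast
  then show thesis
  proof cases
    case 1
    then have "lat_adj v p" using cell_adj[OF vi 1] z v p by blast
    then show ?thesis using that vi p z 1 by blast
  next
    case 2
    then have "z \<in> outer" using ring_cell z by blast
    then obtain p' where "p' \<in> lat_ring n" "lat_adj v p'" using inner_outer[OF vi] z by blast
    then show ?thesis using that[of p'] vi D ring_cell \<open>z \<in> outer\<close> 2 by blast
  qed
qed

text \<open>Trees are grown one vertex at a time, subject to an invariant \<open>I\<close>, until no vertex can
  be added.\<close>

lemma maximal_tree:
  assumes "I D pth" "\<And>D pth. I D pth \<Longrightarrow> D \<subseteq> lat_square n"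
  obtains D' pth' where "I D' pth'" "\<And>v p'. v \<notin> D' \<Longrightarrow> \<not> I (insert v D') p'"
proof -
  let ?S = "{D. \<exists>pth. I D pth}"
  have "?S \<subseteq> Pow (lat_square n)" using assms(2) by blast
  then have fin: "finite ?S" by (rule finite_subset) (simp add: lat_square_def)
  obtain D' where D': "D' \<in> ?S" "\<And>b. b \<in> ?S \<Longrightarrow> D' \<subseteq> b \<Longrightarrow> D' = b"
    using finite_has_maximal[OF fin] assms(1) by blast
  then show thesis using that by blast
qed

text \<open>The path that guards the branch of \<open>v\<close> ends in the cell of \<open>v\<close>, or at
  \<open>z0\<close>, so that it can be prolonged to the cells next to \<open>v\<close>.\<close>

definition geodesic_stage :: "(int \<times> int) set \<Rightarrow> (int \<times> int \<Rightarrow> (int \<times> int) list) \<Rightarrow> real \<Rightarrow> bool" where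
  "geodesic_stage D pth \<eta> \<longleftrightarrow> rooted_tree D pth \<and> (\<forall>v\<in>D. \<exists>y. guardable (branch pth v) y \<eta> \<rho> \<and>
     (v \<in> lat_ring n \<and> y = z0 \<or> v \<in> lat_inner n \<and> y \<in> cell v))"

lemma closed_cells: "C \<subseteq> lat_square n \<Longrightarrow> closed (\<Union>v\<in>C. cell v)"
  by (rule closed_UN, rule finite_subset[of _ "lat_square n"]) (use cell_closed in \<open>auto simp: lat_square_def\<close>)

text \<open>The vertices of the cells along a geodesic \<open>P\<close> from \<open>z0\<close> to
  \<open>f\<close> can be added in the order in which \<open>P\<close> enters their cells. A new vertex
  \<open>v\<close>, entered at time \<open>t1\<close>, is attached to a vertex \<open>p'\<close> of the
  tree whose cell contains \<open>P t1\<close>. If \<open>p'\<close> is new as well, its path ends at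
  \<open>P t\<close> with \<open>t \<le> t1\<close> and follows \<open>P\<close> to \<open>P t1\<close> at
  no cost. Otherwise its path ends somewhere in the cell of \<open>p'\<close>, and changing to
  \<open>P\<close> costs at most \<open>2 * \<delta>\<close>. This happens at most once per branch and
  round, however many cells \<open>P\<close> meets.\<close>

lemma geodesic_round:
  assumes st: "geodesic_stage D pth \<eta>" and f: "f \<in> X"
  obtains D' pth' where "geodesic_stage D' pth' (\<eta> + 2 * \<delta>)" "D \<subseteq> D'" "\<exists>p\<in>D'. f \<in> cell p"
proof -
  obtain P where P: "geodesic_arc X P z0 f" using geodesic_arc_exists[OF geo z0 f] by blast
  let ?l = "dist z0 f"
  define I where "I = (\<lambda>D' pth'. rooted_tree D' pth' \<and> D \<subseteq> D' \<and> (\<forall>v\<in>D. pth' v = pth v) \<and>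
     (\<forall>v\<in>D' - D. v \<in> lat_inner n \<and> (\<exists>t\<in>{0..?l}. P t \<in> cell v \<and> (\<forall>s\<in>{0..t}. P s \<in> (\<Union>p\<in>D'. cell p)) \<and>
        guardable (branch pth' v) (P t) (\<eta> + 2 * \<delta>) \<rho>)))"
  have "I D pth" using st unfolding I_def geodesic_stage_def by blast
  moreover have "\<And>D' pth'. I D' pth' \<Longrightarrow> D' \<subseteq> lat_square n" unfolding I_def rooted_tree_def by blast
  ultimately obtain D' pth' where I: "I D' pth'" and max: "\<And>v p'. v \<notin> D' \<Longrightarrow> \<not> I (insert v D') p'"
    using maximal_tree[of I D pth] by metis
  have tree: "rooted_tree D' pth'" "D \<subseteq> D'" "\<forall>v\<in>D. pth' v = pth v"
    and new: "\<And>v. v \<in> D' - D \<Longrightarrow> v \<in> lat_inner n \<and> (\<exists>t\<in>{0..?l}. P t \<in> cell v \<and> (\<forall>s\<in>{0..t}. P s \<in> (\<Union>p\<in>D'. cell p)) \<and>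
        guardable (branch pth' v) (P t) (\<eta> + 2 * \<delta>) \<rho>)"
    using I unfolding I_def by blast+
  have D': "lat_ring n \<subseteq> D'" "D' \<subseteq> lat_square n" using tree unfolding rooted_tree_def by auto
  have old: "\<exists>y. guardable (branch pth' v) y \<eta> \<rho> \<and> (v \<in> lat_ring n \<and> y = z0 \<or> v \<in> lat_inner n \<and> y \<in> cell v)" if "v \<in> D" for v
    using st that tree(3) unfolding geodesic_stage_def branch_def by metis
  let ?U = "\<Union>p\<in>D'. cell p" and ?U' = "\<Union>p\<in>lat_square n - D'. cell p"
  have all: "P t \<in> ?U" if t: "t \<in> {0..?l}" for t
  proof (rule ccontr)
    assume nt: "P t \<notin> ?U"
    have cov: "P ` {0..?l} \<subseteq> ?U \<union> ?U'"
      using geodesic_arc_dist(1)[OF P] cell_cover D' by fastforce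
    have "(-n,-n) \<in> lat_ring n" using n by (auto simp: lat_ring_def lat_square_def lat_inner_def)
    then have "P 0 \<in> ?U" using P outer(1) ring_cell D' unfolding geodesic_arc_def by blast
    then obtain t1 where t1: "t1 \<in> {0..?l}" "P t1 \<in> ?U" "P t1 \<in> ?U'" "\<And>s. 0 \<le> s \<Longrightarrow> s \<le> t1 \<Longrightarrow> P s \<in> ?U"
        "\<And>u. u \<le> ?l \<Longrightarrow> (\<forall>s\<in>{0..u}. P s \<in> ?U) \<Longrightarrow> u \<le> t1"
      using last_covered_time[OF geodesic_arc_connected[OF P] closed_cells closed_cells cov _ t nt] D' by blast
    obtain v p where vp: "v \<in> lat_square n - D'" "p \<in> D'" "P t1 \<in> cell v" "P t1 \<in> cell p" using t1(2,3) by blast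
    obtain p' where p': "v \<in> lat_inner n" "p' \<in> D'" "lat_adj v p'" "P t1 \<in> cell p'"
      using attachable[OF D' vp] by blast
    have t1X: "P t1 \<in> X" "dist z0 (P t1) = t1" using geodesic_arc_dist[OF P, of t1] t1(1) by auto
    have "guardable (branch pth' p') (P t1) (\<eta> + 2 * \<delta>) \<rho>"
    proof (cases "p' \<in> D")
      case True
      obtain y where y: "guardable (branch pth' p') y \<eta> \<rho>" "p' \<in> lat_ring n \<and> y = z0 \<or> p' \<in> lat_inner n \<and> y \<in> cell p'"
        using old[OF True] by blast
      have "dist z0 y + dist y (P t1) \<le> dist z0 (P t1) + 2 * \<delta>"
        using y(2)
      proof
        assume "p' \<in> lat_inner n \<and> y \<in> cell p'"
        then have "dist y (P t1) \<le> \<delta>" using small p'(4) by blast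
        then show ?thesis using dist_triangle[of z0 y "P t1"] by (simp add: dist_commute)
      qed (use \<delta> in simp)
      then show ?thesis by (intro guardable_extend[OF y(1) t1X(1)]) simp
    next
      case False
      then obtain t where t: "t \<in> {0..?l}" "\<forall>s\<in>{0..t}. P s \<in> ?U" "guardable (branch pth' p') (P t) (\<eta> + 2 * \<delta>) \<rho>"
        using new[of p'] p'(2) by blast
      have tt: "t \<le> t1" using t1(5)[of t] t by auto
      have "dist (P t) (P t1) = \<bar>t - t1\<bar>" using P t(1) t1(1) unfolding geodesic_arc_def by blast
      moreover have "dist z0 (P t) = t" using geodesic_arc_dist(2)[OF P] t(1) by simp
      ultimately show ?thesis using tt t1X by (intro guardable_extend[OF t(3) t1X(1)]) simp
    qed
    then have g: "guardable (insert v (branch pth' p')) (P t1) (\<eta> + 2 * \<delta>) \<rho>"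
      by (rule guardable_same) (use small[OF p'(1)] vp(3) \<delta> in \<open>auto intro: order_trans\<close>)
    have vD: "v \<notin> D'" using vp by blast
    let ?q = "pth'(v := v # pth' p')"
    have br: "branch ?q v = insert v (branch pth' p')" "\<And>w. w \<noteq> v \<Longrightarrow> branch ?q w = branch pth' w" 
      unfolding branch_def by auto
    have "I (insert v D') ?q"
      unfolding I_def
    proof (intro conjI ballI)
      show "rooted_tree (insert v D') ?q" using rooted_tree_insert[OF tree(1) p'(1) vD p'(2,3)] .
      show "D \<subseteq> insert v D'" using tree by blast
      show "?q w = pth w" if "w \<in> D" for w using that tree vD by auto
      fix w assume w: "w \<in> insert v D' - D"
      show "w \<in> lat_inner n" using w new p' by blast
      show "\<exists>t\<in>{0..?l}. P t \<in> cell w \<and> (\<forall>s\<in>{0..t}. P s \<in> (\<Union>p\<in>insert v D'. cell p)) \<and> guardable (branch ?q w) (P t) (\<eta> + 2 * \<delta>) \<rho>"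
      proof (cases "w = v")
        case True
        have "\<forall>s\<in>{0..t1}. P s \<in> (\<Union>p\<in>insert v D'. cell p)" using t1(4) by force
        then show ?thesis unfolding True br(1) using t1(1) vp(3) g by blast
      next
        case False
        then obtain t where t: "t\<in>{0..?l}" "P t \<in> cell w" "\<forall>s\<in>{0..t}. P s \<in> ?U" "guardable (branch pth' w) (P t) (\<eta> + 2 * \<delta>) \<rho>"
          using new[of w] w by blast
        then show ?thesis unfolding br(2)[OF False] by blast
      qed
    qed
    then show False using max vD by blast
  qed
  show thesis
  proof (rule that[of D' pth'])
    show "D \<subseteq> D'" by (rule tree)
    have "P ?l = f" using P unfolding geodesic_arc_def by blast
    then show "\<exists>p\<in>D'. f \<in> cell p" using all[of ?l] by auto
    show "geodesic_stage D' pth' (\<eta> + 2 * \<delta>)"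
      unfolding geodesic_stage_def
    proof (intro conjI ballI tree(1))
      fix v assume v: "v \<in> D'"
      show "\<exists>y. guardable (branch pth' v) y (\<eta> + 2 * \<delta>) \<rho> \<and> (v \<in> lat_ring n \<and> y = z0 \<or> v \<in> lat_inner n \<and> y \<in> cell v)"
      proof (cases "v \<in> D")
        case True
        then show ?thesis using old[OF True] guardable_mono[of _ _ \<eta> \<rho> "\<eta> + 2 * \<delta>" \<rho>] \<delta> by auto
      next
        case False
        then show ?thesis using new[of v] v by blast
      qed
    qed
  qed
qed

text \<open>One round for each point of the net \<open>F\<close>: the excess is bounded in terms of \<open>card
  F\<close> and \<open>\<delta>\<close>, but not of the number of cells.\<close>

lemma geodesic_stage_net:
  assumes "finite F" "F \<subseteq> X"
  obtains D pth where "geodesic_stage D pth (2 * \<delta> * card F)" "\<And>f. f \<in> F \<Longrightarrow> \<exists>p\<in>D. f \<in> cell p"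
proof -
  have "\<exists>D pth. geodesic_stage D pth (2 * \<delta> * card F) \<and> (\<forall>f\<in>F. \<exists>p\<in>D. f \<in> cell p)"
    using assms
  proof (induction F rule: finite_induct)
    case empty
    have "geodesic_stage (lat_ring n) (\<lambda>v. [v]) 0"
      unfolding geodesic_stage_def
    proof (intro conjI ballI)
      show "rooted_tree (lat_ring n) (\<lambda>v. [v])" 
        using lat_square_split(1)[of n] unfolding rooted_tree_def lat_tree_def by auto
      fix v assume "v \<in> lat_ring n"
      then show "\<exists>y. guardable (branch (\<lambda>v. [v]) v) y 0 \<rho> \<and> (v \<in> lat_ring n \<and> y = z0 \<or> v \<in> lat_inner n \<and> y \<in> cell v)"
        using guardable_ring by (intro exI[of _ z0]) (auto simp: branch_def insert_absorb)
    qed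
    then show ?case by auto
  next
    case (insert f F)
    then obtain D pth where D: "geodesic_stage D pth (2 * \<delta> * card F)" "\<forall>f\<in>F. \<exists>p\<in>D. f \<in> cell p" by auto
    obtain D' pth' where "geodesic_stage D' pth' (2 * \<delta> * card F + 2 * \<delta>)" "D \<subseteq> D'" "\<exists>p\<in>D'. f \<in> cell p"
      using geodesic_round[OF D(1), of f] insert.prems by blast
    moreover have "2 * \<delta> * card F + 2 * \<delta> = 2 * \<delta> * card (insert f F)"
      using insert by (simp add: algebra_simps)
    ultimately show ?case using D(2) by (metis insert_iff subset_iff)
  qed
  then show thesis using that by blast
qed

end


text \<open>Vertices are grouped into blocks \<open>blk v\<close> of size comparable to \<open>\<rho>\<close>,
  and \<open>E b\<close> is an enlargement of the block \<open>b\<close>. The blocks are coloured so that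
  the enlargements of different blocks of one colour are not adjacent. The points of \<open>F\<close> are
  so dense that the nearest one can be reached from a point of a block within its enlargement. As
  \<open>F\<close> depends on \<open>\<rho>\<close> but not on \<open>\<delta>\<close>, the last assumption
  holds for sufficiently fine cells.\<close>

locale coloured_lattice_cells = lattice_cells X z0 n cell outer \<rho> \<delta>
  for X :: "'a::metric_space set" and z0 n cell outer \<rho> \<delta> +
  fixes blk :: "int \<times> int \<Rightarrow> 'b" and E :: "'b \<Rightarrow> (int \<times> int) set" and colour :: "'b \<Rightarrow> nat" and C :: nat
    and \<rho>' :: real and F :: "'a set"
  assumes E_small: "v \<in> lat_inner n \<Longrightarrow> w \<in> lat_inner n \<Longrightarrow> v \<in> E b \<Longrightarrow> w \<in> E b \<Longrightarrow> x \<in> cell v \<Longrightarrow> y \<in> cell w \<Longrightarrow> dist x y \<le> \<rho>"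
    and E_sep: "colour b = colour b' \<Longrightarrow> v \<in> E b \<Longrightarrow> w \<in> E b' \<Longrightarrow> lat_adj v w \<Longrightarrow> b = b'"
    and colour: "colour b < C"
    and E_hop: "v \<in> lat_inner n \<Longrightarrow> w \<in> lat_inner n \<Longrightarrow> x \<in> cell v \<Longrightarrow> y \<in> cell w \<Longrightarrow> dist x y \<le> \<rho>' \<Longrightarrow> w \<in> E (blk v)"
    and F: "finite F" "F \<subseteq> X" "x \<in> X \<Longrightarrow> \<exists>f\<in>F. dist x f \<le> \<rho>'" "2 * \<delta> * card F \<le> \<rho>"
begin

text \<open>Each cell of the tree is near the end of the path that guards its branch. The tree contains a cell
  of each point of the net.\<close>

definition colour_stage :: "(int \<times> int) set \<Rightarrow> (int \<times> int \<Rightarrow> (int \<times> int) list) \<Rightarrow> real \<Rightarrow> bool" where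
  "colour_stage D pth \<kappa> \<longleftrightarrow> rooted_tree D pth \<and> (\<forall>v\<in>D. \<exists>y. guardable (branch pth v) y \<rho> \<kappa> \<and> (\<forall>x\<in>cell v. dist x y \<le> \<kappa>)) \<and>
     (\<forall>f\<in>F. \<exists>p\<in>D. f \<in> cell p)"

lemma colour_stage_start:
  obtains D pth where "colour_stage D pth \<rho>"
proof -
  obtain D pth where D: "geodesic_stage D pth (2 * \<delta> * card F)" "\<And>f. f \<in> F \<Longrightarrow> \<exists>p\<in>D. f \<in> cell p"
    using geodesic_stage_net[OF F(1,2)] by blast
  have "\<exists>y. guardable (branch pth v) y \<rho> \<rho> \<and> (\<forall>x\<in>cell v. dist x y \<le> \<rho>)" if v: "v \<in> D" for v
  proof -
    obtain y where y: "guardable (branch pth v) y (2 * \<delta> * card F) \<rho>"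
       "v \<in> lat_ring n \<and> y = z0 \<or> v \<in> lat_inner n \<and> y \<in> cell v"
      using D(1) v unfolding geodesic_stage_def by blast
    have "\<forall>x\<in>cell v. dist x y \<le> \<rho>"
      using y(2)
    proof
      assume "v \<in> lat_ring n \<and> y = z0"
      then show ?thesis using ring_cell outer(2) by (auto simp: dist_commute)
    next
      assume "v \<in> lat_inner n \<and> y \<in> cell v"
      then show ?thesis using small \<delta>(2) order_trans by blast
    qed
    then show ?thesis using guardable_mono[OF y(1) F(4) order_refl] by blast
  qed
  then have "colour_stage D pth \<rho>" using D unfolding colour_stage_def geodesic_stage_def by blast
  then show thesis by (rule that)
qed

text \<open>The nonempty cells in the blocks of one colour \<open>c\<close> are added. A new cell takes over the
  path of its neighbour in the tree. Within an enlarged block this path ends near one and the same set of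
  small diameter, no matter how many cells have been added, so a round costs only \<open>\<rho>\<close>.
  The number of rounds is the number of colours, which does not depend on the fineness of the cells;
  attaching the cells without colours would let the distances grow with their number.

  Every nonempty cell of colour \<open>c\<close> is reached: a geodesic to the nearest point of the net
  stays in the enlarged block, and where it first meets the tree a further cell could be added.\<close>

lemma colour_round:
  assumes st: "colour_stage D pth \<kappa>"
  obtains D' pth' where "colour_stage D' pth' (\<kappa> + \<rho>)" "D \<subseteq> D'"
    "\<And>v. v \<in> lat_inner n \<Longrightarrow> colour (blk v) = c \<Longrightarrow> cell v \<noteq> {} \<Longrightarrow> v \<in> D'"
proof -
  define I where "I = (\<lambda>D' pth'. rooted_tree D' pth' \<and> D \<subseteq> D' \<and> (\<forall>v\<in>D. pth' v = pth v) \<and>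
     (\<forall>v\<in>D' - D. \<exists>b y. colour b = c \<and> v \<in> E b \<inter> lat_inner n \<and> guardable (branch pth' v) y \<rho> (\<kappa> + \<rho>) \<and>
         (\<exists>u\<in>E b \<inter> lat_inner n. \<exists>z\<in>cell u. dist z y \<le> \<kappa>)))"
  have \<rho>: "0 \<le> \<rho>" using \<delta> by simp
  have "I D pth" using st unfolding I_def colour_stage_def by blast
  moreover have "\<And>D' pth'. I D' pth' \<Longrightarrow> D' \<subseteq> lat_square n" unfolding I_def rooted_tree_def by blast
  ultimately obtain D' pth' where I: "I D' pth'" and max: "\<And>v p'. v \<notin> D' \<Longrightarrow> \<not> I (insert v D') p'"
    using maximal_tree[of I D pth] by metis
  have tree: "rooted_tree D' pth'" "D \<subseteq> D'" "\<forall>v\<in>D. pth' v = pth v"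
    and new: "\<And>v. v \<in> D' - D \<Longrightarrow> \<exists>b y. colour b = c \<and> v \<in> E b \<inter> lat_inner n \<and> guardable (branch pth' v) y \<rho> (\<kappa> + \<rho>) \<and>
         (\<exists>u\<in>E b \<inter> lat_inner n. \<exists>z\<in>cell u. dist z y \<le> \<kappa>)"
    using I unfolding I_def by blast+
  have D': "lat_ring n \<subseteq> D'" "D' \<subseteq> lat_square n" using tree unfolding rooted_tree_def by auto
  have old: "\<exists>y. guardable (branch pth' v) y \<rho> \<kappa> \<and> (\<forall>x\<in>cell v. dist x y \<le> \<kappa>)" if "v \<in> D" for v
    using st that tree(3) unfolding colour_stage_def branch_def by metis
  have near: "dist x y \<le> \<kappa> + \<rho>" if "v \<in> E b \<inter> lat_inner n" "x \<in> cell v" "u \<in> E b \<inter> lat_inner n" "z \<in> cell u" "dist z y \<le> \<kappa>"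
    for x y z u v b
    using dist_triangle[of x y z] E_small[of v u b x z] that by force
  have closed: False if v: "v \<in> lat_square n - D'" "v \<in> E b" "colour b = c" and p: "p \<in> D'" and z: "z \<in> cell v" "z \<in> cell p" for v b p z
  proof -
    obtain p' where p': "v \<in> lat_inner n" "p' \<in> D'" "lat_adj v p'" "z \<in> cell p'"
      using attachable[OF D' v(1) p z] by blast
    obtain y u z' where y: "guardable (branch pth' p') y \<rho> (\<kappa> + \<rho>)" "u \<in> E b \<inter> lat_inner n" "z' \<in> cell u" "dist z' y \<le> \<kappa>"
    proof (cases "p' \<in> D")
      case True
      then obtain y where "guardable (branch pth' p') y \<rho> \<kappa>" "dist z y \<le> \<kappa>" using old p'(4) by blast
      then show ?thesis using that[of y v z] guardable_mono[of _ y \<rho> \<kappa> \<rho> "\<kappa> + \<rho>"] \<rho> v(2) p'(1) z(1) by auto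
    next
      case False
      then obtain b' y u z' where b': "colour b' = c" "p' \<in> E b' \<inter> lat_inner n" "guardable (branch pth' p') y \<rho> (\<kappa> + \<rho>)"
         "u\<in>E b' \<inter> lat_inner n" "z'\<in>cell u" "dist z' y \<le> \<kappa>"
        using new[of p'] p'(2) by blast
      have "b = b'" using E_sep[of b b' v p'] b' v p' by auto
      then show ?thesis using that b' by blast
    qed
    have vE: "v \<in> E b \<inter> lat_inner n" using v p' by blast
    have g: "guardable (insert v (branch pth' p')) y \<rho> (\<kappa> + \<rho>)"
      by (rule guardable_same[OF y(1)]) (use near[OF vE _ y(2-4)] in auto)
    have vD: "v \<notin> D'" using v by blast
    let ?q = "pth'(v := v # pth' p')"
    have br: "branch ?q v = insert v (branch pth' p')" "\<And>w. w \<noteq> v \<Longrightarrow> branch ?q w = branch pth' w" 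
      unfolding branch_def by auto
    have "I (insert v D') ?q"
      unfolding I_def
    proof (intro conjI ballI)
      show "rooted_tree (insert v D') ?q" using rooted_tree_insert[OF tree(1) p'(1) vD p'(2,3)] .
      show "D \<subseteq> insert v D'" using tree by blast
      show "?q w = pth w" if "w \<in> D" for w using that tree vD by auto
      fix w assume w: "w \<in> insert v D' - D"
      show "\<exists>b y. colour b = c \<and> w \<in> E b \<inter> lat_inner n \<and> guardable (branch ?q w) y \<rho> (\<kappa> + \<rho>) \<and>
         (\<exists>u\<in>E b \<inter> lat_inner n. \<exists>z\<in>cell u. dist z y \<le> \<kappa>)"
      proof (cases "w = v")
        case True
        show ?thesis unfolding True br(1) using vE v(3) g y(2-4) by blast
      next
        case False
        then show ?thesis unfolding br(2)[OF False] using new[of w] w by blast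
      qed
    qed
    then show False using max vD by blast
  qed
  show thesis
  proof (rule that[of D' pth'])
    show "D \<subseteq> D'" by (rule tree)
    show "colour_stage D' pth' (\<kappa> + \<rho>)"
      unfolding colour_stage_def
    proof (intro conjI ballI tree(1))
      show "\<exists>p\<in>D'. f \<in> cell p" if "f \<in> F" for f using st that tree(2) unfolding colour_stage_def by blast
      fix v assume v: "v \<in> D'"
      show "\<exists>y. guardable (branch pth' v) y \<rho> (\<kappa> + \<rho>) \<and> (\<forall>x\<in>cell v. dist x y \<le> \<kappa> + \<rho>)"
      proof (cases "v \<in> D")
        case True
        then obtain y where y: "guardable (branch pth' v) y \<rho> \<kappa>" "\<forall>x\<in>cell v. dist x y \<le> \<kappa>" using old by blast
        have "guardable (branch pth' v) y \<rho> (\<kappa> + \<rho>)" using guardable_mono[OF y(1)] \<rho> by simp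
        moreover have "\<forall>x\<in>cell v. dist x y \<le> \<kappa> + \<rho>" using y(2) \<rho> by force
        ultimately show ?thesis by blast
      next
        case False
        then show ?thesis using new[of v] v near by blast
      qed
    qed
    fix v assume v: "v \<in> lat_inner n" "colour (blk v) = c" "cell v \<noteq> {}"
    show "v \<in> D'"
    proof (rule ccontr)
      assume vD: "v \<notin> D'"
      have vs: "v \<in> lat_square n" using v lat_square_split by blast
      obtain x where x: "x \<in> cell v" using v by blast
      then have xX: "x \<in> X" using cell_sub vs by blast
      then obtain f where f: "f \<in> F" "dist x f \<le> \<rho>'" using F(3) by blast
      then have fX: "f \<in> X" using F(2) by blast
      obtain Q where Q: "geodesic_arc X Q x f" using geodesic_arc_exists[OF geo xX fX] by blast
      let ?I = "Q ` {0..dist x f}" and ?U = "\<Union>p\<in>D'. cell p" and ?U' = "\<Union>p\<in>lat_square n - D'. cell p"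
      have cov: "?I \<subseteq> ?U \<union> ?U'" using geodesic_arc_dist(1)[OF Q] cell_cover D' by fastforce
      have conn: "connected ?I" using geodesic_arc_connected[OF Q] by (rule connected_continuous_image) simp
      have "x \<in> ?I" "f \<in> ?I"
        using Q unfolding geodesic_arc_def by (auto simp: image_iff intro: bexI[of _ 0] bexI[of _ "dist x f"])
      moreover have "x \<in> ?U'" using x vs vD by blast
      moreover have "f \<in> ?U" using st tree(2) f(1) unfolding colour_stage_def by blast
      ultimately have "?U \<inter> ?U' \<inter> ?I \<noteq> {}"
        using connected_closedD[OF conn _ cov closed_cells closed_cells] D' by blast
      then obtain y t p v' where y: "t \<in> {0..dist x f}" "y = Q t" "p \<in> D'" "y \<in> cell p" "v' \<in> lat_square n - D'" "y \<in> cell v'"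
        by blast
      have "dist x y \<le> \<rho>'" using geodesic_arc_dist(2)[OF Q, of t] y(1,2) f(2) by simp
      moreover have "v' \<in> lat_inner n" using y(5) D' lat_square_split by blast
      ultimately have "v' \<in> E (blk v)" using E_hop[OF v(1) _ x y(6)] by blast
      then show False using closed[OF y(5) _ v(2) y(3) y(6,4)] by blast
    qed
  qed
qed

lemma colour_stage_all:
  obtains D pth where "colour_stage D pth ((C + 1) * \<rho>)" "\<And>v. v \<in> lat_inner n \<Longrightarrow> cell v \<noteq> {} \<Longrightarrow> v \<in> D"
proof -
  have "\<exists>D pth. colour_stage D pth ((k + 1) * \<rho>) \<and> (\<forall>v\<in>lat_inner n. colour (blk v) < k \<longrightarrow> cell v \<noteq> {} \<longrightarrow> v \<in> D)" for k :: nat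
  proof (induction k)
    case 0
    then show ?case using colour_stage_start by force
  next
    case (Suc k)
    then obtain D pth where D: "colour_stage D pth ((k + 1) * \<rho>)" "\<forall>v\<in>lat_inner n. colour (blk v) < k \<longrightarrow> cell v \<noteq> {} \<longrightarrow> v \<in> D"
      by blast
    obtain D' pth' where D': "colour_stage D' pth' ((k + 1) * \<rho> + \<rho>)" "D \<subseteq> D'"
        "\<And>v. v \<in> lat_inner n \<Longrightarrow> colour (blk v) = k \<Longrightarrow> cell v \<noteq> {} \<Longrightarrow> v \<in> D'"
      using colour_round[OF D(1)] by metis
    have eq: "real (k + 1) * \<rho> + \<rho> = real (Suc k + 1) * \<rho>" by (simp add: algebra_simps)
    have "colour_stage D' pth' (real (Suc k + 1) * \<rho>)" using D'(1) unfolding eq .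
    moreover have "v \<in> D'" if "v \<in> lat_inner n" "colour (blk v) < Suc k" "cell v \<noteq> {}" for v
      using that D(2) D'(2) D'(3)[of v] less_Suc_eq by blast
    ultimately show ?case by blast
  qed
  from this[of C] show thesis using that colour by blast
qed

text \<open>Only empty cells remain. The robber is never there, so they are attached to arbitrary neighbours.\<close>

lemma spanning_tree:
  obtains pth where "rooted_tree (lat_square n) pth" "\<And>v. v \<in> lat_square n \<Longrightarrow> \<exists>y. guardable (branch pth v) y \<rho> ((C + 1) * \<rho>)"
proof -
  let ?\<kappa> = "(C + 1) * \<rho>"
  obtain D pth where D: "colour_stage D pth ?\<kappa>" "\<And>v. v \<in> lat_inner n \<Longrightarrow> cell v \<noteq> {} \<Longrightarrow> v \<in> D"
    using colour_stage_all by blast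
  define I where "I = (\<lambda>D' pth'. rooted_tree D' pth' \<and> D \<subseteq> D' \<and> (\<forall>v\<in>D'. \<exists>y. guardable (branch pth' v) y \<rho> ?\<kappa>))"
  have "I D pth" using D unfolding I_def colour_stage_def by blast
  moreover have "\<And>D' pth'. I D' pth' \<Longrightarrow> D' \<subseteq> lat_square n" unfolding I_def rooted_tree_def by blast
  ultimately obtain D' pth' where I: "I D' pth'" and max: "\<And>v p'. v \<notin> D' \<Longrightarrow> \<not> I (insert v D') p'"
    using maximal_tree[of I D pth] by metis
  have tree: "rooted_tree D' pth'" "D \<subseteq> D'" "\<And>v. v \<in> D' \<Longrightarrow> \<exists>y. guardable (branch pth' v) y \<rho> ?\<kappa>"
    using I unfolding I_def by blast+
  have D': "lat_ring n \<subseteq> D'" "D' \<subseteq> lat_square n" using tree unfolding rooted_tree_def by auto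
  have step: "(i,j) \<in> D'" if ij: "(i,j) \<in> lat_inner n" "(i-1,j) \<in> D'" for i j
  proof (rule ccontr)
    assume v: "(i,j) \<notin> D'"
    let ?v = "(i,j)" and ?p = "(i-1,j)"
    have empty: "cell ?v = {}" using D(2) ij(1) v tree(2) by blast
    have adj: "lat_adj ?v ?p" by (simp add: lat_adj_def)
    let ?q = "pth'(?v := ?v # pth' ?p)"
    have br: "branch ?q ?v = insert ?v (branch pth' ?p)" "\<And>w. w \<noteq> ?v \<Longrightarrow> branch ?q w = branch pth' w" 
      unfolding branch_def by auto
    obtain y where "guardable (branch pth' ?p) y \<rho> ?\<kappa>" using tree(3) ij(2) by blast
    then have "guardable (branch ?q ?v) y \<rho> ?\<kappa>" unfolding br(1) by (rule guardable_same) (use empty in auto)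
    then have "\<forall>w\<in>insert ?v D'. \<exists>y. guardable (branch ?q w) y \<rho> ?\<kappa>"
      using tree(3) br(2) by (metis insert_iff)
    moreover have "rooted_tree (insert ?v D') ?q" using rooted_tree_insert[OF tree(1) ij(1) v ij(2) adj] .
    ultimately have "I (insert ?v D') ?q" using tree(2) unfolding I_def by blast
    then show False using max v by blast
  qed
  have row: "(- n + int k, j) \<in> D'" if "k < 2 * n" "- n < j" "j < n" for k :: nat and j
    using that
  proof (induction k)
    case 0
    then have "(- n, j) \<in> lat_ring n" using n by (auto simp: lat_ring_def lat_square_def lat_inner_def)
    then show ?case using D' by auto
  next
    case (Suc k)
    then show ?case using step[of "- n + int (Suc k)" j] by (auto simp: lat_inner_def)
  qed
  have "lat_inner n \<subseteq> D'"
  proof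
    fix v assume v: "v \<in> lat_inner n"
    obtain i j where ij: "v = (i,j)" by (cases v)
    have "- n < i" "i < n" "- n < j" "j < n" using v by (auto simp: ij lat_inner_def)
    then show "v \<in> D'" using row[of "nat (i + n)" j] by (simp add: ij)
  qed
  then have "D' = lat_square n" using D' lat_square_split(1) by blast
  then show thesis using that tree by blast
qed

lemma exists_guarded_cells:
  obtains pth gam len where "guarded_cells X z0 n cell pth gam len (\<rho> + 2 * ((C + 1) * \<rho>))"
proof -
  let ?\<kappa> = "(C + 1) * \<rho>"
  obtain pth where pth: "rooted_tree (lat_square n) pth" "\<And>v. v \<in> lat_square n \<Longrightarrow> \<exists>y. guardable (branch pth v) y \<rho> ?\<kappa>"
    using spanning_tree by blast
  then have "\<exists>\<gamma> L y. almost_geodesic (branch pth v) y \<rho> ?\<kappa> \<gamma> L" if "v \<in> lat_square n" for v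
    using that unfolding guardable_def by blast
  then obtain gam len fin where g: "\<And>v. v \<in> lat_square n \<Longrightarrow> almost_geodesic (branch pth v) (fin v) \<rho> ?\<kappa> (gam v) (len v)"
    by metis
  have "guarded_cells X z0 n cell pth gam len (\<rho> + 2 * ?\<kappa>)"
  proof (unfold_locales; (fact geo z0 n cell_closed cell_cover cell_adj)?)
    show "lat_tree n (lat_square n) pth" using pth unfolding rooted_tree_def by blast
    fix u assume u: "u \<in> lat_square n"
    note gu = g[OF u, unfolded almost_geodesic_def]
    show "0 \<le> len u" "gam u 0 = z0" using gu by auto
    show "gam u t \<in> X" if "0 \<le> t" "t \<le> len u" for t using gu that by auto
    show "dist (gam u s) (gam u t) \<le> t - s" if "0 \<le> s" "s \<le> t" "t \<le> len u" for s t using gu that by auto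
    show "dist (gam u (min (dist z0 x) (len u))) x \<le> \<rho> + 2 * ?\<kappa>"
      if "w \<in> set (pth u) \<union> lat_ring n" "x \<in> cell w" for w x
      using almost_geodesic_near[OF g[OF u] _ that(2)] that(1) unfolding branch_def by blast
  qed
  then show thesis by (rule that)
qed

end


section \<open>Brick walls in a planar chart\<close>

text \<open>The stereographic projection from the image of \<open>z0\<close>. Preimages of compact sets are
  compact, that is, points near \<open>z0\<close> go to infinity.\<close>

lemma punctured_planar_chart:
  fixes X :: "'a::metric_space set" and S :: "(real^3) set"
  assumes X: "compact X" "z0 \<in> X" and S: "S \<subseteq> sphere 0 1" "X homeomorphic S"
  obtains G :: "'a \<Rightarrow> real \<times> real" where "continuous_on (X - {z0}) G" "inj_on G (X - {z0})"
    "\<And>K. compact K \<Longrightarrow> compact {x \<in> X - {z0}. G x \<in> K}"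
proof -
  obtain h h' where h: "homeomorphism X S h h'" using S(2) unfolding homeomorphic_def by blast
  have hX: "h ` X = S" "continuous_on X h" "inj_on h X"
    using h unfolding homeomorphism_def by (auto intro: inj_on_inverseI)
  define p where "p = h z0"
  have p: "p \<in> sphere 0 1" using hX X(2) S(1) unfolding p_def by blast
  have "(sphere 0 1 - {p}) homeomorphic (UNIV :: (real \<times> real) set)"
    by (rule homeomorphic_punctured_sphere_affine) (use p in auto)
  then obtain \<phi> \<psi> where \<phi>: "homeomorphism (sphere 0 1 - {p}) (UNIV :: (real \<times> real) set) \<phi> \<psi>"
    unfolding homeomorphic_def by blast
  have \<phi>D: "continuous_on (sphere 0 1 - {p}) \<phi>" "\<And>y. y \<in> sphere 0 1 - {p} \<Longrightarrow> \<psi> (\<phi> y) = y"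
    "\<And>z. \<phi> (\<psi> z) = z" "continuous_on UNIV \<psi>" "\<And>z. \<psi> z \<in> sphere 0 1 - {p}"
    using \<phi> unfolding homeomorphism_def by blast+
  have hp: "h x \<in> sphere 0 1 - {p}" if "x \<in> X - {z0}" for x
    using that hX S(1) X(2) inj_onD[OF hX(3), of x z0] unfolding p_def by blast
  show thesis
  proof (rule that[of "\<lambda>x. \<phi> (h x)"])
    show "continuous_on (X - {z0}) (\<lambda>x. \<phi> (h x))"
      by (rule continuous_on_compose2[OF \<phi>D(1)]) (use hX(2) hp in \<open>auto intro: continuous_on_subset\<close>)
    show "inj_on (\<lambda>x. \<phi> (h x)) (X - {z0})"
    proof (rule inj_onI)
      fix x y assume xy: "x \<in> X - {z0}" "y \<in> X - {z0}" "\<phi> (h x) = \<phi> (h y)"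
      then have "h x = h y" using \<phi>D(2) hp by metis
      then show "x = y" using xy inj_onD[OF hX(3)] by blast
    qed
    fix K :: "(real \<times> real) set" assume K: "compact K"
    have "{x \<in> X - {z0}. \<phi> (h x) \<in> K} = X \<inter> h -` (\<psi> ` K)"
    proof (intro equalityI subsetI)
      fix x assume "x \<in> {x \<in> X - {z0}. \<phi> (h x) \<in> K}"
      then show "x \<in> X \<inter> h -` (\<psi> ` K)" using \<phi>D(2) hp by (metis (mono_tags, lifting) DiffD1 IntI imageI mem_Collect_eq vimageI)
    next
      fix x assume "x \<in> X \<inter> h -` (\<psi> ` K)"
      then obtain k where k: "x \<in> X" "k \<in> K" "h x = \<psi> k" by blast
      then have "x \<noteq> z0" using \<phi>D(5)[of k] unfolding p_def by auto
      then show "x \<in> {x \<in> X - {z0}. \<phi> (h x) \<in> K}" using k \<phi>D(3) by simp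
    qed
    moreover have "compact (\<psi> ` K)" using K \<phi>D(4) by (intro compact_continuous_image) (auto intro: continuous_on_subset)
    then have "closed (X \<inter> h -` (\<psi> ` K))"
      using X(1) hX(2) by (intro continuous_closed_preimage) (auto simp: compact_imp_closed)
    then have "compact (X \<inter> h -` (\<psi> ` K))"
      using X(1) compact_Int_closed[of X "X \<inter> h -` (\<psi> ` K)"] by (simp add: Int_absorb1 inf_left_idem)
    ultimately show "compact {x \<in> X - {z0}. \<phi> (h x) \<in> K}" by simp
  qed
qed

text \<open>A brick wall in which successive rows are displaced by half a brick, so that no four bricks meet in
  a point.\<close>

definition brick :: "int \<times> int \<Rightarrow> (real \<times> real) set" where
  "brick v = {(a, b). real_of_int (fst v) \<le> b \<and> b \<le> real_of_int (fst v) + 1 \<and>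
     real_of_int (snd v) \<le> a + real_of_int (fst v) / 2 \<and> a + real_of_int (fst v) / 2 \<le> real_of_int (snd v) + 1}"

text \<open>The union of the bricks whose labels are not interior, written as a finite union of closed sets.\<close>

definition outer_bricks :: "int \<Rightarrow> (real \<times> real) set" where
  "outer_bricks n = {(a, b). b \<le> 1 - n} \<union> {(a, b). n \<le> b} \<union>
     (\<Union>i\<in>{-n<..<n}. {(a, b). real_of_int i \<le> b \<and> b \<le> real_of_int i + 1 \<and> (a + real_of_int i / 2 \<le> 1 - n \<or> n \<le> a + real_of_int i / 2)})"

lemma compact_brick: "compact (brick v)"
proof -
  let ?i = "real_of_int (fst v)" and ?j = "real_of_int (snd v)"
  have "brick v = {x. ?i \<le> snd x} \<inter> {x. snd x \<le> ?i + 1} \<inter> {x. ?j \<le> fst x + ?i / 2} \<inter> {x. fst x + ?i / 2 \<le> ?j + 1}"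
    unfolding brick_def by auto
  also have "closed \<dots>"
    by (intro closed_Int closed_Collect_le continuous_intros)
  finally have "closed (brick v)" .
  moreover have "brick v \<subseteq> {?j - ?i/2..?j + 1 - ?i/2} \<times> {?i..?i+1}"
    unfolding brick_def by auto
  then have "bounded (brick v)" by (rule bounded_subset[rotated]) (simp add: bounded_Times)
  ultimately show ?thesis using compact_eq_bounded_closed by blast
qed

lemma closed_outer_bricks: "closed (outer_bricks n)"
proof -
  have *: "{(a, b). b \<le> 1 - real_of_int n} = {x. snd x \<le> 1 - real_of_int n}" "{(a, b). real_of_int n \<le> b} = {x. real_of_int n \<le> snd x}"
    "{(a, b). i \<le> b \<and> b \<le> i + 1 \<and> (a + i / 2 \<le> 1 - real_of_int n \<or> n \<le> a + i / 2)} = {x. i \<le> snd x} \<inter> {x. snd x \<le> i + 1} \<inter> ({x. fst x + i / 2 \<le> 1 - n} \<union> {x. n \<le> fst x + i / 2})" for i :: real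
    by auto
  show ?thesis unfolding outer_bricks_def *
    by (intro closed_Un closed_UN ballI closed_Int closed_Collect_le continuous_intros) simp
qed

lemma bricks_cover: "x \<in> outer_bricks n \<or> (\<exists>v\<in>lat_inner n. x \<in> brick v)"
proof (rule ccontr)
  assume no: "\<not> ?thesis"
  then have nx: "x \<notin> outer_bricks n" by blast
  obtain a b where x: "x = (a, b)" by (cases x)
  define i where "i = \<lfloor>b\<rfloor>"
  define j where "j = \<lfloor>a + i / 2\<rfloor>"
  have ib: "i \<le> b" "b < i + 1" unfolding i_def by linarith+
  have ja: "j \<le> a + i / 2" "a + i / 2 < j + 1" unfolding j_def by linarith+
  have b: "1 - n < b" "b < n" using nx unfolding x outer_bricks_def by auto
  then have i: "- n < i" "i < n" using ib by linarith+
  then have "1 - n < a + i / 2" "a + i / 2 < n" using nx ib unfolding x outer_bricks_def by force+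
  then have "- n < j" "j < n" using ja by linarith+
  then have "\<exists>v\<in>lat_inner n. x \<in> brick v"
    using i ib ja by (intro bexI[of _ "(i,j)"]) (auto simp: x brick_def lat_inner_def)
  then show False using no by blast
qed

text \<open>The labels of bricks in successive rows are shifted by \<open>1/2\<close>; this turns contact into
  adjacency in the triangular lattice.\<close>

lemma bricks_adj:
  assumes "x \<in> brick v" "x \<in> brick w" "v \<noteq> w"
  shows "lat_adj v w"
proof -
  obtain a b i j i' j' where [simp]: "x = (a, b)" "v = (i, j)" "w = (i', j')" by (metis surj_pair)
  have h: "i \<le> b" "b \<le> i + 1" "j \<le> a + i / 2" "a + i / 2 \<le> j + 1" "i' \<le> b" "b \<le> i' + 1" "j' \<le> a + i' / 2" "a + i' / 2 \<le> j' + 1"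
    using assms(1,2) by (auto simp: brick_def)
  have "i' \<le> i + 1" "i \<le> i' + 1" using h by linarith+
  then consider "i' = i" | "i' = i + 1" | "i = i' + 1" by linarith
  then show ?thesis
  proof cases
    case 1
    then have "real_of_int j' \<le> j + 1" "real_of_int j \<le> j' + 1" using h by auto
    then have "j' \<le> j + 1" "j \<le> j' + 1" by linarith+
    then show ?thesis using 1 assms(3) by (auto simp: lat_adj_def)
  next
    case 2
    then have "2 * real_of_int j' \<le> 2 * j + 3" "2 * real_of_int j \<le> 2 * j' + 1" using h by (auto simp: field_simps)
    then have "j' \<le> j + 1" "j \<le> j'" by linarith+
    then show ?thesis using 2 by (auto simp: lat_adj_def)
  next
    case 3
    then have "2 * real_of_int j \<le> 2 * j' + 3" "2 * real_of_int j' \<le> 2 * j + 1" using h by (auto simp: field_simps)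
    then have "j \<le> j' + 1" "j' \<le> j" by linarith+
    then show ?thesis using 3 by (auto simp: lat_adj_def)
  qed
qed

lemma bricks_outer_adj:
  assumes "x \<in> brick v" "x \<in> outer_bricks n" "v \<in> lat_inner n"
  shows "\<exists>p\<in>lat_ring n. lat_adj v p"
proof -
  obtain a b i j where [simp]: "x = (a, b)" "v = (i, j)" by (metis surj_pair)
  have h: "i \<le> b" "b \<le> i + 1" "j \<le> a + i / 2" "a + i / 2 \<le> j + 1"
    using assms(1) by (auto simp: brick_def)
  have v: "- n < i" "i < n" "- n < j" "j < n" using assms(3) by (auto simp: lat_inner_def)
  have "i = 1 - n \<or> i = n - 1 \<or> j = 1 - n \<or> j = n - 1"
  proof -
    consider "b \<le> 1 - n" | "n \<le> b" | i' where "real_of_int i' \<le> b" "b \<le> i' + 1" "a + i' / 2 \<le> 1 - n"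
      | i' where "real_of_int i' \<le> b" "b \<le> i' + 1" "n \<le> a + i' / 2"
      using assms(2) unfolding outer_bricks_def by auto
    then show ?thesis
    proof cases
      case (3 i')
      then have "i' \<le> i + 1" "i \<le> i' + 1" using h by linarith+
      then have "2 * real_of_int j \<le> 2 * (1 - n) + 1" using 3 h by (auto simp: field_simps)
      then have "2 * j \<le> 2 * (1 - n) + 1" by linarith
      then show ?thesis using v by presburger
    next
      case (4 i')
      then have "i' \<le> i + 1" "i \<le> i' + 1" using h by linarith+
      then have "2 * real_of_int n \<le> 2 * (j + 1) + 1" using 4 h by (auto simp: field_simps)
      then have "2 * n \<le> 2 * (j + 1) + 1" by linarith
      then show ?thesis using v by presburger
    qed (use h v in linarith)+
  qed
  then consider "i = 1 - n" | "i = n - 1" | "j = 1 - n" | "j = n - 1" by blast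
  then show ?thesis
  proof cases
    case 1
    then show ?thesis using v by (intro bexI[of _ "(-n, j)"]) (auto simp: lat_adj_def lat_ring_def lat_square_def lat_inner_def)
  next
    case 2
    then show ?thesis using v by (intro bexI[of _ "(n, j)"]) (auto simp: lat_adj_def lat_ring_def lat_square_def lat_inner_def)
  next
    case 3
    then show ?thesis using v by (intro bexI[of _ "(i, -n)"]) (auto simp: lat_adj_def lat_ring_def lat_square_def lat_inner_def)
  next
    case 4
    then show ?thesis using v by (intro bexI[of _ "(i, n)"]) (auto simp: lat_adj_def lat_ring_def lat_square_def lat_inner_def)
  qed
qed

lemma bricks_labels_near:
  assumes "(a, b) \<in> brick v" "(a', b') \<in> brick w" "\<bar>a - a'\<bar> \<le> m / 3" "\<bar>b - b'\<bar> \<le> m / 3" "(m::int) \<ge> 3"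
  shows "\<bar>fst v - fst w\<bar> \<le> m \<and> \<bar>snd v - snd w\<bar> \<le> m"
proof -
  obtain i j i' j' where [simp]: "v = (i, j)" "w = (i', j')" by (metis surj_pair)
  have h: "i \<le> b" "b \<le> i + 1" "j \<le> a + i / 2" "a + i / 2 \<le> j + 1" "i' \<le> b'" "b' \<le> i' + 1" "j' \<le> a' + i' / 2" "a' + i' / 2 \<le> j' + 1"
    using assms(1,2) by (auto simp: brick_def)
  have d: "\<bar>real_of_int i - i'\<bar> \<le> m / 3 + 1" using h assms(4) by linarith
  have m: "3 \<le> real_of_int m" using assms(5) by simp
  have "\<bar>real_of_int i - i'\<bar> \<le> m" using d m by linarith
  then have I: "\<bar>i - i'\<bar> \<le> m" by linarith
  have "real_of_int j - j' \<le> (a - a') + (real_of_int i - i') / 2 + 1" 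
    "real_of_int j' - j \<le> (a' - a) + (real_of_int i' - i) / 2 + 1" using h by (auto simp: field_simps)
  moreover have "a - a' \<le> m / 3" "a' - a \<le> m / 3" "real_of_int i - i' \<le> m / 3 + 1" "real_of_int i' - i \<le> m / 3 + 1" 
    using assms(3) d by linarith+
  moreover have "real_of_int m / 3 + (real_of_int m / 3 + 1) / 2 + 1 \<le> m" using m by (simp add: field_simps)
  ultimately have "real_of_int j - j' \<le> m" "real_of_int j' - j \<le> m" by argo+
  then have "\<bar>real_of_int j - j'\<bar> \<le> m" by linarith
  then have "\<bar>j - j'\<bar> \<le> m" by linarith
  then show ?thesis using I by simp
qed

lemma bricks_points_near:
  assumes "(a, b) \<in> brick v" "(a', b') \<in> brick w" "\<bar>fst v - fst w\<bar> < k" "\<bar>snd v - snd w\<bar> < k"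
  shows "\<bar>a - a'\<bar> \<le> 2 * real_of_int k" "\<bar>b - b'\<bar> \<le> real_of_int k"
proof -
  obtain i j i' j' where [simp]: "v = (i, j)" "w = (i', j')" by (metis surj_pair)
  have h: "i \<le> b" "b \<le> i + 1" "j \<le> a + i / 2" "a + i / 2 \<le> j + 1" "i' \<le> b'" "b' \<le> i' + 1" "j' \<le> a' + i' / 2" "a' + i' / 2 \<le> j' + 1"
    using assms(1,2) by (auto simp: brick_def)
  have "\<bar>i - i'\<bar> \<le> k - 1" "\<bar>j - j'\<bar> \<le> k - 1" using assms(3,4) by auto
  then have d: "\<bar>real_of_int i - i'\<bar> \<le> k - 1" "\<bar>real_of_int j - j'\<bar> \<le> k - 1" by linarith+
  show "\<bar>b - b'\<bar> \<le> k" using h d by linarith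
  show "\<bar>a - a'\<bar> \<le> 2 * real_of_int k" using h d by linarith
qed

lemma brick_inner_bound:
  assumes "(a, b) \<in> brick v" "v \<in> lat_inner n"
  shows "\<bar>a\<bar> \<le> 2 * real_of_int n" "\<bar>b\<bar> \<le> real_of_int n"
proof -
  obtain i j where [simp]: "v = (i, j)" by (metis surj_pair)
  have h: "i \<le> b" "b \<le> i + 1" "j \<le> a + i / 2" "a + i / 2 \<le> j + 1" using assms by (auto simp: brick_def)
  have "- n + 1 \<le> i" "i \<le> n - 1" "- n + 1 \<le> j" "j \<le> n - 1" using assms(2) by (auto simp: lat_inner_def)
  then have "- real_of_int n + 1 \<le> i" "i \<le> real_of_int n - 1" "- real_of_int n + 1 \<le> j" "j \<le> real_of_int n - 1" by linarith+
  then show "\<bar>b\<bar> \<le> n" "\<bar>a\<bar> \<le> 2 * real_of_int n" using h by linarith+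
qed

lemma outer_bricks_far:
  assumes "(a, b) \<in> outer_bricks n" "\<bar>a\<bar> < M" "\<bar>b\<bar> < M" "1 \<le> M" "2 * M \<le> real_of_int n - 1"
  shows False
proof -
  consider "b \<le> 1 - n" | "n \<le> b" | i' where "real_of_int i' \<le> b" "b \<le> i' + 1" "a + i' / 2 \<le> 1 - n"
      | i' where "real_of_int i' \<le> b" "b \<le> i' + 1" "n \<le> a + i' / 2"
      using assms(1) unfolding outer_bricks_def by auto
  then show False by cases (use assms(2-) in linarith)+
qed


section \<open>Three cops on a planar geodesic surface\<close>

lemma div_near:
  fixes i i' m :: int
  assumes "m > 0" "\<bar>i - i'\<bar> \<le> m"
  shows "\<bar>i div m - i' div m\<bar> \<le> 1"
proof -
  have "i div m \<le> (i' + m) div m" by (rule zdiv_mono1) (use assms in linarith)+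
  moreover have "i' div m \<le> (i + m) div m" by (rule zdiv_mono1) (use assms in linarith)+
  moreover have "(i' + m) div m = i' div m + 1" "(i + m) div m = i div m + 1" using assms(1) by simp_all
  ultimately show ?thesis by linarith
qed

lemma div_far:
  fixes i i' m q :: int
  assumes "m > 0" "\<bar>i div m - q\<bar> \<le> 1" "\<bar>i' div m - q\<bar> \<le> 1"
  shows "\<bar>i - i'\<bar> < 3 * m"
proof -
  have e: "i = m * (i div m) + i mod m" "i' = m * (i' div m) + i' mod m" by simp_all
  have r: "0 \<le> i mod m" "i mod m < m" "0 \<le> i' mod m" "i' mod m < m" using assms(1) by auto
  have "\<bar>i div m - i' div m\<bar> \<le> 2" using assms by linarith
  then have "m * \<bar>i div m - i' div m\<bar> \<le> m * 2" using assms(1) by (intro mult_left_mono) auto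
  then have "\<bar>m * (i div m) - m * (i' div m)\<bar> \<le> 2 * m" 
    using assms(1) by (simp add: abs_mult[symmetric] right_diff_distrib[symmetric] abs_mult)
  then show ?thesis using e r by linarith
qed

lemma mod4_eq:
  fixes p q :: int
  assumes "p mod 4 = q mod 4" "\<bar>p - q\<bar> \<le> 3"
  shows "p = q"
  using assms by presburger

lemma compact_net:
  fixes X :: "'a::metric_space set"
  assumes "compact X" "e > 0"
  obtains F where "finite F" "F \<subseteq> X" "\<And>x. x \<in> X \<Longrightarrow> \<exists>f\<in>F. dist x f \<le> e"
proof -
  have "X \<subseteq> (\<Union>x\<in>X. ball x e)" using assms by auto
  then obtain F where F: "F \<subseteq> X" "finite F" "X \<subseteq> (\<Union>x\<in>F. ball x e)"
    using compactE_image[OF assms(1), of X "\<lambda>x. ball x e"] by auto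
  have "\<exists>f\<in>F. dist x f \<le> e" if "x \<in> X" for x
  proof -
    obtain f where "f \<in> F" "x \<in> ball f e" using F(3) \<open>x \<in> X\<close> by blast
    then show ?thesis by (intro bexI[of _ f]) (auto simp: dist_commute)
  qed
  with F show thesis using that by blast
qed

text \<open>The choices depend on each other in this order. The radius \<open>\<rho>\<close> determines a box
  outside of which all points are within \<open>\<rho>\<close> of \<open>z0\<close>, and, by uniform
  continuity of the inverse of the chart on a larger box, the width \<open>\<sigma>\<close> of the blocks.
  The latter determines the density \<open>\<rho>'\<close> of the net \<open>F\<close>. The number of
  points of \<open>F\<close> determines the scale \<open>\<delta>\<close> of the cells and thereby the
  number \<open>m\<close> of bricks in the width of a block. The factor \<open>35\<close> comes from
  \<open>16\<close> colours: \<open>1 + 2 * (16 + 1)\<close>.\<close>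

lemma fine_guarded_cells:
  fixes X :: "'a::metric_space set" and S :: "(real^3) set"
  assumes X: "compact X" "geodesic_space X" "z0 \<in> X" and S: "S \<subseteq> sphere 0 1" "X homeomorphic S" and \<rho>: "\<rho> > 0"
  obtains n cell pth gam len where "guarded_cells X z0 n cell pth gam len (35 * \<rho>)"
proof -
  obtain G :: "'a \<Rightarrow> real \<times> real" where G: "continuous_on (X - {z0}) G" "inj_on G (X - {z0})"
    "\<And>K. compact K \<Longrightarrow> compact {x \<in> X - {z0}. G x \<in> K}"
    using punctured_planar_chart[OF X(1,3) S] by blast
  have "compact (X - ball z0 \<rho>)" using X(1) by (simp add: compact_diff)
  moreover have "continuous_on (X - ball z0 \<rho>) G" by (rule continuous_on_subset[OF G(1)]) (use \<rho> in auto)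
  ultimately have "bounded (G ` (X - ball z0 \<rho>))" using compact_continuous_image compact_imp_bounded by blast
  then obtain M where M: "M > 0" "\<And>x. x \<in> X \<Longrightarrow> \<rho> \<le> dist z0 x \<Longrightarrow> norm (G x) < M"
  proof -
    assume "bounded (G ` (X - ball z0 \<rho>))"
    then obtain M where "M > 0" "\<forall>y\<in>G ` (X - ball z0 \<rho>). norm y < M" using bounded_pos_less by metis
    then show ?thesis using that[of M] by fastforce
  qed
  \<comment> \<open>the interior bricks cover the box of size \<open>M\<close>, but the displacement of the rows makes them reach further; they stay in
    this larger box\<close>
  define Y where "Y = {x \<in> X - {z0}. G x \<in> {-10*M..10*M} \<times> {-10*M..10*M}}"
  have Y: "compact Y" unfolding Y_def by (rule G(3)) (intro compact_Times compact_Icc)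
  have YX: "Y \<subseteq> X - {z0}" unfolding Y_def by auto
  have GY: "continuous_on Y G" "inj_on G Y" using G(1,2) YX continuous_on_subset inj_on_subset by blast+
  have inverse: "\<exists>s>0. \<forall>x\<in>Y. \<forall>y\<in>Y. \<bar>fst (G x) - fst (G y)\<bar> \<le> s \<longrightarrow> \<bar>snd (G x) - snd (G y)\<bar> \<le> s \<longrightarrow> dist x y \<le> d"
    if d: "d > 0" for d
  proof -
    have "continuous_on (G ` Y) (inv_into Y G)"
      using GY Y by (intro continuous_on_inv) auto
    then have "uniformly_continuous_on (G ` Y) (inv_into Y G)"
      using Y GY by (intro compact_uniformly_continuous compact_continuous_image)
    then obtain \<eta> where \<eta>: "\<eta> > 0" "\<And>p q. p \<in> G ` Y \<Longrightarrow> q \<in> G ` Y \<Longrightarrow> dist q p < \<eta> \<Longrightarrow> dist (inv_into Y G q) (inv_into Y G p) < d"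
      using d unfolding uniformly_continuous_on_def by metis
    have "dist x y \<le> d" if xy: "x \<in> Y" "y \<in> Y" "\<bar>fst (G x) - fst (G y)\<bar> \<le> \<eta> / 3" "\<bar>snd (G x) - snd (G y)\<bar> \<le> \<eta> / 3" for x y
    proof -
      have "dist (G x) (G y) = norm (fst (G x) - fst (G y), snd (G x) - snd (G y))"
        by (simp add: dist_norm flip: minus_prod_def fst_diff snd_diff)
      also have "\<dots> \<le> \<bar>fst (G x) - fst (G y)\<bar> + \<bar>snd (G x) - snd (G y)\<bar>"
        using norm_Pair_le[of "fst (G x) - fst (G y)" "snd (G x) - snd (G y)"] by simp
      also have "\<dots> < \<eta>" using xy \<eta>(1) by linarith
      finally show ?thesis using \<eta>(2)[of "G y" "G x"] xy GY(2) by fastforce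
    qed
    then show ?thesis using \<eta>(1) by (intro exI[of _ "\<eta> / 3"]) auto
  qed
  obtain s1 where s1: "s1 > 0" "\<And>x y. x \<in> Y \<Longrightarrow> y \<in> Y \<Longrightarrow> \<bar>fst (G x) - fst (G y)\<bar> \<le> s1 \<Longrightarrow> \<bar>snd (G x) - snd (G y)\<bar> \<le> s1 \<Longrightarrow> dist x y \<le> \<rho>"
    using inverse[OF \<rho>] by blast
  \<comment> \<open>an enlarged block is less than \<open>3 * m\<close> bricks wide, and its points differ by at most \<open>6 * \<sigma>\<close> in each coordinate\<close>
  define \<sigma> where "\<sigma> = s1 / 6"
  have \<sigma>: "\<sigma> > 0" using s1 unfolding \<sigma>_def by simp
  have "uniformly_continuous_on Y G" using GY(1) Y by (rule compact_uniformly_continuous)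
  then obtain \<eta> where \<eta>: "\<eta> > 0" "\<And>x y. x \<in> Y \<Longrightarrow> y \<in> Y \<Longrightarrow> dist y x < \<eta> \<Longrightarrow> dist (G y) (G x) < \<sigma> / 3"
    using \<sigma> unfolding uniformly_continuous_on_def by (metis divide_pos_pos zero_less_numeral)
  define \<rho>' where "\<rho>' = \<eta> / 2"
  have \<rho>': "\<rho>' > 0" using \<eta> unfolding \<rho>'_def by simp
  have hop: "\<bar>fst (G x) - fst (G y)\<bar> \<le> \<sigma> / 3" "\<bar>snd (G x) - snd (G y)\<bar> \<le> \<sigma> / 3"
    if "x \<in> Y" "y \<in> Y" "dist x y \<le> \<rho>'" for x y
  proof -
    have "dist (G x) (G y) < \<sigma> / 3" using \<eta>(2)[OF that(2,1)] that(3) \<eta>(1) unfolding \<rho>'_def by simp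
    moreover have "dist (fst (G x)) (fst (G y)) \<le> dist (G x) (G y)" "dist (snd (G x)) (snd (G y)) \<le> dist (G x) (G y)"
      by (rule dist_fst_le, rule dist_snd_le)
    ultimately show "\<bar>fst (G x) - fst (G y)\<bar> \<le> \<sigma> / 3" "\<bar>snd (G x) - snd (G y)\<bar> \<le> \<sigma> / 3"
      unfolding dist_real_def by linarith+
  qed
  obtain F where F: "finite F" "F \<subseteq> X" "\<And>x. x \<in> X \<Longrightarrow> \<exists>f\<in>F. dist x f \<le> \<rho>'"
    using compact_net[OF X(1) \<rho>'] by blast
  define \<delta> where "\<delta> = \<rho> / (2 * card F + 1)"
  have \<delta>: "0 < \<delta>" "\<delta> \<le> \<rho>" "2 * \<delta> * card F \<le> \<rho>"
    using \<rho> unfolding \<delta>_def by (auto simp: field_simps)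
  obtain s2 where s2: "s2 > 0" "\<And>x y. x \<in> Y \<Longrightarrow> y \<in> Y \<Longrightarrow> \<bar>fst (G x) - fst (G y)\<bar> \<le> s2 \<Longrightarrow> \<bar>snd (G x) - snd (G y)\<bar> \<le> s2 \<Longrightarrow> dist x y \<le> \<delta>"
    using inverse[OF \<delta>(1)] by blast
  define m :: int where "m = max 3 \<lceil>\<sigma> / min (s2/2) M\<rceil>"
  have m3: "3 \<le> m" "\<lceil>\<sigma> / min (s2/2) M\<rceil> \<le> m" unfolding m_def by simp_all
  then have m: "3 \<le> m" "\<sigma> / min (s2/2) M \<le> m" using ceiling_le_iff by blast+
  have m0: "0 < real_of_int m" "0 < m" using m(1) by auto
  define s where "s = \<sigma> / m"
  have s: "0 < s" "2 * s \<le> s2" "s \<le> M"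
  proof -
    show "0 < s" unfolding s_def using \<sigma> m0 by simp
    have "0 < min (s2/2) M" using s2 M by auto
    then have "\<sigma> \<le> m * min (s2/2) M" using m(2) by (simp add: pos_divide_le_eq)
    then have "s \<le> min (s2/2) M" unfolding s_def using m0 by (simp only: pos_divide_le_eq mult.commute)
    then show "2 * s \<le> s2" "s \<le> M" by auto
  qed
  have sm: "s * m = \<sigma>" unfolding s_def using m0 by simp
  define n :: int where "n = \<lceil>2 * (M / s)\<rceil> + 1"
  have Ms: "1 \<le> M / s" using s by (simp add: pos_le_divide_eq)
  have n: "2 * (M / s) \<le> real_of_int n - 1" "real_of_int n \<le> 2 * (M / s) + 2" "1 \<le> n"
  proof -
    show "2 * (M / s) \<le> real_of_int n - 1" unfolding n_def by simp
    show "real_of_int n \<le> 2 * (M / s) + 2" 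
      unfolding n_def using of_int_ceiling_le_add_one[of "2 * (M / s)"] by (simp only: of_int_add of_int_1)
    then show "1 \<le> n" using \<open>2 * (M / s) \<le> real_of_int n - 1\<close> Ms by linarith
  qed
  have ns: "s * n \<le> 4 * M"
  proof -
    have "s * n \<le> s * (2 * (M / s) + 2)" using n(2) s(1) by (intro mult_left_mono) auto
    also have "\<dots> = 2 * M + 2 * s" using s(1) by (simp add: field_simps)
    finally show ?thesis using s(3) by simp
  qed
  define P where "P = (\<lambda>x. G x /\<^sub>R s)"
  have P: "fst (G x) = s * fst (P x)" "snd (G x) = s * snd (P x)" for x
    unfolding P_def using s(1) by simp_all
  have PG: "\<bar>fst (G x) - fst (G y)\<bar> = s * \<bar>fst (P x) - fst (P y)\<bar>" "\<bar>snd (G x) - snd (G y)\<bar> = s * \<bar>snd (P x) - snd (P y)\<bar>" for x y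
    unfolding P using s(1) by (simp_all add: abs_mult flip: right_diff_distrib)
  have Pbr: "(fst (P x), snd (P x)) = P x" for x by simp
  define outer where "outer = insert z0 {x \<in> X - {z0}. P x \<in> outer_bricks n}"
  define cell where "cell = (\<lambda>v. if v \<in> lat_inner n then {x \<in> X - {z0}. P x \<in> brick v} else outer)"
  have inner_cell: "v \<in> lat_inner n \<Longrightarrow> cell v = {x \<in> X - {z0}. P x \<in> brick v}" for v unfolding cell_def by simp
  have cellY: "x \<in> Y" if "v \<in> lat_inner n" "x \<in> cell v" for x v
  proof -
    have x: "x \<in> X - {z0}" "P x \<in> brick v" using that inner_cell by auto
    have "\<bar>fst (P x)\<bar> \<le> 2 * n" "\<bar>snd (P x)\<bar> \<le> n"
      using brick_inner_bound[of "fst (P x)" "snd (P x)" v n] x that(1) by auto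
    then have "s * \<bar>fst (P x)\<bar> \<le> s * (2 * n)" "s * \<bar>snd (P x)\<bar> \<le> s * n" using s(1) by (auto intro!: mult_left_mono)
    moreover have "s * (2 * n) = 2 * (s * n)" by simp
    ultimately have "s * \<bar>fst (P x)\<bar> \<le> 10 * M" "s * \<bar>snd (P x)\<bar> \<le> 10 * M" using ns M(1) by linarith+
    then have "\<bar>fst (G x)\<bar> \<le> 10 * M" "\<bar>snd (G x)\<bar> \<le> 10 * M"
      unfolding P abs_mult using s(1) by simp_all
    then show ?thesis using x unfolding Y_def by (cases "G x") auto
  qed
  have ring: "v \<in> lat_ring n \<Longrightarrow> v \<notin> lat_inner n" for v using lat_square_split(2) by blast
  \<comment> \<open>the colour of a block is its position modulo \<open>4\<close>, since adjacent vertices in the enlargements of two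
    blocks force the positions of these to differ by at most \<open>3\<close>\<close>
  define blk where "blk = (\<lambda>v::int \<times> int. (fst v div m, snd v div m))"
  define E where "E = (\<lambda>q::int \<times> int. {v::int \<times> int. \<bar>fst v div m - fst q\<bar> \<le> 1 \<and> \<bar>snd v div m - snd q\<bar> \<le> 1})"
  define colour where "colour = (\<lambda>q::int \<times> int. nat (4 * (fst q mod 4) + snd q mod 4))"
  have "coloured_lattice_cells X z0 n cell outer \<rho> \<delta> blk E colour 16 \<rho>' F"
  proof
    show "geodesic_space X" "z0 \<in> X" "1 \<le> n" "finite F" "F \<subseteq> X" "2 * \<delta> * card F \<le> \<rho>" "0 \<le> \<delta>" "\<delta> \<le> \<rho>"
      using X n F \<delta> by auto
    show "\<exists>f\<in>F. dist x f \<le> \<rho>'" if "x \<in> X" for x using F(3)[OF that] .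
    show "z0 \<in> outer" unfolding outer_def by simp
    show "cell v \<subseteq> X" if "v \<in> lat_square n" for v unfolding cell_def outer_def using X(3) by auto
    show "closed (cell v)" if "v \<in> lat_square n" for v
    proof (cases "v \<in> lat_inner n")
      case True
      have "P x \<in> brick v \<longleftrightarrow> G x \<in> (\<lambda>z. s *\<^sub>R z) ` brick v" for x
      proof
        assume "P x \<in> brick v"
        moreover have "G x = s *\<^sub>R P x" unfolding P_def using s(1) by simp
        ultimately show "G x \<in> (\<lambda>z. s *\<^sub>R z) ` brick v" by blast
      next
        assume "G x \<in> (\<lambda>z. s *\<^sub>R z) ` brick v"
        then obtain z where z: "z \<in> brick v" "G x = s *\<^sub>R z" by blast
        have "P x = z" unfolding P_def z(2) using s(1) by simp
        then show "P x \<in> brick v" using z(1) by simp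
      qed
      then have "cell v = {x \<in> X - {z0}. G x \<in> (\<lambda>z. s *\<^sub>R z) ` brick v}" unfolding inner_cell[OF True] by blast
      also have "compact \<dots>" by (intro G(3) compact_scaling compact_brick)
      finally show ?thesis by (rule compact_imp_closed)
    next
      case False
      have "continuous_on (X - {z0}) P" unfolding P_def by (intro continuous_intros G(1))
      then have "openin (top_of_set (X - {z0})) ((X - {z0}) \<inter> P -` (- outer_bricks n))"
        using closed_outer_bricks by (intro continuous_openin_preimage_gen) auto
      moreover have "openin (top_of_set X) (X - {z0})" by (simp add: openin_delete)
      ultimately have "openin (top_of_set X) ((X - {z0}) \<inter> P -` (- outer_bricks n))" using openin_trans by blast
      moreover have "X - ((X - {z0}) \<inter> P -` (- outer_bricks n)) = outer" using X(3) unfolding outer_def by auto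
      ultimately have "closedin (top_of_set X) outer" by (metis closedin_diff closedin_topspace topspace_euclidean_subtopology closedin_subtopology_refl openin_subset)
      then have "closed outer" using X(1) closedin_closed_trans compact_imp_closed by blast
      then show ?thesis using False unfolding cell_def by simp
    qed
    show "X \<subseteq> (\<Union>v\<in>lat_square n. cell v)"
    proof
      fix x assume x: "x \<in> X"
      have r: "(-n,-n) \<in> lat_ring n" using n(3) by (auto simp: lat_ring_def lat_square_def lat_inner_def)
      show "x \<in> (\<Union>v\<in>lat_square n. cell v)"
      proof (cases "x \<in> outer")
        case True
        then have "x \<in> cell (-n,-n)" unfolding cell_def using ring[OF r] by simp
        then show ?thesis using r lat_square_split(1) by blast
      next
        case False
        then obtain v where "v \<in> lat_inner n" "P x \<in> brick v"
          using bricks_cover[of "P x" n] x unfolding outer_def by blast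
        then show ?thesis using inner_cell x False lat_square_split(1) unfolding outer_def by blast
      qed
    qed
    show "lat_adj v w" if "v \<in> lat_inner n" "w \<in> lat_inner n" "v \<noteq> w" "cell v \<inter> cell w \<noteq> {}" for v w
      using that bricks_adj inner_cell by blast
    show "cell v = outer" if "v \<in> lat_ring n" for v unfolding cell_def using ring[OF that] by simp
    show "dist z0 x \<le> \<rho>" if x: "x \<in> outer" for x
    proof (rule ccontr)
      assume far: "\<not> dist z0 x \<le> \<rho>"
      then have xz: "x \<noteq> z0" using \<rho> by auto
      then have xo: "x \<in> X" "P x \<in> outer_bricks n" using x unfolding outer_def by auto
      have "norm (G x) < M" using M(2) xo(1) far by simp
      then have "\<bar>fst (G x)\<bar> < M" "\<bar>snd (G x)\<bar> < M"
        using norm_fst_le[of "fst (G x)" "snd (G x)"] norm_snd_le[of "snd (G x)" "fst (G x)"] by auto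
      then have "\<bar>fst (P x)\<bar> < M / s" "\<bar>snd (P x)\<bar> < M / s"
        unfolding P using s(1) by (auto simp: abs_mult pos_less_divide_eq mult.commute)
      then show False using outer_bricks_far[of "fst (P x)" "snd (P x)" n "M / s"] xo Ms n(1) by simp
    qed
    show "\<exists>p\<in>lat_ring n. lat_adj v p" if "v \<in> lat_inner n" "cell v \<inter> outer \<noteq> {}" for v
      using that bricks_outer_adj[of _ v n] inner_cell[OF that(1)] unfolding outer_def by blast
    show "dist x y \<le> \<delta>" if v: "v \<in> lat_inner n" "x \<in> cell v" "y \<in> cell v" for v x y
    proof (rule s2(2)[OF cellY[OF v(1,2)] cellY[OF v(1,3)]])
      have "(fst (P x), snd (P x)) \<in> brick v" "(fst (P y), snd (P y)) \<in> brick v" using v inner_cell by auto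
      from bricks_points_near[OF this, of 1]
      have d: "\<bar>fst (P x) - fst (P y)\<bar> \<le> 2" "\<bar>snd (P x) - snd (P y)\<bar> \<le> 2" by auto
      have "s * \<bar>fst (P x) - fst (P y)\<bar> \<le> s * 2" "s * \<bar>snd (P x) - snd (P y)\<bar> \<le> s * 2"
        using d s(1) by (auto intro!: mult_left_mono)
      then show "\<bar>fst (G x) - fst (G y)\<bar> \<le> s2" "\<bar>snd (G x) - snd (G y)\<bar> \<le> s2" unfolding PG using s(2) by auto
    qed
    show "dist x y \<le> \<rho>" if v: "v \<in> lat_inner n" "w \<in> lat_inner n" "v \<in> E q" "w \<in> E q" "x \<in> cell v" "y \<in> cell w" for v w q x y
    proof (rule s1(2)[OF cellY[OF v(1,5)] cellY[OF v(2,6)]])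
      have b: "(fst (P x), snd (P x)) \<in> brick v" "(fst (P y), snd (P y)) \<in> brick w" using v inner_cell by auto
      have "\<bar>fst v - fst w\<bar> < 3 * m" "\<bar>snd v - snd w\<bar> < 3 * m"
        using div_far[OF m0(2)] v(3,4) unfolding E_def by blast+
      from bricks_points_near[OF b this]
      have d: "\<bar>fst (P x) - fst (P y)\<bar> \<le> 6 * m" "\<bar>snd (P x) - snd (P y)\<bar> \<le> 6 * m" using m0 by auto
      have "s * \<bar>fst (P x) - fst (P y)\<bar> \<le> s * (6 * m)" "s * \<bar>snd (P x) - snd (P y)\<bar> \<le> s * (6 * m)"
        using d s(1) by (auto intro!: mult_left_mono)
      moreover have "s * (6 * m) = s1" using sm unfolding \<sigma>_def by (simp add: field_simps)
      ultimately show "\<bar>fst (G x) - fst (G y)\<bar> \<le> s1" "\<bar>snd (G x) - snd (G y)\<bar> \<le> s1" unfolding PG by auto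
    qed
    show "q = q'" if q: "colour q = colour q'" "v \<in> E q" "w \<in> E q'" "lat_adj v w" for q q' v w
    proof -
      have "\<bar>fst v - fst w\<bar> \<le> m" "\<bar>snd v - snd w\<bar> \<le> m" using q(4) m(1) unfolding lat_adj_def by auto
      then have "\<bar>fst v div m - fst w div m\<bar> \<le> 1" "\<bar>snd v div m - snd w div m\<bar> \<le> 1"
        using div_near[OF m0(2)] by blast+
      then have d: "\<bar>fst q - fst q'\<bar> \<le> 3" "\<bar>snd q - snd q'\<bar> \<le> 3" 
        using q(2,3) unfolding E_def mem_Collect_eq by linarith+
      have "4 * (fst q mod 4) + snd q mod 4 = 4 * (fst q' mod 4) + snd q' mod 4"
        using q(1) unfolding colour_def by (simp add: eq_nat_nat_iff)
      moreover have "0 \<le> snd q mod 4" "snd q mod 4 < 4" "0 \<le> snd q' mod 4" "snd q' mod 4 < 4" by simp_all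
      ultimately have "fst q mod 4 = fst q' mod 4 \<and> snd q mod 4 = snd q' mod 4" by presburger
      then show "q = q'" using mod4_eq d by (intro prod_eqI) blast+
    qed
    show "colour q < 16" for q
      unfolding colour_def using pos_mod_bound[of 4 "snd q"] pos_mod_bound[of 4 "fst q"] by (simp add: nat_less_iff)
    show "w \<in> E (blk v)" if v: "v \<in> lat_inner n" "w \<in> lat_inner n" "x \<in> cell v" "y \<in> cell w" "dist x y \<le> \<rho>'" for v w x y
    proof -
      have b: "(fst (P x), snd (P x)) \<in> brick v" "(fst (P y), snd (P y)) \<in> brick w" using v inner_cell by auto
      have h: "s * \<bar>fst (P x) - fst (P y)\<bar> \<le> s * (m / 3)" "s * \<bar>snd (P x) - snd (P y)\<bar> \<le> s * (m / 3)"
        using hop[OF cellY[OF v(1,3)] cellY[OF v(2,4)] v(5)] sm unfolding PG by auto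
      then have "\<bar>fst (P x) - fst (P y)\<bar> \<le> m / 3" "\<bar>snd (P x) - snd (P y)\<bar> \<le> m / 3" using s(1) by auto
      from bricks_labels_near[OF b this m(1)]
      have "\<bar>fst w - fst v\<bar> \<le> m" "\<bar>snd w - snd v\<bar> \<le> m" by auto
      then show ?thesis using div_near[OF m0(2)] unfolding E_def blk_def by auto
    qed
  qed
  then interpret coloured_lattice_cells X z0 n cell outer \<rho> \<delta> blk E colour 16 \<rho>' F .
  obtain pth gam len where "guarded_cells X z0 n cell pth gam len (\<rho> + 2 * (real (16 + 1) * \<rho>))"
    using exists_guarded_cells by blast
  moreover have "\<rho> + 2 * (real (16 + 1) * \<rho>) = 35 * \<rho>" by simp
  ultimately show thesis using that by metis
qed

theorem theorem14:
  fixes X :: "'a::metric_space set"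
  assumes "compact_geodesic_surface X"
    and "\<exists>S. S \<subseteq> sphere (0 :: real^3) 1 \<and> X homeomorphic S"
  shows "cop_number X \<le> 3"
proof -
  have X: "compact X" "geodesic_space X" using assms(1) unfolding compact_geodesic_surface_def by auto
  obtain S :: "(real^3) set" where S: "S \<subseteq> sphere 0 1" "X homeomorphic S" using assms(2) by blast
  have "cops_win X 3"
  proof (rule cops_winI[OF X(2)])
    fix \<tau> and e :: real and r and c :: "nat \<Rightarrow> 'a"
    assume h: "\<tau> \<in> agility_functions" "e > 0" "r \<in> X" "\<forall>i<3. c i \<in> X"
    obtain n cell pth gam len where "guarded_cells X r n cell pth gam len (35 * (e / 35))"
      using fine_guarded_cells[OF X h(3) S, of "e / 35"] h(2) by (metis divide_pos_pos zero_less_numeral)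
    then interpret guarded_cells X r n cell pth gam len e by simp
    show "cops_reach X 3 \<tau> e 0 r c" by (rule three_cops_reach[OF h(1,3,4)])
  qed simp
  then have "(3::nat) \<in> {k. 1 \<le> k \<and> cops_win X k}" by simp
  then have "cop_number X \<le> enat 3" unfolding cop_number_def by (rule INF_lower)
  then show ?thesis by (simp add: numeral_eq_enat)
qed

end
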